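(* Let $\Omega\subset\mathbb{R}^d$ be a bounded domain with smooth boundary, $0<m\le1$, and let $S$ be a bounded positive function on $\Omega$ for which there are constants $0<k_0\le k_1$ with $$k_0\,\Phi_1(x)\le S(x)^m\le k_1\,\Phi_1(x)\qquad\text{for all }x\in\Omega.$$ Let $f\in W^{1,2}_0(\Omega)$ and $g=f/\Phi_1$. Then $$\frac{(\lambda_2-\lambda_1)\,k_0^2}{k_1^2\,\|S\|_\infty^{1-m}}\int_\Omega|g-\overline g|^2S^{1+m}dx\le\int_\Omega|\nabla g|^2S^{2m}dx,\qquad \overline g=\frac{\int_\Omega gS^{1+m}dx}{\int_\Omega S^{1+m}dx}.$$
   Context: $0<\lambda_1<\lambda_2$ are the first two eigenvalues of the Dirichlet Laplacian on $\Omega$ and $\Phi_1>0$ the first eigenfunction with $\|\Phi_1\|_2=1$. It is known that $(\lambda_2-\lambda_1)\int_\Omega|g-g_{\Phi_1}|^2\Phi_1^2dx\le\int_\Omega|\nabla g|^2\Phi_1^2dx$ with $g_{\Phi_1}=\int g\Phi_1^2/\int\Phi_1^2$. *)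

theory Defs
  imports "HOL-Analysis.Analysis" "HOL-Probability.Essential_Supremum"
begin

fun iter_dderiv :: "'a::euclidean_space list \<Rightarrow> ('a \<Rightarrow> real) \<Rightarrow> 'a \<Rightarrow> real" where
  "iter_dderiv [] f = f"
| "iter_dderiv (v # vs) f = (\<lambda>x. frechet_derivative (iter_dderiv vs f) (at x) v)"

definition smooth_on :: "'a::euclidean_space set \<Rightarrow> ('a \<Rightarrow> real) \<Rightarrow> bool" where
  "smooth_on U f \<longleftrightarrow>
     (\<forall>vs. set vs \<subseteq> Basis \<longrightarrow> (\<forall>x\<in>U. iter_dderiv vs f differentiable (at x)))"

definition smooth_bounded_domain :: "'a::euclidean_space set \<Rightarrow> bool" where
  "smooth_bounded_domain \<Omega> \<longleftrightarrow>
     \<Omega> \<noteq> {} \<and> open \<Omega> \<and> connected \<Omega> \<and> bounded \<Omega> \<and>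
     (\<forall>p\<in>frontier \<Omega>. \<exists>U \<rho>. open U \<and> p \<in> U \<and> smooth_on U \<rho> \<and>
        (\<forall>x\<in>U. \<exists>i\<in>Basis. frechet_derivative \<rho> (at x) i \<noteq> 0) \<and>
        \<Omega> \<inter> U = {x\<in>U. \<rho> x < 0})"

definition grad :: "('a::euclidean_space \<Rightarrow> real) \<Rightarrow> 'a \<Rightarrow> 'a" where
  "grad f x = (\<Sum>i\<in>Basis. frechet_derivative f (at x) i *\<^sub>R i)"

definition test_fun :: "'a::euclidean_space set \<Rightarrow> ('a \<Rightarrow> real) \<Rightarrow> bool" where
  "test_fun \<Omega> \<phi> \<longleftrightarrow> smooth_on UNIV \<phi> \<and> compact (closure {x. \<phi> x \<noteq> 0})
      \<and> closure {x. \<phi> x \<noteq> 0} \<subseteq> \<Omega>"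

definition weak_grad :: "'a::euclidean_space set \<Rightarrow> ('a \<Rightarrow> real) \<Rightarrow> ('a \<Rightarrow> 'a) \<Rightarrow> bool" where
  "weak_grad \<Omega> g G \<longleftrightarrow>
     (\<forall>K. compact K \<and> K \<subseteq> \<Omega> \<longrightarrow> set_integrable lebesgue K g \<and> set_integrable lebesgue K G) \<and>
     (\<forall>\<phi>. test_fun \<Omega> \<phi> \<longrightarrow> (\<forall>i\<in>Basis.
        (LINT x:\<Omega>|lebesgue. g x * (grad \<phi> x \<bullet> i)) = - (LINT x:\<Omega>|lebesgue. (G x \<bullet> i) * \<phi> x)))"

definition H01 :: "'a::euclidean_space set \<Rightarrow> ('a \<Rightarrow> real) \<Rightarrow> ('a \<Rightarrow> 'a) \<Rightarrow> bool" where
  "H01 \<Omega> f Df \<longleftrightarrow>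
     f \<in> borel_measurable (lebesgue_on \<Omega>) \<and> Df \<in> borel_measurable (lebesgue_on \<Omega>) \<and>
     (\<integral>\<^sup>+x\<in>\<Omega>. ennreal ((f x)\<^sup>2) \<partial>lebesgue) < \<infinity> \<and>
     (\<integral>\<^sup>+x\<in>\<Omega>. ennreal ((norm (Df x))\<^sup>2) \<partial>lebesgue) < \<infinity> \<and>
     (\<exists>\<phi>. (\<forall>n. test_fun \<Omega> (\<phi> n)) \<and>
        (\<lambda>n. \<integral>\<^sup>+x\<in>\<Omega>. ennreal ((\<phi> n x - f x)\<^sup>2 + (norm (grad (\<phi> n) x - Df x))\<^sup>2) \<partial>lebesgue)
          \<longlonglongrightarrow> 0)"

definition W012_0 :: "'a::euclidean_space set \<Rightarrow> ('a \<Rightarrow> real) set" where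
  "W012_0 \<Omega> = {f. \<exists>Df. H01 \<Omega> f Df}"

definition dirichlet_eigenpair :: "'a::euclidean_space set \<Rightarrow> real \<Rightarrow> ('a \<Rightarrow> real) \<Rightarrow> bool" where
  "dirichlet_eigenpair \<Omega> lam u \<longleftrightarrow>
     (\<exists>Du. H01 \<Omega> u Du \<and>
        (\<integral>\<^sup>+x\<in>\<Omega>. ennreal ((u x)\<^sup>2) \<partial>lebesgue) > 0 \<and>
        (\<forall>\<phi>. test_fun \<Omega> \<phi> \<longrightarrow>
           (LINT x:\<Omega>|lebesgue. Du x \<bullet> grad \<phi> x) = lam * (LINT x:\<Omega>|lebesgue. u x * \<phi> x)))"

definition dirichlet_eigenvalue :: "'a::euclidean_space set \<Rightarrow> real \<Rightarrow> bool" where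
  "dirichlet_eigenvalue \<Omega> lam \<longleftrightarrow> (\<exists>u. dirichlet_eigenpair \<Omega> lam u)"

end

(*
  Write f = g \<Phi> with \<Phi> the ground state.  Jacobi's identity (Picone) turns the Dirichlet energy
  into int |grad f|^2 - lam1 int f^2 = int |grad g|^2 \<Phi>^2.  If the left-hand side vanishes, g is
  constant, so lam1 is simple; by Rellich compactness the Rayleigh quotient attains its minimum on
  the orthogonal complement of \<Phi>, hence that minimum is an eigenvalue above lam1, and the Poincare
  inequality for \<Phi>^2 with constant lam2 - lam1 follows.  Replacing \<Phi>^2 by S^(1+m) and S^(2m)
  costs the stated constants, because the mean is the best constant in the weighted L2 norm.

  Dividing by \<Phi>, which is only an L2 class, needs a positive essential lower bound on compact sets.
  It comes from the mean value property: smooth weighted means of a superharmonic function decrease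
  with the radius.
*)
theory Submission
  imports Defs "HOL-Complex_Analysis.Great_Picard" "HOL-Library.Diagonal_Subsequence"
begin

section \<open>Square integrable functions\<close>

text \<open>All estimates are made in the unweighted space L2 over \<Omega>. For v = g \<Phi> the
  vector field \<Phi> grad g equals Dv - (v/\<Phi>) D\<Phi>, which involves no derivative of a
  quotient; this is \<open>ground_grad\<close>, and its squared norm is the weighted energy.

  The obstacle is that \<Phi> is only a limit of test functions, so \<phi>^2/\<Phi> is not an
  obvious test function. Two limits replace it: 1/s becomes s/(s^2 + d^2), \<Phi> is approximated
  with d fixed, and then d tends to 0 under bounds supplied by the lower bound on compact sets. The
  passage from test functions to all of \<open>H01\<close> comes from the identity itself: as lam1
  >= 0, the transformed function is controlled by the gradient.

  Of the spectrum only one minimizer is constructed. Its value is an eigenvalue different from lam1,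
  hence at least lam2, because lam2 is by definition the next eigenvalue.

  The constants come from S^(1+m) = S^(1-m) (S^m)^2 with S^m <= k1 \<Phi>, and from S^(2m) >= k0^2
  \<Phi>^2.\<close>

definition L2 :: "'a measure \<Rightarrow> ('a \<Rightarrow> 'b::euclidean_space) \<Rightarrow> bool" where
  "L2 M u \<longleftrightarrow> u \<in> borel_measurable M \<and> integrable M (\<lambda>x. (norm (u x))\<^sup>2)"

definition L2norm :: "'a measure \<Rightarrow> ('a \<Rightarrow> 'b::euclidean_space) \<Rightarrow> real" where
  "L2norm M u = sqrt (\<integral>x. (norm (u x))\<^sup>2 \<partial>M)"

text \<open>Functions are kept as functions, not as classes modulo null sets, so that pointwise
  facts about \<Phi>, S and g remain usable. Membership in L2 is part of the notion because a
  Bochner integral of a non-integrable function defaults to 0, which would make small norms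
  meaningless.\<close>

definition L2conv :: "'a measure \<Rightarrow> (nat \<Rightarrow> 'a \<Rightarrow> 'b::euclidean_space) \<Rightarrow> ('a \<Rightarrow> 'b) \<Rightarrow> bool" where
  "L2conv M u v \<longleftrightarrow> (\<forall>n. L2 M (u n)) \<and> L2 M v \<and> (\<lambda>n. L2norm M (\<lambda>x. u n x - v x)) \<longlonglongrightarrow> 0"

lemma L2_measurable [measurable_dest]: "L2 M u \<Longrightarrow> u \<in> borel_measurable M"
  by (simp add: L2_def)

lemma L2_bound:
  assumes "u \<in> borel_measurable M" "integrable M w" "AE x in M. (norm (u x))\<^sup>2 \<le> w x"
  shows "L2 M u"
  unfolding L2_def
proof
  note [measurable] = assms(1)
  show "integrable M (\<lambda>x. (norm (u x))\<^sup>2)"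
    by (rule Bochner_Integration.integrable_bound[OF assms(2)])
       (use assms(3) in \<open>auto elim!: eventually_mono\<close>)
qed (fact assms(1))

lemma L2norm_nonneg [simp]: "0 \<le> L2norm M u"
  by (simp add: L2norm_def)

lemma L2norm_sq: "(L2norm M u)\<^sup>2 = (\<integral>x. (norm (u x))\<^sup>2 \<partial>M)"
  by (simp add: L2norm_def)

lemma norm_add_sq_le: "(norm (a + b))\<^sup>2 \<le> 2 * (norm a)\<^sup>2 + 2 * (norm b)\<^sup>2"
  for a b :: "'b::real_normed_vector"
proof -
  have "(norm (a + b))\<^sup>2 \<le> (norm a + norm b)\<^sup>2"
    by (intro power_mono norm_triangle_ineq) auto
  also have "\<dots> \<le> 2 * (norm a)\<^sup>2 + 2 * (norm b)\<^sup>2"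
    using sum_squares_ge_zero[of "norm a - norm b" 0]
    by (simp add: power2_eq_square algebra_simps)
  finally show ?thesis .
qed

lemma L2_zero [simp]: "L2 M (\<lambda>x. 0)"
  by (simp add: L2_def)

lemma L2_add: "L2 M u \<Longrightarrow> L2 M v \<Longrightarrow> L2 M (\<lambda>x. u x + v x)"
  by (rule L2_bound[where w = "\<lambda>x. 2 * (norm (u x))\<^sup>2 + 2 * (norm (v x))\<^sup>2"])
     (auto simp: L2_def norm_add_sq_le)

lemma L2_bmult:
  fixes b :: "'a \<Rightarrow> real"
  assumes "b \<in> borel_measurable M" "AE x in M. \<bar>b x\<bar> \<le> C" "L2 M u"
  shows "L2 M (\<lambda>x. b x *\<^sub>R u x)"
proof (rule L2_bound[where w = "\<lambda>x. C\<^sup>2 * (norm (u x))\<^sup>2"])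
  show "AE x in M. (norm (b x *\<^sub>R u x))\<^sup>2 \<le> C\<^sup>2 * (norm (u x))\<^sup>2"
    using assms(2)
  proof eventually_elim
    case (elim x)
    then have "\<bar>b x\<bar>\<^sup>2 \<le> C\<^sup>2" by (intro power_mono) auto
    then show ?case by (simp add: power_mult_distrib mult_right_mono)
  qed
qed (use assms in \<open>auto simp: L2_def\<close>)

lemma L2_scaleR: "L2 M u \<Longrightarrow> L2 M (\<lambda>x. c *\<^sub>R u x)"
  by (rule L2_bmult[where C = "\<bar>c\<bar>"]) auto

lemma L2_cmult: "L2 M u \<Longrightarrow> L2 M (\<lambda>x. c * u x)" for u :: "'a \<Rightarrow> real"
  using L2_scaleR[of M u c] by simp

lemma L2_diff: "L2 M u \<Longrightarrow> L2 M v \<Longrightarrow> L2 M (\<lambda>x. u x - v x)"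
  using L2_add[of M u "\<lambda>x. (-1) *\<^sub>R v x"] L2_scaleR[of M v "-1"] by simp

lemma L2_inner_left: "L2 M u \<Longrightarrow> L2 M (\<lambda>x. u x \<bullet> i)"
proof (rule L2_bound[where w = "\<lambda>x. (norm (u x))\<^sup>2 * (norm i)\<^sup>2"], goal_cases)
  case 3
  show ?case
    by (rule AE_I2) (metis Cauchy_Schwarz_ineq2 abs_ge_zero power_mono power_mult_distrib real_norm_def)
qed (auto simp: L2_def)

lemma L2norm_cong_AE:
  assumes "AE x in M. norm (u x) = norm (v x)" "u \<in> borel_measurable M" "v \<in> borel_measurable M"
  shows "L2norm M u = L2norm M v"
proof -
  have "(\<integral>x. (norm (u x))\<^sup>2 \<partial>M) = (\<integral>x. (norm (v x))\<^sup>2 \<partial>M)"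
    using assms by (intro integral_cong_AE) auto
  then show ?thesis by (simp add: L2norm_def)
qed

lemma L2norm_minus_commute: "L2norm M (\<lambda>x. u x - v x) = L2norm M (\<lambda>x. v x - u x)"
  by (simp add: L2norm_def norm_minus_commute)

lemma L2norm_scaleR: "L2norm M (\<lambda>x. c *\<^sub>R u x) = \<bar>c\<bar> * L2norm M u"
  by (simp add: L2norm_def power_mult_distrib real_sqrt_mult)

lemma integrable_norm_prod:
  assumes "L2 M u" "L2 M v"
  shows "integrable M (\<lambda>x. norm (u x) * norm (v x))"
proof (rule Bochner_Integration.integrable_bound[where f = "\<lambda>x. (norm (u x))\<^sup>2 + (norm (v x))\<^sup>2"])
  note [measurable] = assms
  show "AE x in M. norm (norm (u x) * norm (v x)) \<le> norm ((norm (u x))\<^sup>2 + (norm (v x))\<^sup>2)"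
  proof (rule AE_I2)
    fix x
    have "2 * (norm (u x) * norm (v x)) \<le> (norm (u x))\<^sup>2 + (norm (v x))\<^sup>2"
      using sum_squares_bound[of "norm (u x)" "norm (v x)"] by (simp add: mult.assoc)
    moreover have "0 \<le> norm (u x) * norm (v x)" by simp
    ultimately have "norm (u x) * norm (v x) \<le> (norm (u x))\<^sup>2 + (norm (v x))\<^sup>2" by linarith
    then show "norm (norm (u x) * norm (v x)) \<le> norm ((norm (u x))\<^sup>2 + (norm (v x))\<^sup>2)"
      by (simp add: abs_mult)
  qed
  show "integrable M (\<lambda>x. (norm (u x))\<^sup>2 + (norm (v x))\<^sup>2)"
    using assms by (auto simp: L2_def)
qed (use assms in \<open>auto simp: L2_def\<close>)

lemma integrable_inner:
  assumes "L2 M u" "L2 M v"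
  shows "integrable M (\<lambda>x. u x \<bullet> v x)"
  by (rule Bochner_Integration.integrable_bound[OF integrable_norm_prod[OF assms]])
     (use assms in \<open>auto simp: L2_def Cauchy_Schwarz_ineq2 abs_mult\<close>)

lemma integrable_mult_L2:
  fixes u v :: "'a \<Rightarrow> real"
  assumes "L2 M u" "L2 M v"
  shows "integrable M (\<lambda>x. u x * v x)"
  using integrable_inner[OF assms] by simp

text \<open>The discriminant argument: the integral of (t|u| - |v|)^2 is a quadratic in t that never
  becomes negative.\<close>

lemma CS_norm:
  assumes "L2 M u" "L2 M v"
  shows "(\<integral>x. norm (u x) * norm (v x) \<partial>M) \<le> L2norm M u * L2norm M v"
proof -
  define A where "A = (L2norm M u)\<^sup>2"
  define B where "B = (\<integral>x. norm (u x) * norm (v x) \<partial>M)"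
  define C where "C = (L2norm M v)\<^sup>2"
  have i: "integrable M (\<lambda>x. (norm (u x))\<^sup>2)" "integrable M (\<lambda>x. (norm (v x))\<^sup>2)"
    "integrable M (\<lambda>x. norm (u x) * norm (v x))"
    using assms integrable_norm_prod[OF assms] by (auto simp: L2_def)
  have q: "0 \<le> t\<^sup>2 * A - 2 * t * B + C" for t
  proof -
    have "0 \<le> (\<integral>x. (t * norm (u x) - norm (v x))\<^sup>2 \<partial>M)" by simp
    also have "(\<lambda>x. (t * norm (u x) - norm (v x))\<^sup>2) =
        (\<lambda>x. t\<^sup>2 * (norm (u x))\<^sup>2 - 2 * t * (norm (u x) * norm (v x)) + (norm (v x))\<^sup>2)"
      by (auto simp: power2_eq_square algebra_simps)
    also have "(\<integral>x. t\<^sup>2 * (norm (u x))\<^sup>2 - 2 * t * (norm (u x) * norm (v x)) + (norm (v x))\<^sup>2 \<partial>M)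
        = t\<^sup>2 * A - 2 * t * B + C"
      using i by (simp add: A_def B_def C_def L2norm_sq)
    finally show ?thesis .
  qed
  have "B\<^sup>2 \<le> A * C"
  proof (cases "A = 0")
    case True
    have "B = 0"
    proof (rule ccontr)
      assume "B \<noteq> 0"
      \<comment> \<open>For A = 0 the quadratic is C - 2tB, and this choice of t gives it the value
        -1.\<close>
      then show False using q[of "(C + 1) / (2 * B)"] True by (simp add: field_simps)
    qed
    then show ?thesis using True by simp
  next
    case False
    then have "A > 0" by (simp add: A_def)
    then show ?thesis using q[of "B / A"]
      by (simp add: field_simps power2_eq_square)
  qed
  then have "B\<^sup>2 \<le> (L2norm M u * L2norm M v)\<^sup>2" by (simp add: A_def C_def power_mult_distrib)
  then show ?thesis unfolding B_def by (rule power2_le_imp_le) simp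
qed

lemma CS_inner:
  assumes "L2 M u" "L2 M v"
  shows "\<bar>\<integral>x. u x \<bullet> v x \<partial>M\<bar> \<le> L2norm M u * L2norm M v"
proof -
  have "\<bar>\<integral>x. u x \<bullet> v x \<partial>M\<bar> \<le> (\<integral>x. \<bar>u x \<bullet> v x\<bar> \<partial>M)"
    using integral_norm_bound[of M "\<lambda>x. u x \<bullet> v x"] by simp
  also have "\<dots> \<le> (\<integral>x. norm (u x) * norm (v x) \<partial>M)"
    using integrable_inner[OF assms] integrable_norm_prod[OF assms]
    by (intro integral_mono) (auto simp: Cauchy_Schwarz_ineq2)
  also have "\<dots> \<le> L2norm M u * L2norm M v" by (rule CS_norm[OF assms])
  finally show ?thesis .
qed

lemma L2norm_add_sq:
  assumes "L2 M u" "L2 M v"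
  shows "(L2norm M (\<lambda>x. u x + v x))\<^sup>2 = (L2norm M u)\<^sup>2 + 2 * (\<integral>x. u x \<bullet> v x \<partial>M) + (L2norm M v)\<^sup>2"
proof -
  have "(\<lambda>x. (norm (u x + v x))\<^sup>2) = (\<lambda>x. (norm (u x))\<^sup>2 + 2 * (u x \<bullet> v x) + (norm (v x))\<^sup>2)"
    by (auto simp: power2_norm_eq_inner inner_simps inner_commute)
  then show ?thesis
    using assms integrable_inner[OF assms] by (simp add: L2norm_sq L2_def)
qed

lemma L2norm_triangle:
  assumes "L2 M u" "L2 M v"
  shows "L2norm M (\<lambda>x. u x + v x) \<le> L2norm M u + L2norm M v"
proof (rule power2_le_imp_le)
  show "(L2norm M (\<lambda>x. u x + v x))\<^sup>2 \<le> (L2norm M u + L2norm M v)\<^sup>2"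
    using CS_inner[OF assms] by (simp add: L2norm_add_sq[OF assms] power2_sum)
qed simp

lemma L2norm_triangle_diff:
  assumes "L2 M u" "L2 M v" "L2 M w"
  shows "L2norm M (\<lambda>x. u x - w x) \<le> L2norm M (\<lambda>x. u x - v x) + L2norm M (\<lambda>x. v x - w x)"
  using L2norm_triangle[of M "\<lambda>x. u x - v x" "\<lambda>x. v x - w x"] assms by (simp add: L2_diff)

lemma L2norm_triangle_sub:
  assumes "L2 M u" "L2 M v"
  shows "L2norm M u \<le> L2norm M (\<lambda>x. u x - v x) + L2norm M v"
  using L2norm_triangle[of M "\<lambda>x. u x - v x" v] assms by (simp add: L2_diff)

lemma L2norm_diff_le:
  assumes "L2 M u" "L2 M v"
  shows "\<bar>L2norm M u - L2norm M v\<bar> \<le> L2norm M (\<lambda>x. u x - v x)"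
  using L2norm_triangle_sub[OF assms] L2norm_triangle_sub[OF assms(2,1)]
  by (simp add: L2norm_minus_commute[of M v u])

lemma L2norm_mono_AE:
  assumes "L2 M v" "u \<in> borel_measurable M" "AE x in M. norm (u x) \<le> norm (v x)"
  shows "L2norm M u \<le> L2norm M v"
proof -
  have *: "AE x in M. (norm (u x))\<^sup>2 \<le> (norm (v x))\<^sup>2"
    using assms(3) by eventually_elim (auto intro: power_mono)
  have "L2 M u" using * assms by (intro L2_bound) (auto simp: L2_def)
  then have "(\<integral>x. (norm (u x))\<^sup>2 \<partial>M) \<le> (\<integral>x. (norm (v x))\<^sup>2 \<partial>M)"
    using * assms by (intro integral_mono_AE) (auto simp: L2_def)
  then show ?thesis by (simp add: L2norm_def)
qed

lemma L2norm_bmult_le: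
  fixes b :: "'a \<Rightarrow> real"
  assumes "b \<in> borel_measurable M" "AE x in M. \<bar>b x\<bar> \<le> C" "0 \<le> C" "L2 M u"
  shows "L2norm M (\<lambda>x. b x *\<^sub>R u x) \<le> C * L2norm M u"
proof -
  note [measurable] = assms(1,4)
  have "L2norm M (\<lambda>x. b x *\<^sub>R u x) \<le> L2norm M (\<lambda>x. C *\<^sub>R u x)"
    using assms(2) by (intro L2norm_mono_AE L2_scaleR assms)
      (auto elim!: eventually_mono intro: mult_right_mono order_trans[OF _ abs_ge_self])
  then show ?thesis using assms(3) by (simp add: L2norm_scaleR)
qed

lemma L2convD:
  assumes "L2conv M u v"
  shows "L2 M (u n)" "L2 M v" "(\<lambda>n. L2norm M (\<lambda>x. u n x - v x)) \<longlonglongrightarrow> 0"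
  using assms by (auto simp: L2conv_def)

lemma L2conv_const: "L2 M u \<Longrightarrow> L2conv M (\<lambda>n. u) u"
  by (simp add: L2conv_def L2norm_def)

lemma L2conv_subseq: "L2conv M u v \<Longrightarrow> strict_mono r \<Longrightarrow> L2conv M (\<lambda>n. u (r n)) v"
  unfolding L2conv_def
  using LIMSEQ_subseq_LIMSEQ[of "\<lambda>n. L2norm M (\<lambda>x. u n x - v x)" 0 r] by (auto simp: o_def)

lemma L2conv_L2norm:
  assumes "L2conv M u v"
  shows "(\<lambda>n. L2norm M (u n)) \<longlonglongrightarrow> L2norm M v"
proof -
  note c = L2convD[OF assms]
  have "(\<lambda>n. L2norm M (u n) - L2norm M v) \<longlonglongrightarrow> 0"
    by (rule Lim_null_comparison[OF _ c(3)]) (auto intro!: L2norm_diff_le c eventuallyI)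
  then show ?thesis by (simp add: LIM_zero_iff)
qed

lemma squeeze_null:
  fixes f g :: "nat \<Rightarrow> real"
  assumes "\<And>n. norm (f n) \<le> g n" "g \<longlonglongrightarrow> 0"
  shows "f \<longlonglongrightarrow> 0"
  by (rule Lim_null_comparison[OF always_eventually assms(2)]) (use assms(1) in blast)

lemma L2conv_add:
  assumes "L2conv M u v" "L2conv M u' v'"
  shows "L2conv M (\<lambda>n x. u n x + u' n x) (\<lambda>x. v x + v' x)"
proof -
  note c = L2convD[OF assms(1)] and c' = L2convD[OF assms(2)]
  have "norm (L2norm M (\<lambda>x. (u n x + u' n x) - (v x + v' x))) \<le>
      L2norm M (\<lambda>x. u n x - v x) + L2norm M (\<lambda>x. u' n x - v' x)" for n
    using L2norm_triangle[OF L2_diff[OF c(1)[of n] c(2)] L2_diff[OF c'(1)[of n] c'(2)]]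
    by (simp add: algebra_simps)
  then have "(\<lambda>n. L2norm M (\<lambda>x. (u n x + u' n x) - (v x + v' x))) \<longlonglongrightarrow> 0"
    by (rule squeeze_null) (use tendsto_add[OF c(3) c'(3)] in simp)
  then show ?thesis using c c' by (auto simp: L2conv_def intro: L2_add)
qed

lemma L2conv_scaleR:
  assumes "L2conv M u v"
  shows "L2conv M (\<lambda>n x. c *\<^sub>R u n x) (\<lambda>x. c *\<^sub>R v x)"
  using assms tendsto_mult[OF tendsto_const[of "\<bar>c\<bar>"] L2convD(3)[OF assms]]
  by (auto simp: L2conv_def L2_scaleR L2norm_scaleR simp flip: scaleR_diff_right)

lemma L2conv_inner_left:
  assumes "L2conv M u v"
  shows "L2conv M (\<lambda>n x. u n x \<bullet> i) (\<lambda>x. v x \<bullet> i)"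
proof -
  note c = L2convD[OF assms]
  have "norm (L2norm M (\<lambda>x. u n x \<bullet> i - v x \<bullet> i)) \<le> norm i * L2norm M (\<lambda>x. u n x - v x)" for n
  proof -
    have "L2norm M (\<lambda>x. u n x \<bullet> i - v x \<bullet> i) \<le> L2norm M (\<lambda>x. norm i *\<^sub>R (u n x - v x))"
      by (intro L2norm_mono_AE L2_scaleR L2_diff L2_inner_left c AE_I2 L2_measurable)
         (auto simp flip: inner_diff_left
               intro: order_trans[OF Cauchy_Schwarz_ineq2] simp: mult.commute)
    then show ?thesis by (simp only: L2norm_scaleR) simp
  qed
  then have "(\<lambda>n. L2norm M (\<lambda>x. u n x \<bullet> i - v x \<bullet> i)) \<longlonglongrightarrow> 0"
    by (rule squeeze_null) (use tendsto_mult[OF tendsto_const[of "norm i"] c(3)] in simp)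
  then show ?thesis using c by (auto simp: L2conv_def intro: L2_inner_left)
qed

lemma L2conv_AE_subseq:
  assumes "L2conv M u v"
  obtains r where "strict_mono r" "AE x in M. (\<lambda>n. u (r n) x) \<longlonglongrightarrow> v x"
proof -
  note c = L2convD[OF assms]
  have "(\<lambda>n. (L2norm M (\<lambda>x. u n x - v x))\<^sup>2) \<longlonglongrightarrow> 0"
    using tendsto_power[OF c(3), of 2] by simp
  then have "(\<lambda>n. \<integral>x. norm ((norm (u n x - v x))\<^sup>2) \<partial>M) \<longlonglongrightarrow> 0"
    by (simp add: L2norm_sq)
  moreover have "integrable M (\<lambda>x. (norm (u n x - v x))\<^sup>2)" for n
    using L2_diff[OF c(1)[of n] c(2)] by (simp add: L2_def)
  ultimately have "\<exists>r. strict_mono r \<and> (AE x in M. (\<lambda>n. (norm (u (r n) x - v x))\<^sup>2) \<longlonglongrightarrow> 0)"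
    by (intro tendsto_L1_AE_subseq) auto
  then obtain r where r: "strict_mono r" and
    ae: "AE x in M. (\<lambda>n. (norm (u (r n) x - v x))\<^sup>2) \<longlonglongrightarrow> 0"
    by blast
  have "AE x in M. (\<lambda>n. u (r n) x) \<longlonglongrightarrow> v x"
    using ae
  proof eventually_elim
    case (elim x)
    have "(\<lambda>n. sqrt ((norm (u (r n) x - v x))\<^sup>2)) \<longlonglongrightarrow> sqrt 0"
      by (rule tendsto_real_sqrt[OF elim])
    then show ?case by (simp add: tendsto_norm_zero_iff LIM_zero_iff)
  qed
  with r show ?thesis by (rule that)
qed

text \<open>The tool for every later limit of the form b(p_n) u_n . v_n: the coefficients converge
  only almost everywhere but stay bounded, while the two factors converge in L2. With u0 and v0
  frozen the coefficients are handled by dominated convergence; the factors are then exchanged one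
  at a time by Cauchy-Schwarz.\<close>

lemma L2conv_inner:
  assumes "L2conv M u u0" "L2conv M v v0"
    and b: "\<And>n. b n \<in> borel_measurable M" "b0 \<in> borel_measurable M"
    and bd: "\<And>n. AE x in M. \<bar>b n x\<bar> \<le> C"
    and lim: "AE x in M. (\<lambda>n. b n x) \<longlonglongrightarrow> (b0 x :: real)"
  shows "(\<lambda>n. \<integral>x. b n x * (u n x \<bullet> v n x) \<partial>M) \<longlonglongrightarrow> (\<integral>x. b0 x * (u0 x \<bullet> v0 x) \<partial>M)"
    and "integrable M (\<lambda>x. b0 x * (u0 x \<bullet> v0 x))"
proof -
  note cu = L2convD[OF assms(1)] and cv = L2convD[OF assms(2)]
  \<comment> \<open>\<open>C\<close> carries no sign, for instance on a null space, whereas the norm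
    estimates multiply by it.\<close>
  define D where "D = max C 0"
  have D: "AE x in M. \<bar>b n x\<bar> \<le> D" "0 \<le> D" for n
    using bd[of n] by (auto simp: D_def elim!: eventually_mono)
  have bu: "L2 M (\<lambda>x. b n x *\<^sub>R w x)" if "L2 M w" for n and w :: "'a \<Rightarrow> 'b"
    by (rule L2_bmult[OF b(1) D(1) that])
  have dom: "AE x in M. norm (b n x * (u0 x \<bullet> v0 x)) \<le> D * (norm (u0 x) * norm (v0 x))" for n
    using D(1)[of n]
  proof eventually_elim
    case (elim x)
    then show ?case
      by (simp add: abs_mult) (intro mult_mono Cauchy_Schwarz_ineq2; simp add: D(2))
  qed
  have conv: "AE x in M. (\<lambda>n. b n x * (u0 x \<bullet> v0 x)) \<longlonglongrightarrow> b0 x * (u0 x \<bullet> v0 x)"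
    using lim by eventually_elim (intro tendsto_intros)
  note [measurable] = cu(1,2) cv(1,2) b
  have meas: "(\<lambda>x. b0 x * (u0 x \<bullet> v0 x)) \<in> borel_measurable M"
    "\<And>n. (\<lambda>x. b n x * (u0 x \<bullet> v0 x)) \<in> borel_measurable M"
    by measurable
  have intd: "integrable M (\<lambda>x. D * (norm (u0 x) * norm (v0 x)))"
    by (intro integrable_mult_right integrable_norm_prod cu cv)
  have L1: "(\<lambda>n. \<integral>x. b n x * (u0 x \<bullet> v0 x) \<partial>M) \<longlonglongrightarrow> (\<integral>x. b0 x * (u0 x \<bullet> v0 x) \<partial>M)"
    by (rule integral_dominated_convergence[OF meas intd conv dom])
  show "integrable M (\<lambda>x. b0 x * (u0 x \<bullet> v0 x))"
    by (rule integrable_dominated_convergence[OF meas intd conv dom])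
  have L2: "norm ((\<integral>x. b n x * (u n x \<bullet> v n x) \<partial>M) - (\<integral>x. b n x * (u0 x \<bullet> v0 x) \<partial>M))
      \<le> D * L2norm M (\<lambda>x. u n x - u0 x) * L2norm M (v n) + D * L2norm M u0 * L2norm M (\<lambda>x. v n x - v0 x)" for n
  proof -
    have I1: "integrable M (\<lambda>x. (b n x *\<^sub>R w x) \<bullet> z x)" if "L2 M w" "L2 M z" for w z :: "'a \<Rightarrow> 'b"
      by (rule integrable_inner[OF bu[OF that(1)] that(2)])
    have "(\<integral>x. b n x * (u n x \<bullet> v n x) \<partial>M) - (\<integral>x. b n x * (u0 x \<bullet> v0 x) \<partial>M)
       = (\<integral>x. (b n x *\<^sub>R (u n x - u0 x)) \<bullet> v n x + (b n x *\<^sub>R u0 x) \<bullet> (v n x - v0 x) \<partial>M)"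
      using I1[OF cu(1)[of n] cv(1)[of n]] I1[OF cu(2) cv(2)]
      by (subst Bochner_Integration.integral_diff[symmetric])
         (auto simp: algebra_simps inner_simps intro!: Bochner_Integration.integral_cong)
    also have "\<dots> = (\<integral>x. (b n x *\<^sub>R (u n x - u0 x)) \<bullet> v n x \<partial>M) + (\<integral>x. (b n x *\<^sub>R u0 x) \<bullet> (v n x - v0 x) \<partial>M)"
      by (intro Bochner_Integration.integral_add I1 L2_diff cu cv)
    also have "norm \<dots> \<le> L2norm M (\<lambda>x. b n x *\<^sub>R (u n x - u0 x)) * L2norm M (v n)
        + L2norm M (\<lambda>x. b n x *\<^sub>R u0 x) * L2norm M (\<lambda>x. v n x - v0 x)"
      using CS_inner[OF bu[OF L2_diff[OF cu(1)[of n] cu(2)]] cv(1)[of n], of n]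
        CS_inner[OF bu[OF cu(2)] L2_diff[OF cv(1)[of n] cv(2)], of n]
      by simp
    also have "\<dots> \<le> (D * L2norm M (\<lambda>x. u n x - u0 x)) * L2norm M (v n) + (D * L2norm M u0) * L2norm M (\<lambda>x. v n x - v0 x)"
      by (intro add_mono mult_right_mono L2norm_bmult_le b D L2_diff cu L2norm_nonneg)
    finally show ?thesis .
  qed
  have "(\<lambda>n. D * L2norm M (\<lambda>x. u n x - u0 x) * L2norm M (v n) + D * L2norm M u0 * L2norm M (\<lambda>x. v n x - v0 x))
      \<longlonglongrightarrow> D * 0 * L2norm M v0 + D * L2norm M u0 * 0"
    by (intro tendsto_intros cu cv L2conv_L2norm assms)
  then have "(\<lambda>n. (\<integral>x. b n x * (u n x \<bullet> v n x) \<partial>M) - (\<integral>x. b n x * (u0 x \<bullet> v0 x) \<partial>M)) \<longlonglongrightarrow> 0"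
    by (intro squeeze_null[OF L2]) simp
  from tendsto_add[OF this L1] show
    "(\<lambda>n. \<integral>x. b n x * (u n x \<bullet> v n x) \<partial>M) \<longlonglongrightarrow> (\<integral>x. b0 x * (u0 x \<bullet> v0 x) \<partial>M)" by simp
qed

lemma L2conv_inner1:
  assumes "L2conv M u u0" "L2conv M v v0"
  shows "(\<lambda>n. \<integral>x. u n x \<bullet> v n x \<partial>M) \<longlonglongrightarrow> (\<integral>x. u0 x \<bullet> v0 x \<partial>M)"
  using L2conv_inner(1)[OF assms, of "\<lambda>_ _. 1" "\<lambda>_. 1" 1] by simp

section \<open>Completeness of L2 over a finite measure\<close>

definition L2Cauchy :: "'a measure \<Rightarrow> (nat \<Rightarrow> 'a \<Rightarrow> 'b::euclidean_space) \<Rightarrow> bool" where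
  "L2Cauchy M u \<longleftrightarrow> (\<forall>n. L2 M (u n)) \<and>
     (\<forall>e>0. \<exists>N. \<forall>m\<ge>N. \<forall>n\<ge>N. L2norm M (\<lambda>x. u m x - u n x) < e)"

lemma L2CauchyD: "L2Cauchy M u \<Longrightarrow> 0 < e \<Longrightarrow> \<exists>N. \<forall>m\<ge>N. \<forall>n\<ge>N. L2norm M (\<lambda>x. u m x - u n x) < e"
  unfolding L2Cauchy_def by blast

lemma L2conv_Cauchy:
  assumes "L2conv M u v"
  shows "L2Cauchy M u"
  unfolding L2Cauchy_def
proof (intro conjI allI impI)
  note c = L2convD[OF assms]
  show "L2 M (u n)" for n by (rule c)
  fix e :: real assume "0 < e"
  then obtain N where N: "\<And>n. n \<ge> N \<Longrightarrow> L2norm M (\<lambda>x. u n x - v x) < e / 2"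
    using LIMSEQ_D[OF c(3), of "e / 2"] by auto
  show "\<exists>N. \<forall>m\<ge>N. \<forall>n\<ge>N. L2norm M (\<lambda>x. u m x - u n x) < e"
  proof (intro exI allI impI)
    fix m n assume "N \<le> m" "N \<le> n"
    then show "L2norm M (\<lambda>x. u m x - u n x) < e"
      using N[of m] N[of n] L2norm_triangle_diff[OF c(1)[of m] c(2) c(1)[of n]]
      by (simp add: L2norm_minus_commute[of M v])
  qed
qed

text \<open>Fatou's lemma in n, applied to |u_m - u_n|^2. It serves wherever the limit is already
  known pointwise: in the completeness proof and for the transform in \<open>picone\<close>.\<close>

lemma L2Cauchy_AE_limit:
  assumes C: "L2Cauchy M u" and lim: "AE x in M. (\<lambda>n. u n x) \<longlonglongrightarrow> v x"
    and v: "v \<in> borel_measurable M"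
  shows "L2conv M u v"
proof -
  have L: "L2 M (u n)" for n using C by (simp add: L2Cauchy_def)
  note [measurable] = L v
  have key: "L2 M (\<lambda>x. u m x - v x) \<and> L2norm M (\<lambda>x. u m x - v x) \<le> e"
    if e: "0 < e" and N: "\<forall>n\<ge>N. L2norm M (\<lambda>x. u m x - u n x) < e" for m e N
  proof -
    have "(\<integral>\<^sup>+x. ennreal ((norm (u m x - v x))\<^sup>2) \<partial>M)
        \<le> (\<integral>\<^sup>+x. liminf (\<lambda>n. ennreal ((norm (u m x - u n x))\<^sup>2)) \<partial>M)"
    proof (intro nn_integral_mono_AE)
      show "AE x in M. ennreal ((norm (u m x - v x))\<^sup>2) \<le> liminf (\<lambda>n. ennreal ((norm (u m x - u n x))\<^sup>2))"
        using lim
      proof eventually_elim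
        case (elim x)
        have "(\<lambda>n. ennreal ((norm (u m x - u n x))\<^sup>2)) \<longlonglongrightarrow> ennreal ((norm (u m x - v x))\<^sup>2)"
          by (intro tendsto_ennrealI tendsto_intros elim)
        then show ?case using lim_imp_Liminf[OF trivial_limit_sequentially] by (metis order_refl)
      qed
    qed
    also have "\<dots> \<le> liminf (\<lambda>n. \<integral>\<^sup>+x. ennreal ((norm (u m x - u n x))\<^sup>2) \<partial>M)"
      by (intro nn_integral_liminf) measurable
    also have "\<dots> \<le> limsup (\<lambda>n. \<integral>\<^sup>+x. ennreal ((norm (u m x - u n x))\<^sup>2) \<partial>M)"
      by (rule Liminf_le_Limsup) simp
    also have "\<dots> \<le> ennreal (e\<^sup>2)"
    proof (rule Limsup_bounded, unfold eventually_sequentially, intro exI[of _ N] allI impI)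
      fix n assume "N \<le> n"
      then have "(L2norm M (\<lambda>x. u m x - u n x))\<^sup>2 \<le> e\<^sup>2" using N by (intro power_mono) (auto intro: less_imp_le)
      then show "(\<integral>\<^sup>+x. ennreal ((norm (u m x - u n x))\<^sup>2) \<partial>M) \<le> ennreal (e\<^sup>2)"
        using L2_diff[OF L[of m] L[of n]]
        by (subst nn_integral_eq_integral) (auto simp: L2_def L2norm_sq intro: ennreal_leI)
    qed
    finally have le: "(\<integral>\<^sup>+x. ennreal ((norm (u m x - v x))\<^sup>2) \<partial>M) \<le> ennreal (e\<^sup>2)" .
    then have i: "integrable M (\<lambda>x. (norm (u m x - v x))\<^sup>2)"
      by (intro integrableI_bounded) (auto simp: le_less_trans[OF _ ennreal_less_top])
    then have l: "L2 M (\<lambda>x. u m x - v x)" by (simp add: L2_def)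
    have "ennreal ((L2norm M (\<lambda>x. u m x - v x))\<^sup>2) \<le> ennreal (e\<^sup>2)"
      using le nn_integral_eq_integral[OF i] by (simp add: L2norm_sq)
    then have "(L2norm M (\<lambda>x. u m x - v x))\<^sup>2 \<le> e\<^sup>2"
      by (subst (asm) ennreal_le_iff) simp_all
    then have "L2norm M (\<lambda>x. u m x - v x) \<le> e"
      by (rule power2_le_imp_le) (use e in simp)
    with l show ?thesis ..
  qed
  have ex: "\<exists>N. \<forall>m\<ge>N. L2 M (\<lambda>x. u m x - v x) \<and> L2norm M (\<lambda>x. u m x - v x) \<le> e" if "0 < e" for e
  proof -
    obtain N where "\<forall>m\<ge>N. \<forall>n\<ge>N. L2norm M (\<lambda>x. u m x - u n x) < e"
      using L2CauchyD[OF C \<open>0 < e\<close>] by blast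
    then show ?thesis using key[OF that, of N] by blast
  qed
  \<comment> \<open>One index is enough to put v into L2, since v = u_N - (u_N - v).\<close>
  obtain N where "L2 M (\<lambda>x. u N x - v x)" using ex[of 1] by auto
  from L2_diff[OF L[of N] this] have Lv: "L2 M v" by simp
  have "(\<lambda>n. L2norm M (\<lambda>x. u n x - v x)) \<longlonglongrightarrow> 0"
  proof (rule LIMSEQ_I)
    fix e :: real assume "0 < e"
    then obtain N where "\<forall>m\<ge>N. L2norm M (\<lambda>x. u m x - v x) \<le> e / 2" using ex[of "e/2"] by auto
    then show "\<exists>N. \<forall>n\<ge>N. norm (L2norm M (\<lambda>x. u n x - v x) - 0) < e"
      using \<open>0 < e\<close> by (intro exI[of _ N]) (auto intro: le_less_trans)
  qed
  with Lv L show ?thesis by (simp add: L2conv_def)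
qed

lemma (in finite_measure) L2_integrable:
  assumes "L2 M u"
  shows "integrable M u" "(\<integral>x. norm (u x) \<partial>M) \<le> L2norm M u * sqrt (measure M (space M))"
proof -
  have 1: "L2 M (\<lambda>x. 1::real)" by (simp add: L2_def)
  have "integrable M (\<lambda>x. norm (u x))" using integrable_norm_prod[OF assms 1] by simp
  then show "integrable M u" using assms by (subst (asm) integrable_norm_iff) (auto simp: L2_def)
  show "(\<integral>x. norm (u x) \<partial>M) \<le> L2norm M u * sqrt (measure M (space M))"
    using CS_norm[OF assms 1] by (simp add: L2norm_def)
qed

lemma (in finite_measure) L2_const: "L2 M (\<lambda>x. c)"
  by (simp add: L2_def)

lemma L2conv_of_subseq:
  assumes C: "L2Cauchy M u" and r: "strict_mono r" and L: "L2conv M (\<lambda>n. u (r n)) v"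
  shows "L2conv M u v"
proof -
  have Lu: "L2 M (u n)" for n using C by (simp add: L2Cauchy_def)
  have Lv: "L2 M v" using L by (simp add: L2conv_def)
  have "(\<lambda>n. L2norm M (\<lambda>x. u n x - v x)) \<longlonglongrightarrow> 0"
  proof (rule LIMSEQ_I)
    fix e :: real assume e: "0 < e"
    obtain N where N: "\<forall>m\<ge>N. \<forall>n\<ge>N. L2norm M (\<lambda>x. u m x - u n x) < e / 2"
      using L2CauchyD[OF C, of "e / 2"] e by auto
    obtain K where K: "\<forall>n\<ge>K. L2norm M (\<lambda>x. u (r n) x - v x) < e / 2"
      using LIMSEQ_D[OF L2convD(3)[OF L], of "e / 2"] e by auto
    define k where "k = max K N"
    have "N \<le> r k" using seq_suble[OF r, of k] by (simp add: k_def)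
    have "L2norm M (\<lambda>x. u n x - v x) < e" if "N \<le> n" for n
    proof -
      have "L2norm M (\<lambda>x. u n x - u (r k) x) < e / 2" using N that \<open>N \<le> r k\<close> by blast
      moreover have "L2norm M (\<lambda>x. u (r k) x - v x) < e / 2" using K by (simp add: k_def)
      ultimately show ?thesis using L2norm_triangle_diff[OF Lu[of n] Lu[of "r k"] Lv] by linarith
    qed
    then show "\<exists>N. \<forall>n\<ge>N. norm (L2norm M (\<lambda>x. u n x - v x) - 0) < e" by auto
  qed
  with Lu Lv show ?thesis by (simp add: L2conv_def)
qed

lemma L2Cauchy_subseq:
  assumes "L2Cauchy M u" "strict_mono r"
  shows "L2Cauchy M (\<lambda>n. u (r n))"
  unfolding L2Cauchy_def
proof (intro conjI allI impI)
  show "L2 M (u (r n))" for n using assms by (simp add: L2Cauchy_def)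
  fix e :: real assume "0 < e"
  then obtain N where N: "\<forall>m\<ge>N. \<forall>n\<ge>N. L2norm M (\<lambda>x. u m x - u n x) < e"
    using L2CauchyD[OF assms(1)] by blast
  then show "\<exists>N. \<forall>m\<ge>N. \<forall>n\<ge>N. L2norm M (\<lambda>x. u (r m) x - u (r n) x) < e"
    using seq_suble[OF assms(2)] by (meson order_trans)
qed

text \<open>Over a finite measure Cauchy-Schwarz makes an L2 Cauchy sequence Cauchy in L1, so a
  subsequence converges almost everywhere. \<open>L2Cauchy_AE_limit\<close> upgrades this to L2
  convergence, and the Cauchy property carries it to the whole sequence.\<close>

lemma (in finite_measure) L2_complete:
  fixes u :: "nat \<Rightarrow> 'a \<Rightarrow> 'b::euclidean_space"
  assumes C: "L2Cauchy M u"
  obtains v where "L2conv M u v"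
proof -
  have L: "L2 M (u n)" for n using C by (simp add: L2Cauchy_def)
  note [measurable] = L
  \<comment> \<open>The added 1 keeps \<open>K\<close> positive when the whole space has measure
    zero.\<close>
  define K where "K = sqrt (measure M (space M)) + 1"
  have K: "K > 0" by (simp add: K_def add_nonneg_pos)
  have "\<exists>N. \<forall>i\<ge>N. \<forall>j\<ge>N. (LINT x|M. norm (u i x - u j x)) < e" if e: "e > 0" for e
  proof -
    obtain N where N: "\<forall>m\<ge>N. \<forall>n\<ge>N. L2norm M (\<lambda>x. u m x - u n x) < e / K"
      using L2CauchyD[OF C, of "e / K"] e K by auto
    have "(LINT x|M. norm (u i x - u j x)) < e" if "i \<ge> N" "j \<ge> N" for i j
    proof -
      have "(LINT x|M. norm (u i x - u j x)) \<le> L2norm M (\<lambda>x. u i x - u j x) * sqrt (measure M (space M))"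
        by (rule L2_integrable(2)[OF L2_diff[OF L L]])
      also have "\<dots> \<le> L2norm M (\<lambda>x. u i x - u j x) * K" by (intro mult_left_mono) (auto simp: K_def)
      also have "\<dots> < e" using N that K by (simp add: pos_less_divide_eq)
      finally show ?thesis .
    qed
    then show ?thesis by blast
  qed
  then obtain r where r: "strict_mono r" and ae: "AE x in M. Cauchy (\<lambda>i. u (r i) x)"
    using cauchy_L1_AE_cauchy_subseq[of M u, OF L2_integrable(1)[OF L]] by blast
  define v where "v x = lim (\<lambda>i. u (r i) x)" for x
  have v: "v \<in> borel_measurable M" unfolding v_def by measurable
  have "AE x in M. (\<lambda>n. u (r n) x) \<longlonglongrightarrow> v x"
    using ae unfolding v_def by eventually_elim (simp add: Cauchy_convergent convergent_LIMSEQ_iff[symmetric])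
  then have "L2conv M (\<lambda>n. u (r n)) v"
    by (rule L2Cauchy_AE_limit[OF L2Cauchy_subseq[OF C r] _ v])
  then show ?thesis using L2conv_of_subseq[OF C r] that by blast
qed

section \<open>Smooth functions and bump functions\<close>

definition pd :: "'a::euclidean_space \<Rightarrow> ('a \<Rightarrow> real) \<Rightarrow> 'a \<Rightarrow> real" where
  "pd i f x = frechet_derivative f (at x) i"

text \<open>\<open>smooth_on\<close> quantifies over lists of directions, which does not fit the
  product and chain rules. Here the order is the recursion variable: all basis derivatives of order
  up to n are themselves differentiable, and closure properties follow by induction on n.\<close>

primrec ck :: "nat \<Rightarrow> ('a::euclidean_space \<Rightarrow> real) \<Rightarrow> bool" where
  "ck 0 f = (\<forall>x. f differentiable (at x))"
| "ck (Suc n) f = ((\<forall>x. f differentiable (at x)) \<and> (\<forall>i\<in>Basis. ck n (pd i f)))"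

lemma ck_diff: "ck n f \<Longrightarrow> f differentiable (at x)"
  by (cases n) auto

text \<open>\<open>iter_dderiv\<close> applies the direction at the head of the list last, while
  \<open>ck\<close> peels off the derivative taken first. Appending at the end reconciles the
  two.\<close>

lemma iter_dderiv_snoc: "iter_dderiv (vs @ [v]) f = iter_dderiv vs (pd v f)"
  by (induction vs) (auto simp: pd_def[abs_def])

lemma ck_iff_iter_dderiv:
  "ck n f \<longleftrightarrow> (\<forall>vs. length vs \<le> n \<and> set vs \<subseteq> Basis \<longrightarrow> (\<forall>x. iter_dderiv vs f differentiable (at x)))"
proof (induction n arbitrary: f)
  case (Suc n)
  show ?case
  proof
    assume L: "ck (Suc n) f"
    show "\<forall>vs. length vs \<le> Suc n \<and> set vs \<subseteq> Basis \<longrightarrow> (\<forall>x. iter_dderiv vs f differentiable (at x))"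
    proof (intro allI impI)
      fix vs :: "'a list" and x assume "length vs \<le> Suc n \<and> set vs \<subseteq> Basis"
      then show "iter_dderiv vs f differentiable (at x)"
        using L Suc.IH by (cases vs rule: rev_cases) (auto simp: iter_dderiv_snoc)
    qed
  next
    assume R: "\<forall>vs. length vs \<le> Suc n \<and> set vs \<subseteq> Basis \<longrightarrow> (\<forall>x. iter_dderiv vs f differentiable (at x))"
    have "ck n (pd i f)" if "i \<in> Basis" for i
      unfolding Suc.IH
    proof (intro allI impI)
      fix vs :: "'a list" and x assume "length vs \<le> n \<and> set vs \<subseteq> Basis"
      then show "iter_dderiv vs (pd i f) differentiable (at x)"
        using R[rule_format, of "vs @ [i]" x] that by (simp add: iter_dderiv_snoc)
    qed
    moreover have "f differentiable (at x)" for x using R[rule_format, of "[]" x] by simp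
    ultimately show "ck (Suc n) f" by simp
  qed
qed simp

lemma smooth_iff_ck: "smooth_on UNIV f \<longleftrightarrow> (\<forall>n. ck n f)"
  unfolding smooth_on_def ck_iff_iter_dderiv by auto

lemma ck_SucD: "ck (Suc n) f \<Longrightarrow> ck n f"
  by (induction n arbitrary: f) auto

lemma pd_eqI: "(f has_derivative F) (at x) \<Longrightarrow> pd i f x = F i"
  by (simp add: pd_def frechet_derivative_at[symmetric])

lemma diff_has_derivative: "f differentiable (at x) \<Longrightarrow> (f has_derivative (\<lambda>h. pd h f x)) (at x)"
  unfolding pd_def by (simp add: frechet_derivative_works[symmetric])

lemma pd_const: "pd i (\<lambda>x. c) = (\<lambda>x. 0)"
  by (rule ext, rule pd_eqI[THEN trans]) (auto intro!: derivative_eq_intros)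

lemma pd_add:
  assumes "f differentiable (at x)" "g differentiable (at x)"
  shows "pd i (\<lambda>x. f x + g x) x = pd i f x + pd i g x"
  by (rule pd_eqI[THEN trans]) (auto intro!: derivative_eq_intros diff_has_derivative assms)

lemma pd_mult:
  assumes "f differentiable (at x)" "g differentiable (at x)"
  shows "pd i (\<lambda>x. f x * g x) x = f x * pd i g x + pd i f x * g x"
  by (rule pd_eqI[THEN trans]) (auto intro!: derivative_eq_intros diff_has_derivative assms)

lemma pd_compose:
  assumes "f differentiable (at x)" "(h has_real_derivative D) (at (f x))"
  shows "pd i (\<lambda>x. h (f x)) x = D * pd i f x" "(\<lambda>x. h (f x)) differentiable (at x)"
proof -
  have *: "((\<lambda>x. h (f x)) has_derivative (\<lambda>v. D * pd v f x)) (at x)"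
    using diff_chain_at[OF diff_has_derivative[OF assms(1)] assms(2)[unfolded has_field_derivative_def]]
    by (simp add: o_def)
  then show "pd i (\<lambda>x. h (f x)) x = D * pd i f x" by (rule pd_eqI)
  show "(\<lambda>x. h (f x)) differentiable (at x)" using * by (rule differentiableI)
qed

lemma ck_const: "ck n (\<lambda>x. c)"
  by (induction n arbitrary: c) (auto simp: pd_const)

lemma ck_add: "ck n f \<Longrightarrow> ck n g \<Longrightarrow> ck n (\<lambda>x. f x + g x)"
proof (induction n arbitrary: f g)
  case (Suc n)
  then have "pd i (\<lambda>x. f x + g x) = (\<lambda>x. pd i f x + pd i g x)" for i
    by (intro ext pd_add) auto
  with Suc show ?case by (auto simp: differentiable_add)
qed (auto simp: differentiable_add)

lemma ck_mult: "ck n f \<Longrightarrow> ck n g \<Longrightarrow> ck n (\<lambda>x. f x * g x)"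
proof (induction n arbitrary: f g)
  case (Suc n)
  then have "pd i (\<lambda>x. f x * g x) = (\<lambda>x. f x * pd i g x + pd i f x * g x)" for i
    by (intro ext pd_mult) auto
  with Suc show ?case using ck_SucD[OF Suc.prems(1)] ck_SucD[OF Suc.prems(2)]
    by (auto simp: differentiable_mult intro!: ck_add Suc.IH)
qed (auto simp: differentiable_mult)

lemma ck_inverse: "ck n f \<Longrightarrow> (\<And>x. f x \<noteq> 0) \<Longrightarrow> ck n (\<lambda>x. inverse (f x))"
proof (induction n arbitrary: f)
  case 0
  then show ?case by (auto intro: differentiable_inverse)
next
  case (Suc n)
  have "pd i (\<lambda>x. inverse (f x)) = (\<lambda>x. (-1) * (inverse (f x) * inverse (f x)) * pd i f x)" for i
  proof
    fix x
    have d: "(inverse has_real_derivative (-1) * (inverse (f x) * inverse (f x))) (at (f x))"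
      by (auto intro!: derivative_eq_intros simp: Suc.prems)
    show "pd i (\<lambda>x. inverse (f x)) x = (-1) * (inverse (f x) * inverse (f x)) * pd i f x"
      using pd_compose(1)[where h = inverse and f = f and x = x, OF _ d] Suc.prems by auto
  qed
  note eq = this
  show ?case unfolding ck.simps
  proof (intro conjI allI ballI)
    show "(\<lambda>x. inverse (f x)) differentiable (at x)" for x
      using Suc.prems by (auto intro: differentiable_inverse)
    fix i :: 'a assume "i \<in> Basis"
    then have "ck n (pd i f)" using Suc.prems by simp
    then show "ck n (pd i (\<lambda>x. inverse (f x)))"
      unfolding eq by (intro ck_mult ck_const Suc.IH ck_SucD[OF Suc.prems(1)] Suc.prems(2))
  qed
qed

text \<open>When differentiation merely shifts the index of the family, the chain rule never leaves
  it, and induction replaces a formula for higher derivatives of a composition. It is applied with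
  \<open>b = bumpD\<close>.\<close>

lemma ck_family:
  assumes "\<And>n. ck n p" and b: "\<And>k s. (b k has_real_derivative b (Suc k) s) (at s)"
  shows "ck n (\<lambda>x. b k (p x))"
proof (induction n arbitrary: k)
  case 0
  show ?case using pd_compose(2)[OF ck_diff[OF assms(1)] b] by auto
next
  case (Suc n)
  have "pd i (\<lambda>x. b k (p x)) = (\<lambda>x. b (Suc k) (p x) * pd i p x)" for i
    by (intro ext pd_compose(1)[OF ck_diff[OF assms(1)] b])
  moreover have "ck n (pd i p)" if "i \<in> Basis" for i using assms(1)[of "Suc n"] that by auto
  ultimately show ?case
    using pd_compose(2)[OF ck_diff[OF assms(1)] b] by (auto intro!: ck_mult Suc.IH)
qed

abbreviation smooth :: "('a::euclidean_space \<Rightarrow> real) \<Rightarrow> bool" where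
  "smooth f \<equiv> smooth_on UNIV f"

lemma smooth_diff: "smooth f \<Longrightarrow> f differentiable (at x)"
  by (auto simp: smooth_iff_ck intro: ck_diff)

lemma smooth_const: "smooth (\<lambda>x. c)"
  and smooth_add: "smooth f \<Longrightarrow> smooth g \<Longrightarrow> smooth (\<lambda>x. f x + g x)"
  and smooth_mult: "smooth f \<Longrightarrow> smooth g \<Longrightarrow> smooth (\<lambda>x. f x * g x)"
  and smooth_inverse: "smooth f \<Longrightarrow> (\<And>x. f x \<noteq> 0) \<Longrightarrow> smooth (\<lambda>x. inverse (f x))"
  by (auto simp: smooth_iff_ck ck_const ck_add ck_mult ck_inverse)

lemma smooth_sum: "(\<And>k. k \<in> A \<Longrightarrow> smooth (f k)) \<Longrightarrow> smooth (\<lambda>x. \<Sum>k\<in>A. f k x)"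
  by (induction A rule: infinite_finite_induct) (auto simp: smooth_const smooth_add)

lemma smooth_pd: "smooth f \<Longrightarrow> i \<in> Basis \<Longrightarrow> smooth (pd i f)"
  unfolding smooth_iff_ck by (metis ck.simps(2))

lemma smooth_continuous: "smooth f \<Longrightarrow> continuous_on S f"
  using smooth_diff by (metis continuous_at_imp_continuous_on differentiable_imp_continuous_within)

lemma grad_inner: "i \<in> Basis \<Longrightarrow> grad f x \<bullet> i = pd i f x"
  by (simp add: grad_def pd_def inner_sum_left inner_Basis if_distrib sum.delta cong: if_cong)

lemma pd_grad: "f differentiable (at x) \<Longrightarrow> pd h f x = grad f x \<bullet> h"
proof -
  assume "f differentiable (at x)"
  then interpret l: bounded_linear "\<lambda>h. pd h f x"
    using diff_has_derivative has_derivative_bounded_linear by blast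
  have "pd h f x = pd (\<Sum>i\<in>Basis. (h \<bullet> i) *\<^sub>R i) f x" by (simp add: euclidean_representation)
  also have "\<dots> = (\<Sum>i\<in>Basis. (h \<bullet> i) * pd i f x)" by (simp add: l.sum l.scaleR)
  also have "\<dots> = grad f x \<bullet> h"
    by (simp add: grad_def inner_sum_left pd_def inner_commute[of h] mult.commute)
  finally show ?thesis .
qed

lemma grad_has_derivative: "f differentiable (at x) \<Longrightarrow> (f has_derivative (\<lambda>h. grad f x \<bullet> h)) (at x)"
  using diff_has_derivative[of f x] pd_grad[of f x] by simp

lemma gradI:
  assumes "(f has_derivative (\<lambda>h. v \<bullet> h)) (at x)" shows "grad f x = v"
  by (rule euclidean_eqI) (simp add: grad_inner pd_eqI[OF assms])

lemma grad_add: "f differentiable (at x) \<Longrightarrow> g differentiable (at x) \<Longrightarrow>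
    grad (\<lambda>x. f x + g x) x = grad f x + grad g x"
  by (rule euclidean_eqI) (simp add: grad_inner pd_add inner_add_left)

lemma grad_mult: "f differentiable (at x) \<Longrightarrow> g differentiable (at x) \<Longrightarrow>
    grad (\<lambda>x. f x * g x) x = f x *\<^sub>R grad g x + g x *\<^sub>R grad f x"
  by (rule euclidean_eqI) (simp add: grad_inner pd_mult inner_add_left)

lemma grad_const [simp]: "grad (\<lambda>x. c) x = 0"
  by (rule euclidean_eqI) (simp add: grad_inner pd_const)

lemma grad_compose: "f differentiable (at x) \<Longrightarrow> (h has_real_derivative D) (at (f x)) \<Longrightarrow>
    grad (\<lambda>x. h (f x)) x = D *\<^sub>R grad f x"
  by (rule euclidean_eqI) (simp add: grad_inner pd_compose)

lemma smooth_grad_continuous: "smooth f \<Longrightarrow> continuous_on S (grad f)"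
proof -
  assume "smooth f"
  then have "continuous_on S (\<lambda>x. \<Sum>i\<in>Basis. pd i f x *\<^sub>R i)"
    by (intro continuous_intros smooth_continuous smooth_pd)
  then show ?thesis by (simp add: grad_def[abs_def] pd_def)
qed

lemma grad_outside:
  assumes "x \<notin> closure {x. f x \<noteq> 0}"
  shows "grad f x = 0"
proof (rule gradI)
  have "open (- closure {x. f x \<noteq> 0})" by auto
  moreover have "f y = 0" if "y \<in> - closure {x. f x \<noteq> 0}" for y
    using that closure_subset[of "{x. f x \<noteq> 0}"] by auto
  moreover have "x \<in> - closure {x. f x \<noteq> 0}" using assms by simp
  moreover have "((\<lambda>x. 0) has_derivative (\<lambda>h. 0)) (at x)" by (rule has_derivative_const)
  ultimately have "(f has_derivative (\<lambda>h. 0)) (at x)"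
    by (metis has_derivative_transform_within_open)
  then show "(f has_derivative (\<lambda>h. 0 \<bullet> h)) (at x)" by simp
qed

lemma pd_outside:
  assumes "i \<in> Basis" "x \<notin> closure {x. f x \<noteq> 0}"
  shows "pd i f x = 0"
  using grad_outside[OF assms(2)] grad_inner[OF assms(1), of f x] by simp

section \<open>Calculus of test functions\<close>

lemma test_fun_smooth: "test_fun \<Omega> f \<Longrightarrow> smooth f"
  by (simp add: test_fun_def)

lemma test_fun_outside: "test_fun \<Omega> f \<Longrightarrow> x \<notin> \<Omega> \<Longrightarrow> f x = 0 \<and> grad f x = 0"
  using closure_subset[of "{x. f x \<noteq> 0}"] grad_outside[of x f] by (auto simp: test_fun_def)

lemma test_funI:
  assumes "smooth f" "compact K" "K \<subseteq> \<Omega>" "\<And>x. x \<notin> K \<Longrightarrow> f x = 0"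
  shows "test_fun \<Omega> f"
proof -
  have "closure {x. f x \<noteq> 0} \<subseteq> K"
    using assms by (intro closure_minimal) (auto simp: compact_imp_closed)
  moreover from this have "compact (closure {x. f x \<noteq> 0})"
    using assms(2) by (meson closed_closure compact_closure compact_imp_bounded bounded_subset closure_subset)
  ultimately show ?thesis using assms by (auto simp: test_fun_def)
qed

lemma test_fun_support:
  assumes "test_fun \<Omega> f"
  obtains K where "compact K" "K \<subseteq> \<Omega>" "\<And>x. x \<notin> K \<Longrightarrow> f x = 0 \<and> grad f x = 0"
  using assms closure_subset[of "{x. f x \<noteq> 0}"] grad_outside[of _ f]
  by (intro that[of "closure {x. f x \<noteq> 0}"]) (auto simp: test_fun_def)

lemma test_fun_mult:
  assumes "test_fun \<Omega> f" "smooth g"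
  shows "test_fun \<Omega> (\<lambda>x. f x * g x)"
proof -
  obtain K where "compact K" "K \<subseteq> \<Omega>" "\<And>x. x \<notin> K \<Longrightarrow> f x = 0 \<and> grad f x = 0"
    using test_fun_support[OF assms(1)] by blast
  then show ?thesis using assms by (intro test_funI[of _ K] smooth_mult) (auto dest: test_fun_smooth)
qed

lemma test_fun_cmult: "test_fun \<Omega> f \<Longrightarrow> test_fun \<Omega> (\<lambda>x. c * f x)"
  using test_fun_mult[OF _ smooth_const, of \<Omega> f c] by (simp add: mult.commute)

lemma test_fun_add:
  assumes "test_fun \<Omega> f" "test_fun \<Omega> g"
  shows "test_fun \<Omega> (\<lambda>x. f x + g x)"
proof -
  obtain K where K: "compact K" "K \<subseteq> \<Omega>" "\<And>x. x \<notin> K \<Longrightarrow> f x = 0 \<and> grad f x = 0"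
    using test_fun_support[OF assms(1)] by blast
  obtain L where L: "compact L" "L \<subseteq> \<Omega>" "\<And>x. x \<notin> L \<Longrightarrow> g x = 0 \<and> grad g x = 0"
    using test_fun_support[OF assms(2)] by blast
  from K L show ?thesis using assms
    by (intro test_funI[of _ "K \<union> L"] smooth_add) (auto dest: test_fun_smooth)
qed

lemma test_fun_zero: "test_fun \<Omega> (\<lambda>x. 0)"
  by (rule test_funI[of _ "{}"]) (auto simp: smooth_const)

lemma test_fun_sum: "(\<And>k. k \<in> A \<Longrightarrow> test_fun \<Omega> (f k)) \<Longrightarrow> test_fun \<Omega> (\<lambda>x. \<Sum>k\<in>A. f k x)"
  by (induction A rule: infinite_finite_induct) (auto simp: test_fun_zero test_fun_add)

lemma test_fun_mono: "test_fun \<Omega> f \<Longrightarrow> \<Omega> \<subseteq> \<Omega>' \<Longrightarrow> test_fun \<Omega>' f"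
  by (auto simp: test_fun_def)

lemma test_fun_pd:
  assumes "test_fun \<Omega> f" "i \<in> Basis"
  shows "test_fun \<Omega> (pd i f)"
proof (rule test_funI)
  show "smooth (pd i f)" using assms by (intro smooth_pd test_fun_smooth)
  show "compact (closure {x. f x \<noteq> 0})" "closure {x. f x \<noteq> 0} \<subseteq> \<Omega>"
    using assms(1) by (auto simp: test_fun_def)
qed (rule pd_outside[OF assms(2)])

lemma test_fun_diff: "test_fun \<Omega> f \<Longrightarrow> test_fun \<Omega> g \<Longrightarrow> test_fun \<Omega> (\<lambda>x. f x - g x)"
  using test_fun_add[OF _ test_fun_cmult[of \<Omega> g "-1"], of f] by simp

lemma grad_cmult: "f differentiable (at x) \<Longrightarrow> grad (\<lambda>x. c * f x) x = c *\<^sub>R grad f x"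
  by (subst grad_mult) auto

lemma grad_diff: "f differentiable (at x) \<Longrightarrow> g differentiable (at x) \<Longrightarrow>
    grad (\<lambda>x. f x - g x) x = grad f x - grad g x"
  using grad_add[of f x "\<lambda>x. (-1) * g x"] grad_cmult[of g x "-1"] by simp

lemma cont_compact_support_bounded:
  fixes f :: "'a::euclidean_space \<Rightarrow> 'b::real_normed_vector"
  assumes "continuous_on UNIV f" "compact K" "\<And>x. x \<notin> K \<Longrightarrow> f x = 0"
  obtains C where "0 \<le> C" "\<And>x. norm (f x) \<le> C"
proof -
  have "compact (f ` K)" using assms by (intro compact_continuous_image) (auto intro: continuous_on_subset)
  then obtain C where C: "\<And>x. x \<in> K \<Longrightarrow> norm (f x) \<le> C" 
    using compact_imp_bounded by (fastforce simp: bounded_iff)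
  show ?thesis
  proof (rule that[of "max C 0"])
    show "norm (f x) \<le> max C 0" for x using C[of x] assms(3)[of x] by (cases "x \<in> K") auto
  qed simp
qed

lemma test_fun_bounded:
  assumes "test_fun \<Omega> f"
  obtains C where "0 \<le> C" "\<And>x. \<bar>f x\<bar> \<le> C"
proof -
  obtain K where K: "compact K" "K \<subseteq> \<Omega>" "\<And>x. x \<notin> K \<Longrightarrow> f x = 0 \<and> grad f x = 0"
    using test_fun_support[OF assms] by blast
  show ?thesis
    using cont_compact_support_bounded[OF smooth_continuous[OF test_fun_smooth[OF assms]] K(1)] K(3) that
    by (metis real_norm_def)
qed

lemma test_fun_grad_bounded:
  assumes "test_fun \<Omega> f"
  obtains C where "0 \<le> C" "\<And>x. norm (grad f x) \<le> C"
proof -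
  obtain K where K: "compact K" "K \<subseteq> \<Omega>" "\<And>x. x \<notin> K \<Longrightarrow> f x = 0 \<and> grad f x = 0"
    using test_fun_support[OF assms] by blast
  show ?thesis
    using cont_compact_support_bounded[OF smooth_grad_continuous[OF test_fun_smooth[OF assms]] K(1)] K(3) that
    by metis
qed

lemma test_fun_lipschitz:
  assumes f: "smooth f" and C: "\<And>x. norm (grad f x) \<le> C"
  shows "\<bar>f x - f y\<bar> \<le> C * norm (x - y)"
proof -
  have "norm (f x - f y) \<le> C * norm (x - y)"
  proof (rule differentiable_bound[where S = UNIV and f' = "\<lambda>x h. grad f x \<bullet> h"])
    show "(f has_derivative (\<lambda>h. grad f z \<bullet> h)) (at z within UNIV)" for z
      using grad_has_derivative[OF smooth_diff[OF f]] by simp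
    show "onorm (\<lambda>h. grad f z \<bullet> h) \<le> C" for z
    proof (rule onorm_le)
      fix h show "norm (grad f z \<bullet> h) \<le> C * norm h"
        using Cauchy_Schwarz_ineq2[of "grad f z" h] mult_right_mono[OF C[of z] norm_ge_zero[of h]]
        by simp
    qed
  qed auto
  then show ?thesis by simp
qed

section \<open>The flat function exp(-1/s) and the radial bumps built from it\<close>

definition bfam :: "real poly \<Rightarrow> real \<Rightarrow> real" where
  "bfam P s = (if s > 0 then poly P (1 / s) * exp (- (1 / s)) else 0)"

lemma poly_exp_tendsto_0: "((\<lambda>t. poly P t * exp (- t)) \<longlongrightarrow> (0::real)) at_top"
proof -
  have "((\<lambda>t. \<Sum>k\<le>degree P. coeff P k * (t ^ k / exp t)) \<longlongrightarrow> (\<Sum>k\<le>degree P. coeff P k * 0)) at_top"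
    by (intro tendsto_intros tendsto_power_div_exp_0)
  moreover have "(\<lambda>t. \<Sum>k\<le>degree P. coeff P k * (t ^ k / exp t)) = (\<lambda>t. poly P t * exp (- t))"
    by (auto simp: poly_altdef sum_distrib_right exp_minus divide_inverse mult.assoc)
  ultimately show ?thesis by simp
qed

text \<open>With t = 1/s, the derivative in s of P(t) exp(-t) is t^2 (P - P')(t) exp(-t). The family
  indexed by polynomials is thus closed under differentiation; the only delicate point is s =
  0.\<close>

lemma bfam_deriv:
  "(bfam P has_real_derivative bfam ([:0, 0, 1:] * (P - pderiv P)) s) (at s)"
proof -
  consider "s > 0" | "s < 0" | "s = 0" by linarith
  then show ?thesis
  proof cases
    case 1
    have "((\<lambda>s. poly P (1 / s) * exp (- (1 / s))) has_real_derivative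
        bfam ([:0, 0, 1:] * (P - pderiv P)) s) (at s)"
      using 1 by (auto intro!: derivative_eq_intros simp: bfam_def field_simps power2_eq_square)
    then show ?thesis
      by (rule DERIV_cong_ev[THEN iffD1, rotated 3])
         (use 1 in \<open>auto simp: bfam_def intro!: eventually_mono[OF eventually_gt_at_top]
            eventually_mono[OF eventually_nhds_in_open[of "{0<..}"]]\<close>)
  next
    case 2
    have "((\<lambda>s. 0) has_real_derivative bfam ([:0, 0, 1:] * (P - pderiv P)) s) (at s)"
      using 2 by (auto simp: bfam_def)
    then show ?thesis
      by (rule DERIV_cong_ev[THEN iffD1, rotated 3])
         (use 2 in \<open>auto simp: bfam_def intro!: eventually_mono[OF eventually_nhds_in_open[of "{..<0}"]]\<close>)
  next
    case 3
    \<comment> \<open>From the left the quotient is identically 0. From the right it is t P(t)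
      exp(-t) with t = 1/h tending to infinity.\<close>
    have "((\<lambda>h. (bfam P (0 + h) - bfam P 0) / h) \<longlongrightarrow> 0) (at 0)"
    proof (rule filterlim_split_at)
      show "((\<lambda>h. (bfam P (0 + h) - bfam P 0) / h) \<longlongrightarrow> 0) (at_left 0)"
        by (rule tendsto_eventually) (auto simp: bfam_def eventually_at_filter)
      have "((\<lambda>h. poly ([:0, 1:] * P) (inverse h) * exp (- inverse h)) \<longlongrightarrow> 0) (at_right 0)"
        by (rule filterlim_compose[OF poly_exp_tendsto_0 filterlim_inverse_at_top_right])
      moreover have "\<forall>\<^sub>F h in at_right 0. poly ([:0, 1:] * P) (inverse h) * exp (- inverse h)
          = (bfam P (0 + h) - bfam P 0) / h"
        by (auto simp: bfam_def eventually_at_filter field_simps)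
      ultimately show "((\<lambda>h. (bfam P (0 + h) - bfam P 0) / h) \<longlongrightarrow> 0) (at_right 0)"
        by (rule Lim_transform_eventually)
    qed
    then show ?thesis using 3 by (simp add: DERIV_def bfam_def)
  qed
qed

primrec bpoly :: "nat \<Rightarrow> real poly" where
  "bpoly 0 = 1"
| "bpoly (Suc k) = [:0, 0, 1:] * (bpoly k - pderiv (bpoly k))"

text \<open>The k-th derivative of the function that is exp(-1/s) for s > 0 and 0 elsewhere.\<close>

definition bumpD :: "nat \<Rightarrow> real \<Rightarrow> real" where "bumpD k = bfam (bpoly k)"

lemma bumpD_deriv: "(bumpD k has_real_derivative bumpD (Suc k) s) (at s)"
  using bfam_deriv[of "bpoly k" s] by (simp add: bumpD_def)

lemma bumpD_nonpos: "s \<le> 0 \<Longrightarrow> bumpD k s = 0"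
  by (simp add: bumpD_def bfam_def)

lemma bumpD0_pos: "s > 0 \<Longrightarrow> bumpD 0 s > 0"
  by (simp add: bumpD_def bfam_def)

text \<open>The polynomial for k = 1 is t^2, so the first derivative is positive too. The mean value
  kernel is built from that derivative.\<close>

lemma bumpD1_pos: "s > 0 \<Longrightarrow> bumpD (Suc 0) s > 0"
  by (simp add: bumpD_def bfam_def)

lemma bumpD_nonneg: "0 \<le> bumpD 0 s" "0 \<le> bumpD (Suc 0) s"
  using bumpD0_pos[of s] bumpD1_pos[of s] bumpD_nonpos[of s] by (cases "s > 0"; simp)+

lemma bumpD_continuous: "continuous_on S (bumpD k)"
  by (meson bumpD_deriv DERIV_isCont continuous_at_imp_continuous_on)

text \<open>The profile is composed with a polynomial in x, which keeps the function smooth at the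
  centre y. For positive a and c the support is the ball of radius sqrt(a/c); k counts the
  derivatives already taken of the profile.\<close>

definition bump :: "nat \<Rightarrow> real \<Rightarrow> real \<Rightarrow> 'a::euclidean_space \<Rightarrow> 'a \<Rightarrow> real" where
  "bump k a c y x = bumpD k (a - c * ((x - y) \<bullet> (x - y)))"

lemma quad_deriv:
  "((\<lambda>x. a - c * ((x - y) \<bullet> (x - y))) has_derivative (\<lambda>h. - (2 * c * ((x - y) \<bullet> h)))) (at x)"
  by (auto intro!: derivative_eq_intros simp: inner_commute algebra_simps)

lemma smooth_lin: "smooth (\<lambda>x. x \<bullet> i)"
proof -
  have "((\<lambda>x. x \<bullet> i) has_derivative (\<lambda>h. h \<bullet> i)) (at x)" for x
    by (auto intro!: derivative_eq_intros)
  then have "(\<lambda>x. x \<bullet> i) differentiable (at x)" "pd j (\<lambda>x. x \<bullet> i) = (\<lambda>x. j \<bullet> i)" for x j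
    by (auto intro!: pd_eqI differentiableI)
  then have "ck n (\<lambda>x. x \<bullet> i)" for n by (cases n) (auto simp: ck_const)
  then show ?thesis by (simp add: smooth_iff_ck)
qed

lemma smooth_quad: "smooth (\<lambda>x. a - c * ((x - y) \<bullet> (x - y)))"
proof -
  have d: "(\<lambda>x. a - c * ((x - y) \<bullet> (x - y))) differentiable (at x)" for x
    using quad_deriv by (rule differentiableI)
  have "pd j (\<lambda>x. a - c * ((x - y) \<bullet> (x - y))) = (\<lambda>x. (- (2 * c)) * (x \<bullet> j) + 2 * c * (y \<bullet> j))" for j
    by (rule ext, subst pd_eqI[OF quad_deriv]) (simp add: inner_diff_left algebra_simps)
  moreover have "smooth (\<lambda>x. (- (2 * c)) * (x \<bullet> j) + 2 * c * (y \<bullet> j))" for j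
    by (intro smooth_add smooth_mult smooth_const smooth_lin)
  ultimately have "ck n (pd j (\<lambda>x. a - c * ((x - y) \<bullet> (x - y))))" for n j
    by (simp add: smooth_iff_ck)
  then have "ck n (\<lambda>x. a - c * ((x - y) \<bullet> (x - y)))" for n
    using d by (cases n) auto
  then show ?thesis by (simp add: smooth_iff_ck)
qed

lemma smooth_bump: "smooth (bump k a c y)"
  unfolding bump_def[abs_def] smooth_iff_ck
  by (intro allI ck_family[where b = bumpD] bumpD_deriv) (use smooth_quad smooth_iff_ck in blast)

lemma pd_bump: "pd i (bump k a c y) x = bump (Suc k) a c y x * (- (2 * c * ((x - y) \<bullet> i)))"
  unfolding bump_def[abs_def]
  by (subst pd_compose(1)[OF smooth_diff[OF smooth_quad] bumpD_deriv]) (simp add: pd_eqI[OF quad_deriv])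

lemma bump_outside:
  assumes "0 < c" "a \<le> c * r\<^sup>2" "0 \<le> r" "r \<le> dist y x"
  shows "bump k a c y x = 0"
proof -
  have "r\<^sup>2 \<le> (dist y x)\<^sup>2" using assms by (intro power_mono) auto
  then have "c * r\<^sup>2 \<le> c * (dist y x)\<^sup>2" using assms by (intro mult_left_mono) auto
  moreover have "(dist y x)\<^sup>2 = (x - y) \<bullet> (x - y)"
    by (simp add: dist_norm power2_norm_eq_inner norm_minus_commute)
  ultimately have "c * r\<^sup>2 \<le> c * ((x - y) \<bullet> (x - y))" by (simp only:)
  then have "a - c * ((x - y) \<bullet> (x - y)) \<le> 0" using assms(2) by linarith
  then show ?thesis unfolding bump_def by (rule bumpD_nonpos)
qed

lemma test_fun_bump:
  assumes "0 < c" "a \<le> c * r\<^sup>2" "0 \<le> r" "cball y r \<subseteq> \<Omega>"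
  shows "test_fun \<Omega> (bump k a c y)"
  by (rule test_funI[of _ "cball y r"])
     (use assms in \<open>auto simp: smooth_bump intro!: bump_outside[where r = r]\<close>)

lemma bump_nonneg: "0 \<le> bump 0 a c y x" "0 \<le> bump (Suc 0) a c y x"
  by (simp_all only: bump_def bumpD_nonneg)

lemma bump_pos:
  assumes "0 < c" "dist y x < r" "c * r\<^sup>2 \<le> a"
  shows "0 < bump 0 a c y x" "0 < bump (Suc 0) a c y x"
proof -
  have "(dist y x)\<^sup>2 < r\<^sup>2" using assms by (intro power_strict_mono) auto
  then have "c * (dist y x)\<^sup>2 < c * r\<^sup>2" using assms(1) by (rule mult_strict_left_mono)
  moreover have "(dist y x)\<^sup>2 = (x - y) \<bullet> (x - y)"
    by (simp add: dist_norm power2_norm_eq_inner norm_minus_commute)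
  ultimately have "c * ((x - y) \<bullet> (x - y)) < a"
    using assms(3) by simp
  then show "0 < bump 0 a c y x" "0 < bump (Suc 0) a c y x"
    using bumpD0_pos bumpD1_pos by (simp_all add: bump_def)
qed

lemma pd_pd_bump:
  assumes "i \<in> Basis"
  shows "pd i (pd i (bump k a c y)) x =
    4 * c\<^sup>2 * ((x - y) \<bullet> i)\<^sup>2 * bump (Suc (Suc k)) a c y x - 2 * c * bump (Suc k) a c y x"
proof -
  have l: "((\<lambda>x. - (2 * c * ((x - y) \<bullet> i))) has_derivative (\<lambda>h. - (2 * c * (h \<bullet> i)))) (at x)"
    by (auto intro!: derivative_eq_intros)
  have "pd i (pd i (bump k a c y)) x = pd i (\<lambda>x. bump (Suc k) a c y x * (- (2 * c * ((x - y) \<bullet> i)))) x"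
    by (rule arg_cong[where f = "\<lambda>f. pd i f x"]) (simp add: pd_bump fun_eq_iff)
  also have "\<dots> = bump (Suc k) a c y x * (- (2 * c * (i \<bullet> i)))
     + pd i (bump (Suc k) a c y) x * (- (2 * c * ((x - y) \<bullet> i)))"
    using pd_eqI[OF l, of i] by (subst pd_mult) (auto intro: smooth_diff smooth_bump differentiableI[OF l])
  finally show ?thesis using assms by (simp add: pd_bump power2_eq_square algebra_simps)
qed

text \<open>Summing the squared coordinates leaves only |x-y|^2 and the dimension, so the Laplacian
  is radial again and can be matched with the scale derivative of a radial kernel.\<close>

lemma laplacian_bump:
  "(\<Sum>i\<in>Basis. pd i (pd i (bump k a c y)) x) =
    4 * c\<^sup>2 * ((x - y) \<bullet> (x - y)) * bump (Suc (Suc k)) a c y x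
    - 2 * c * DIM('a) * bump (Suc k) a c y x" for x :: "'a::euclidean_space"
proof -
  have "(x - y) \<bullet> (x - y) = (\<Sum>i\<in>Basis. ((x - y) \<bullet> i)\<^sup>2)"
    by (subst euclidean_inner) (simp add: power2_eq_square)
  then show ?thesis
    by (simp add: pd_pd_bump sum_subtractf sum_distrib_left sum_distrib_right mult.assoc mult.commute mult.left_commute)
qed

section \<open>Integration of test functions\<close>

lemma lborel_shift_integral:
  fixes f :: "'a::euclidean_space \<Rightarrow> 'b::{banach, second_countable_topology}"
  assumes [measurable]: "f \<in> borel_measurable borel"
  shows "(\<integral>x. f (x + a) \<partial>lborel) = (\<integral>x. f x \<partial>lborel)"
proof -
  have "(\<integral>x. f x \<partial>lborel) = (\<integral>x. f x \<partial>(distr lborel borel ((+) a)))" by (simp add: lborel_distr_plus)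
  also have "\<dots> = (\<integral>x. f (a + x) \<partial>lborel)" by (rule integral_distr) measurable
  finally show ?thesis by (simp add: add.commute)
qed

lemma lborel_shift_integrable:
  fixes f :: "'a::euclidean_space \<Rightarrow> 'b::{banach, second_countable_topology}"
  assumes "integrable lborel f"
  shows "integrable lborel (\<lambda>x. f (x + a))"
proof -
  have [measurable]: "f \<in> borel_measurable borel" using borel_measurable_integrable[OF assms] by simp
  have "integrable (distr lborel borel ((+) a)) f" using assms by (simp add: lborel_distr_plus)
  then have "integrable lborel (\<lambda>x. f (a + x))" by (subst (asm) integrable_distr_eq) measurable
  then show ?thesis by (simp add: add.commute)
qed

lemma lborel_minus_integral:
  fixes f :: "'a::euclidean_space \<Rightarrow> real"
  assumes [measurable]: "f \<in> borel_measurable borel"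
  shows "(\<integral>x. f (a - x) \<partial>lborel) = (\<integral>x. f x \<partial>lborel)"
proof -
  have "(\<integral>x. f x \<partial>lborel) = (\<integral>x. f x \<partial>(density (distr lborel borel (\<lambda>x. a + (-1) *\<^sub>R x)) (\<lambda>_. ennreal (\<bar>-1\<bar> ^ DIM('a)))))"
    using lborel_affine[of "-1" a] by (simp del: scaleR_minus1_left)
  also have "\<dots> = (\<integral>x. f x \<partial>(distr lborel borel (\<lambda>x. a + (-1) *\<^sub>R x)))"
    by (simp add: density_1)
  also have "\<dots> = (\<integral>x. f (a + (-1) *\<^sub>R x) \<partial>lborel)" by (rule integral_distr) measurable
  finally show ?thesis by simp
qed

lemma cc_integrable:
  fixes f :: "'a::euclidean_space \<Rightarrow> 'b::{banach, second_countable_topology}"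
  assumes "continuous_on UNIV f" "compact K" "\<And>x. x \<notin> K \<Longrightarrow> f x = 0"
  shows "integrable lborel f"
proof -
  have "integrable lborel (\<lambda>x. indicator K x *\<^sub>R f x)"
    using assms by (intro borel_integrable_compact) (auto intro: continuous_on_subset)
  moreover have "(\<lambda>x. indicator K x *\<^sub>R f x) = f" using assms(3) by (auto simp: indicator_def fun_eq_iff)
  ultimately show ?thesis by simp
qed

lemma cc_L2:
  fixes f :: "'a::euclidean_space \<Rightarrow> 'b::euclidean_space"
  assumes "continuous_on UNIV f" "compact K" "\<And>x. x \<notin> K \<Longrightarrow> f x = 0"
  shows "L2 lborel f"
  unfolding L2_def using assms
  by (auto intro!: cc_integrable[of _ K] continuous_intros borel_measurable_continuous_onI)

lemma test_fun_integrable: "test_fun \<Omega> f \<Longrightarrow> integrable lborel f"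
  by (rule test_fun_support, assumption)
     (rule cc_integrable, auto intro: smooth_continuous test_fun_smooth)

lemma test_fun_L2: "test_fun \<Omega> f \<Longrightarrow> L2 lborel f" "test_fun \<Omega> f \<Longrightarrow> L2 lborel (grad f)"
  by (rule test_fun_support, assumption,
      rule cc_L2, auto intro: smooth_continuous smooth_grad_continuous test_fun_smooth)+

lemma smooth_borel [measurable_dest]: "smooth f \<Longrightarrow> f \<in> borel_measurable borel"
  by (intro borel_measurable_continuous_onI smooth_continuous)

lemma smooth_grad_borel: "smooth f \<Longrightarrow> grad f \<in> borel_measurable borel"
  by (intro borel_measurable_continuous_onI smooth_grad_continuous)

definition diffq :: "('a::euclidean_space \<Rightarrow> real) \<Rightarrow> 'a \<Rightarrow> nat \<Rightarrow> 'a \<Rightarrow> real" where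
  "diffq f h n x = real (Suc n) * (f (x + (1 / real (Suc n)) *\<^sub>R h) - f x)"

text \<open>The majorant does not depend on n: the gradient bound gives its height, and since all
  shifts have length at most |h|, one enlarged ball contains the supports of all quotients.\<close>

lemma diff_quotient:
  fixes f :: "'a::euclidean_space \<Rightarrow> real" and h :: 'a
  assumes t: "test_fun \<Omega> f"
  obtains C R where "\<forall>x. (\<lambda>n. diffq f h n x) \<longlonglongrightarrow> grad f x \<bullet> h"
    "\<forall>n x. \<bar>diffq f h n x\<bar> \<le> C * indicator (cball 0 R) x" "0 \<le> C"
proof -
  let ?q = "diffq f h"
  have s: "smooth f" using t by (rule test_fun_smooth)
  obtain K where K: "compact K" "K \<subseteq> \<Omega>" "\<And>x. x \<notin> K \<Longrightarrow> f x = 0 \<and> grad f x = 0"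
    using test_fun_support[OF t] by blast
  obtain C where C: "0 \<le> C" "\<And>x. norm (grad f x) \<le> C" using test_fun_grad_bounded[OF t] by blast
  obtain R where R: "\<And>x. x \<in> K \<Longrightarrow> norm x \<le> R"
    using compact_imp_bounded[OF K(1)] by (auto simp: bounded_iff)
  show ?thesis
  proof (rule that[of "C * norm h" "R + norm h"]; (intro allI)?)
    fix x
    have d: "((\<lambda>t. f (x + t *\<^sub>R h)) has_real_derivative (grad f x \<bullet> h)) (at 0)"
      unfolding has_field_derivative_def
      by (rule has_derivative_eq_rhs, rule has_derivative_compose[of "\<lambda>t. x + t *\<^sub>R h" "\<lambda>t. t *\<^sub>R h"])
         (auto intro!: derivative_eq_intros grad_has_derivative smooth_diff[OF s] simp: mult.commute)
    then have "((\<lambda>t. (f (x + (0 + t) *\<^sub>R h) - f (x + 0 *\<^sub>R h)) / t) \<longlongrightarrow> grad f x \<bullet> h) (at 0)"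
      by (simp add: DERIV_def)
    moreover have "filterlim (\<lambda>n. 1 / real (Suc n)) (at 0) sequentially"
      unfolding filterlim_at using LIMSEQ_inverse_real_of_nat by (simp add: inverse_eq_divide)
    ultimately have "(\<lambda>n. (f (x + (0 + 1 / real (Suc n)) *\<^sub>R h) - f (x + 0 *\<^sub>R h)) / (1 / real (Suc n)))
        \<longlonglongrightarrow> grad f x \<bullet> h"
      by (rule filterlim_compose)
    then show "(\<lambda>n. ?q n x) \<longlonglongrightarrow> grad f x \<bullet> h" by (simp add: diffq_def mult.commute)
  next
    fix n x
    have "norm ((1 / real (Suc n)) *\<^sub>R h) \<le> norm h"
      using mult_right_mono[of "1 / real (Suc n)" 1 "norm h"] by simp
    then have out: "x \<notin> cball 0 (R + norm h) \<Longrightarrow> x + (1 / real (Suc n)) *\<^sub>R h \<notin> K \<and> x \<notin> K"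
      using R[of x] R[of "x + (1 / real (Suc n)) *\<^sub>R h"]
        norm_triangle_ineq4[of "x + (1 / real (Suc n)) *\<^sub>R h" "(1 / real (Suc n)) *\<^sub>R h"]
        norm_ge_zero[of h] by auto
    have "\<bar>f (x + (1 / real (Suc n)) *\<^sub>R h) - f x\<bar> \<le> C * norm ((1 / real (Suc n)) *\<^sub>R h)"
      using test_fun_lipschitz[OF s C(2), of "x + (1 / real (Suc n)) *\<^sub>R h" x] by simp
    then have "\<bar>?q n x\<bar> \<le> real (Suc n) * (C * norm ((1 / real (Suc n)) *\<^sub>R h))"
      unfolding diffq_def abs_mult by (intro mult_mono) auto
    also have "\<dots> = C * norm h" by simp
    finally show "\<bar>?q n x\<bar> \<le> C * norm h * indicator (cball 0 (R + norm h)) x"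
      using out K(3)[of x] K(3)[of "x + (1 / real (Suc n)) *\<^sub>R h"]
      by (cases "x \<in> cball 0 (R + norm h)") (auto simp: diffq_def)
  qed (use C in simp)
qed

lemma integrable_indicator_cball [simp]: "integrable lborel (indicat_real (cball x0 R))"
  by (rule integrable_real_indicator[OF _ emeasure_lborel_cball_finite]) simp

lemma integrable_const_ball:
  fixes C R :: real and x0 :: "'a::euclidean_space"
  shows "integrable lborel (\<lambda>x. C * indicator (cball x0 R) x)"
  by (rule integrable_mult_right) simp

text \<open>Translation invariance gives every difference quotient the integral 0, and dominated
  convergence passes this to the derivative. Applied to a product it becomes integration by
  parts.\<close>

lemma integral_grad_zero:
  fixes f :: "'a::euclidean_space \<Rightarrow> real"
  assumes t: "test_fun \<Omega> f"
  shows "(\<integral>x. grad f x \<bullet> h \<partial>lborel) = 0"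
proof -
  define q where "q = diffq f h"
  have q_eq: "q n x = real (Suc n) * (f (x + (1 / real (Suc n)) *\<^sub>R h) - f x)" for n x
    by (simp add: q_def diffq_def)
  obtain C R where "\<forall>x. (\<lambda>n. diffq f h n x) \<longlonglongrightarrow> grad f x \<bullet> h"
    "\<forall>n x. \<bar>diffq f h n x\<bar> \<le> C * indicator (cball 0 R) x" and C0: "0 \<le> C"
    by (rule diff_quotient[OF t, of h])
  then have C: "\<And>x. (\<lambda>n. q n x) \<longlonglongrightarrow> grad f x \<bullet> h"
    "\<And>n x. \<bar>q n x\<bar> \<le> C * indicator (cball 0 R) x" "0 \<le> C"
    unfolding q_def by blast+
  have [measurable]: "f \<in> borel_measurable borel" "grad f \<in> borel_measurable borel"
    using test_fun_smooth[OF t] by (auto intro: smooth_borel smooth_grad_borel)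
  have "(\<lambda>n. \<integral>x. q n x \<partial>lborel) \<longlonglongrightarrow> (\<integral>x. grad f x \<bullet> h \<partial>lborel)"
    by (rule integral_dominated_convergence[where w = "\<lambda>x. C * indicator (cball 0 R) x"])
       (use C in \<open>auto simp: q_eq[abs_def] intro: integrable_const_ball\<close>)
  moreover have "(\<integral>x. q n x \<partial>lborel) = 0" for n
    using test_fun_integrable[OF t] lborel_shift_integrable[OF test_fun_integrable[OF t]]
    by (simp add: q_eq lborel_shift_integral)
  ultimately show ?thesis by (simp add: LIMSEQ_const_iff)
qed

lemma integral_by_parts:
  assumes "test_fun \<Omega> f" "smooth g" "i \<in> Basis"
  shows "(\<integral>x. f x * pd i g x \<partial>lborel) = - (\<integral>x. pd i f x * g x \<partial>lborel)"
proof -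
  have "test_fun \<Omega> (\<lambda>x. f x * g x)" by (rule test_fun_mult[OF assms(1,2)])
  then have "(\<integral>x. grad (\<lambda>x. f x * g x) x \<bullet> i \<partial>lborel) = 0" by (rule integral_grad_zero)
  moreover have "grad (\<lambda>x. f x * g x) x \<bullet> i = f x * pd i g x + pd i f x * g x" for x
    using assms by (simp add: grad_inner pd_mult smooth_diff test_fun_smooth)
  moreover have "integrable lborel (\<lambda>x. f x * pd i g x)"
    by (intro test_fun_integrable[of \<Omega>] test_fun_mult assms smooth_pd)
  moreover have "integrable lborel (\<lambda>x. pd i f x * g x)"
    by (intro test_fun_integrable[of \<Omega>] test_fun_mult test_fun_pd assms)
  ultimately show ?thesis by simp
qed

lemma L2norm_shift:
  assumes "u \<in> borel_measurable borel"
  shows "L2norm lborel (\<lambda>x. u (x + a)) = L2norm lborel u"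
proof -
  have "(\<lambda>x. (norm (u x))\<^sup>2) \<in> borel_measurable borel" using assms by measurable
  from lborel_shift_integral[OF this, of a] show ?thesis by (simp add: L2norm_def)
qed

lemma L2_shift: "L2 lborel u \<Longrightarrow> L2 lborel (\<lambda>x. u (x + a))"
  using lborel_shift_integrable[of "\<lambda>x. (norm (u x))\<^sup>2" a] unfolding L2_def
  by (auto intro: measurable_compose[of "\<lambda>x. x + a" _ borel])

text \<open>The translation is split into \<open>N\<close> equal steps; as \<open>N\<close> grows the difference quotients of a
  single step converge boundedly to the directional derivative.\<close>

lemma L2norm_translate_le:
  fixes f :: "'a::euclidean_space \<Rightarrow> real"
  assumes t: "test_fun \<Omega> f"
  shows "L2norm lborel (\<lambda>x. f (x + h) - f x) \<le> norm h * L2norm lborel (grad f)"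
proof -
  note L = test_fun_L2[OF t]
  have [measurable]: "f \<in> borel_measurable borel" "grad f \<in> borel_measurable borel"
    using test_fun_smooth[OF t] by (auto intro: smooth_borel smooth_grad_borel)
  have iter: "L2norm lborel (\<lambda>x. f (x + real k *\<^sub>R s) - f x) \<le> real k * L2norm lborel (\<lambda>x. f (x + s) - f x)" for k s
  proof (induction k)
    case 0
    then show ?case by (simp add: L2norm_def)
  next
    case (Suc k)
    have "L2norm lborel (\<lambda>x. f (x + real (Suc k) *\<^sub>R s) - f x) \<le>
       L2norm lborel (\<lambda>x. f (x + real (Suc k) *\<^sub>R s) - f (x + s)) + L2norm lborel (\<lambda>x. f (x + s) - f x)"
      by (rule L2norm_triangle_diff) (intro L L2_shift)+
    also have "L2norm lborel (\<lambda>x. f (x + real (Suc k) *\<^sub>R s) - f (x + s)) = L2norm lborel (\<lambda>x. f (x + real k *\<^sub>R s) - f x)"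
      using L2norm_shift[of "\<lambda>x. f (x + real k *\<^sub>R s) - f x" s] by (simp add: algebra_simps)
    finally show ?case using Suc by (simp add: algebra_simps)
  qed
  define q where "q = diffq f h"
  have q_eq: "q n x = real (Suc n) * (f (x + (1 / real (Suc n)) *\<^sub>R h) - f x)" for n x
    by (simp add: q_def diffq_def)
  obtain C R where "\<forall>x. (\<lambda>n. diffq f h n x) \<longlonglongrightarrow> grad f x \<bullet> h"
    "\<forall>n x. \<bar>diffq f h n x\<bar> \<le> C * indicator (cball 0 R) x" and C0: "0 \<le> C"
    by (rule diff_quotient[OF t, of h])
  then have C: "\<And>x. (\<lambda>n. q n x) \<longlonglongrightarrow> grad f x \<bullet> h"
    "\<And>n x. \<bar>q n x\<bar> \<le> C * indicator (cball 0 R) x" "0 \<le> C"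
    unfolding q_def by blast+
  have sq: "(L2norm lborel (\<lambda>x. f (x + h) - f x))\<^sup>2 \<le> (\<integral>x. (q n x)\<^sup>2 \<partial>lborel)" for n
  proof -
    have "L2norm lborel (\<lambda>x. f (x + h) - f x) \<le> real (Suc n) * L2norm lborel (\<lambda>x. f (x + (1 / real (Suc n)) *\<^sub>R h) - f x)"
      using iter[of "Suc n" "(1 / real (Suc n)) *\<^sub>R h"] by (simp del: of_nat_Suc)
    also have "\<dots> = L2norm lborel (q n)"
      using L2norm_scaleR[of lborel "real (Suc n)" "\<lambda>x. f (x + (1 / real (Suc n)) *\<^sub>R h) - f x"]
      by (simp add: q_eq[abs_def])
    finally have "(L2norm lborel (\<lambda>x. f (x + h) - f x))\<^sup>2 \<le> (L2norm lborel (q n))\<^sup>2" by (intro power_mono) auto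
    then show ?thesis by (simp add: L2norm_sq)
  qed
  have lim: "(\<lambda>n. \<integral>x. (q n x)\<^sup>2 \<partial>lborel) \<longlonglongrightarrow> (\<integral>x. (grad f x \<bullet> h)\<^sup>2 \<partial>lborel)"
  proof (rule integral_dominated_convergence[where w = "\<lambda>x. C\<^sup>2 * indicator (cball 0 R) x"])
    show "AE x in lborel. norm ((q n x)\<^sup>2) \<le> C\<^sup>2 * indicator (cball 0 R) x" for n
    proof (rule AE_I2)
      fix x
      have "\<bar>q n x\<bar>\<^sup>2 \<le> (C * indicator (cball 0 R) x)\<^sup>2" by (intro power_mono C) auto
      then show "norm ((q n x)\<^sup>2) \<le> C\<^sup>2 * indicator (cball 0 R) x"
        by (cases "x \<in> cball 0 R") simp_all
    qed
    show "integrable lborel (\<lambda>x. C\<^sup>2 * indicator (cball 0 R) (x :: 'a))" by (rule integrable_const_ball)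
  qed (use C(1) in \<open>auto simp: q_eq[abs_def] intro!: tendsto_power\<close>)
  have "(L2norm lborel (\<lambda>x. f (x + h) - f x))\<^sup>2 \<le> (\<integral>x. (grad f x \<bullet> h)\<^sup>2 \<partial>lborel)"
    by (rule LIMSEQ_le_const[OF lim]) (use sq in auto)
  also have "\<dots> \<le> (\<integral>x. (norm h)\<^sup>2 * (norm (grad f x))\<^sup>2 \<partial>lborel)"
  proof (rule integral_mono)
    show "integrable lborel (\<lambda>x. (grad f x \<bullet> h)\<^sup>2)" using L2_inner_left[OF L(2), of h] by (simp add: L2_def)
    show "integrable lborel (\<lambda>x. (norm h)\<^sup>2 * (norm (grad f x))\<^sup>2)" using L(2) by (simp add: L2_def)
    show "(grad f x \<bullet> h)\<^sup>2 \<le> (norm h)\<^sup>2 * (norm (grad f x))\<^sup>2" for x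
      using Cauchy_Schwarz_ineq[of "grad f x" h] by (simp add: power2_norm_eq_inner mult.commute)
  qed
  also have "\<dots> = (norm h * L2norm lborel (grad f))\<^sup>2" by (simp add: L2norm_sq power_mult_distrib)
  finally show ?thesis by (rule power2_le_imp_le) simp
qed

text \<open>The mean value inequality bounds the difference quotients by the same w that bounds the
  derivative, so dominated convergence along sequences applies.\<close>

lemma DERIV_integral:
  fixes F F' :: "real \<Rightarrow> 'a \<Rightarrow> real"
  assumes int: "\<And>t. t \<in> {a<..<b} \<Longrightarrow> integrable M (F t)"
    and der: "\<And>t x. t \<in> {a<..<b} \<Longrightarrow> x \<in> space M \<Longrightarrow> ((\<lambda>t. F t x) has_real_derivative F' t x) (at t)"
    and bd: "\<And>t x. t \<in> {a<..<b} \<Longrightarrow> x \<in> space M \<Longrightarrow> \<bar>F' t x\<bar> \<le> w x"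
    and w: "integrable M w" and meas: "F' t0 \<in> borel_measurable M"
    and t0: "t0 \<in> {a<..<b}"
  shows "((\<lambda>t. \<integral>x. F t x \<partial>M) has_real_derivative (\<integral>x. F' t0 x \<partial>M)) (at t0)"
  unfolding has_field_derivative_iff tendsto_at_iff_sequentially
proof (intro allI impI)
  fix X :: "nat \<Rightarrow> real"
  assume X: "\<forall>i. X i \<in> UNIV - {t0}" "X \<longlonglongrightarrow> t0"
  have "eventually (\<lambda>n. X n \<in> {a<..<b}) sequentially"
    using topological_tendstoD[OF X(2), of "{a<..<b}"] t0 by simp
  then obtain N where N: "\<And>n. n \<ge> N \<Longrightarrow> X n \<in> {a<..<b}" by (auto simp: eventually_sequentially)
  \<comment> \<open>Dropping the first N terms puts every point into the interval, so that the
    majorant is valid for all indices.\<close>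
  define Y where "Y n = X (n + N)" for n
  have Y: "Y n \<in> {a<..<b}" "Y n \<noteq> t0" for n using N X(1) by (auto simp: Y_def)
  have Ylim: "Y \<longlonglongrightarrow> t0" using X(2) unfolding Y_def by (rule LIMSEQ_ignore_initial_segment)
  have "(\<lambda>n. \<integral>x. (F (Y n) x - F t0 x) / (Y n - t0) \<partial>M) \<longlonglongrightarrow> (\<integral>x. F' t0 x \<partial>M)"
  proof (rule integral_dominated_convergence[where w = w])
    show "(\<lambda>x. (F (Y n) x - F t0 x) / (Y n - t0)) \<in> borel_measurable M" for n
      using int[OF Y(1)[of n]] int[OF t0] by measurable
    show "AE x in M. (\<lambda>n. (F (Y n) x - F t0 x) / (Y n - t0)) \<longlonglongrightarrow> F' t0 x"
    proof (rule AE_I2)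
      fix x assume "x \<in> space M"
      then have "((\<lambda>t. (F t x - F t0 x) / (t - t0)) \<longlongrightarrow> F' t0 x) (at t0)"
        using der[OF t0] by (simp add: has_field_derivative_iff)
      then show "(\<lambda>n. (F (Y n) x - F t0 x) / (Y n - t0)) \<longlonglongrightarrow> F' t0 x"
        using Y(2) Ylim unfolding tendsto_at_iff_sequentially by (auto simp: o_def)
    qed
    show "AE x in M. norm ((F (Y n) x - F t0 x) / (Y n - t0)) \<le> w x" for n
    proof (rule AE_I2)
      fix x assume x: "x \<in> space M"
      have "norm (F (Y n) x - F t0 x) \<le> w x * norm (Y n - t0)"
      proof (rule field_differentiable_bound[of "{a<..<b}" "\<lambda>t. F t x" "\<lambda>t. F' t x"])
        show "((\<lambda>t. F t x) has_field_derivative F' t x) (at t within {a<..<b})" if "t \<in> {a<..<b}" for t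
          using der[OF that x] by (rule has_field_derivative_at_within)
      qed (use bd x Y(1) t0 in auto)
      then show "norm ((F (Y n) x - F t0 x) / (Y n - t0)) \<le> w x"
        using Y(2)[of n] by (simp add: divide_le_eq abs_divide)
    qed
  qed (fact meas w)+
  moreover have "(\<integral>x. (F (Y n) x - F t0 x) / (Y n - t0) \<partial>M) = ((\<integral>x. F (Y n) x \<partial>M) - (\<integral>x. F t0 x \<partial>M)) / (Y n - t0)" for n
    using int[OF Y(1)[of n]] int[OF t0] by (simp add: Bochner_Integration.integral_diff)
  ultimately have "(\<lambda>n. ((\<integral>x. F (X (n + N)) x \<partial>M) - (\<integral>x. F t0 x \<partial>M)) / (X (n + N) - t0)) \<longlonglongrightarrow> (\<integral>x. F' t0 x \<partial>M)"
    unfolding Y_def by (simp only:)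
  then have "(\<lambda>n. ((\<integral>x. F (X n) x \<partial>M) - (\<integral>x. F t0 x \<partial>M)) / (X n - t0)) \<longlonglongrightarrow> (\<integral>x. F' t0 x \<partial>M)"
    by (rule LIMSEQ_offset)
  then show "((\<lambda>y. ((\<integral>x. F y x \<partial>M) - (\<integral>x. F t0 x \<partial>M)) / (y - t0)) \<circ> X) \<longlonglongrightarrow> (\<integral>x. F' t0 x \<partial>M)"
    by (simp add: o_def)
qed

text \<open>A bridge: the notions to be treated integrate against completed Lebesgue measure on
  \<Omega>, whereas translations and Fubini are carried out for the Borel measure on the whole
  space.\<close>

lemma integral_lebesgue_on_borel:
  fixes F :: "'a::euclidean_space \<Rightarrow> 'b::{banach, second_countable_topology}"
  assumes "F \<in> borel_measurable borel" "\<Omega> \<in> sets lebesgue" "\<And>x. x \<notin> \<Omega> \<Longrightarrow> F x = 0"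
  shows "(\<integral>x. F x \<partial>lebesgue_on \<Omega>) = (\<integral>x. F x \<partial>lborel)"
    and "integrable (lebesgue_on \<Omega>) F \<longleftrightarrow> integrable lborel F"
proof -
  have "(\<lambda>x. indicator \<Omega> x *\<^sub>R F x) = F" using assms(3) by (auto simp: indicator_def fun_eq_iff)
  then show "(\<integral>x. F x \<partial>lebesgue_on \<Omega>) = (\<integral>x. F x \<partial>lborel)"
     "integrable (lebesgue_on \<Omega>) F \<longleftrightarrow> integrable lborel F"
    using assms(1,2) by (simp_all add: integral_restrict_space integrable_restrict_space
        integral_completion integrable_completion)
qed

lemma borel_measurable_lebesgue_on_borel: "F \<in> borel_measurable borel \<Longrightarrow> F \<in> borel_measurable (lebesgue_on \<Omega>)"
  by (simp add: measurable_completion measurable_restrict_space1)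

lemma L2_lebesgue_on:
  assumes "L2 lborel u" "\<Omega> \<in> sets lebesgue" "\<And>x. x \<notin> \<Omega> \<Longrightarrow> u x = 0"
  shows "L2 (lebesgue_on \<Omega>) u" "L2norm (lebesgue_on \<Omega>) u = L2norm lborel u"
proof -
  have u: "u \<in> borel_measurable borel" using assms(1) by (simp add: L2_def)
  then have m: "(\<lambda>x. (norm (u x))\<^sup>2) \<in> borel_measurable borel" by measurable
  note i = integral_lebesgue_on_borel[OF m assms(2)]
  show "L2 (lebesgue_on \<Omega>) u" "L2norm (lebesgue_on \<Omega>) u = L2norm lborel u"
    using assms i borel_measurable_lebesgue_on_borel[OF u] by (simp_all add: L2_def L2norm_def)
qed

lemma test_fun_L2_on:
  assumes "test_fun \<Omega> f" "\<Omega> \<in> sets lebesgue"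
  shows "L2 (lebesgue_on \<Omega>) f" "L2 (lebesgue_on \<Omega>) (grad f)"
  using test_fun_L2[OF assms(1)] assms(2) test_fun_outside[OF assms(1)] by (auto intro!: L2_lebesgue_on)

text \<open>For open \<open>U\<close>, the test functions \<open>k s / (1 + k s)\<close>, with \<open>s\<close> a growing sum of bumps on balls
  exhausting \<open>U\<close>, increase to the indicator of \<open>U\<close>.\<close>

lemma fundamental_nonneg:
  fixes h :: "'a::euclidean_space \<Rightarrow> real"
  assumes O: "open O'" and h: "integrable (lebesgue_on O') h"
    and pos: "\<And>\<psi>. test_fun O' \<psi> \<Longrightarrow> (\<And>x. 0 \<le> \<psi> x) \<Longrightarrow> 0 \<le> (\<integral>x. h x * \<psi> x \<partial>lebesgue_on O')"
  shows "AE x in lebesgue_on O'. 0 \<le> h x"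
proof -
  let ?M = "lebesgue_on O'"
  note [measurable] = borel_measurable_integrable[OF h]
  have Os: "O' \<in> sets lebesgue" using O by auto
  have spM: "space ?M = O'" by simp
  have open_nonneg: "0 \<le> (\<integral>x. h x * indicator U x \<partial>?M)" if U: "open U" "U \<subseteq> O'" for U
  proof (cases "U = {}")
    case False
    define F where "F = {ball y r |y r. 0 < r \<and> cball y r \<subseteq> U}"
    obtain F' where F': "F' \<subseteq> F" "countable F'" "\<Union>F' = \<Union>F"
      using Lindelof[of F] by (auto simp: F_def)
    have "\<Union>F = U"
    proof
      show "U \<subseteq> \<Union>F"
      proof
        fix x assume "x \<in> U"
        then obtain r where "0 < r" "cball x r \<subseteq> U" using U(1) open_contains_cball by blast
        then show "x \<in> \<Union>F" by (auto simp: F_def intro!: exI[of _ "ball x r"])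
      qed
    qed (auto simp: F_def)
    then have F'U: "\<Union>F' = U" using F' by simp
    then have ne: "F' \<noteq> {}" using False by auto
    \<comment> \<open>The enumeration may repeat balls but needs a nonempty family; this is the
      reason for the case split on \<open>U\<close>.\<close>
    define e where "e = from_nat_into F'"
    have rng: "range e = F'" unfolding e_def by (rule range_from_nat_into[OF ne F'(2)])
    then have "\<exists>y r. e n = ball y r \<and> 0 < r \<and> cball y r \<subseteq> U" for n
      using F'(1) rng rangeI[of e n] unfolding F_def by blast
    then obtain y r where yr: "\<And>n. e n = ball (y n) (r n)" "\<And>n. 0 < r n" "\<And>n. cball (y n) (r n) \<subseteq> U"
      by metis
    define \<eta> where "\<eta> n = bump 0 ((r n)\<^sup>2) 1 (y n)" for n
    have \<eta>: "test_fun U (\<eta> n)" "0 \<le> \<eta> n x" "x \<in> e n \<Longrightarrow> 0 < \<eta> n x" for n x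
      using yr(1)[of n] yr(2)[of n] yr(3)[of n]
      by (auto simp: \<eta>_def intro!: test_fun_bump[where r = "r n"] bump_nonneg bump_pos[where r = "r n"])
    define s where "s k x = (\<Sum>j\<le>k. \<eta> j x)" for k x
    define \<psi> where "\<psi> k x = real k * s k x * inverse (1 + real k * s k x)" for k x
    have s0: "0 \<le> s k x" for k x by (auto simp: s_def intro!: sum_nonneg \<eta>)
    have p: "0 < 1 + real k * s k x" for k x using s0[of k x] by (simp add: add_pos_nonneg)
    have st: "test_fun U (s k)" for k unfolding s_def by (intro test_fun_sum \<eta>)
    have \<psi>: "test_fun U (\<psi> k)" for k
      unfolding \<psi>_def by (intro test_fun_mult test_fun_cmult st smooth_inverse smooth_add smooth_mult smooth_const
        test_fun_smooth[OF st]) (use p in \<open>metis less_irrefl\<close>)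
    have \<psi>01: "0 \<le> \<psi> k x" "\<psi> k x \<le> 1" for k x
      using p[of k x] s0[of k x] by (auto simp: \<psi>_def field_simps)
    have lim: "(\<lambda>k. \<psi> k x) \<longlonglongrightarrow> indicator U x" for x
    proof (cases "x \<in> U")
      case True
      then have "x \<in> \<Union>(range e)" using F'U rng by simp
      then obtain j where "x \<in> e j" by blast
      then have j: "0 < \<eta> j x" by (rule \<eta>)
      have "1 - inverse (1 + real k * \<eta> j x) \<le> \<psi> k x" if "k \<ge> j" for k
      proof -
        have "\<eta> j x \<le> s k x" unfolding s_def using that by (intro member_le_sum) (auto simp: \<eta>)
        then have "1 + real k * \<eta> j x \<le> 1 + real k * s k x" by (simp add: mult_left_mono)
        then have "inverse (1 + real k * s k x) \<le> inverse (1 + real k * \<eta> j x)"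
          using j by (intro le_imp_inverse_le) (auto intro: add_pos_nonneg)
        moreover have "\<psi> k x = 1 - inverse (1 + real k * s k x)"
          using p[of k x] by (simp add: \<psi>_def field_simps)
        ultimately show ?thesis by simp
      qed
      then have ev: "\<forall>\<^sub>F k in sequentially. 1 - inverse (1 + real k * \<eta> j x) \<le> \<psi> k x"
        by (auto simp: eventually_sequentially)
      have "filterlim (\<lambda>k. 1 + real k * \<eta> j x) at_top sequentially"
        by (rule filterlim_tendsto_add_at_top[OF tendsto_const])
           (rule filterlim_at_top_mult_tendsto_pos[OF tendsto_const j filterlim_real_sequentially])
      then have "(\<lambda>k. 1 - inverse (1 + real k * \<eta> j x)) \<longlonglongrightarrow> 1 - 0"
        by (intro tendsto_diff tendsto_const tendsto_inverse_0_at_top)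
      then have "(\<lambda>k. \<psi> k x) \<longlonglongrightarrow> 1"
        using ev by (intro tendsto_sandwich[OF ev _ _ tendsto_const]) (auto simp: \<psi>01)
      then show ?thesis using True by simp
    next
      case False
      then have "\<psi> k x = 0" for k using test_fun_outside[OF \<psi>] by blast
      then show ?thesis using False by simp
    qed
    have [measurable]: "\<psi> k \<in> borel_measurable ?M" for k
      by (intro borel_measurable_lebesgue_on_borel smooth_borel test_fun_smooth[OF \<psi>])
    have [measurable]: "(indicator U :: _ \<Rightarrow> real) \<in> borel_measurable ?M"
      using U by (intro borel_measurable_lebesgue_on_borel) auto
    have "(\<lambda>k. \<integral>x. h x * \<psi> k x \<partial>?M) \<longlonglongrightarrow> (\<integral>x. h x * indicator U x \<partial>?M)"
    proof (rule integral_dominated_convergence[where w = "\<lambda>x. \<bar>h x\<bar>"])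
      show "AE x in ?M. norm (h x * \<psi> k x) \<le> \<bar>h x\<bar>" for k
        using \<psi>01[of k] by (auto simp: abs_mult intro!: mult_left_le)
    qed (use h lim in \<open>auto intro!: tendsto_mult\<close>)
    then show ?thesis
      by (rule LIMSEQ_le_const) (use pos[OF test_fun_mono[OF \<psi> U(2)] \<psi>01(1)] in auto)
  qed simp
  define E where "E = {x \<in> space ?M. h x < 0}"
  have EM: "E \<in> sets ?M" unfolding E_def by measurable
  then have E: "E \<in> sets lebesgue" "E \<subseteq> O'" using Os by (auto simp: sets_restrict_space_iff E_def)
  have "\<exists>T. open T \<and> E \<subseteq> T \<and> T - E \<in> lmeasurable \<and> emeasure lebesgue (T - E) < ennreal (1 / real (Suc n))" for n
    by (rule sets_lebesgue_outer_open[OF E(1), of "1 / real (Suc n)"]) auto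
  then obtain T where T: "\<And>n. open (T n)" "\<And>n. E \<subseteq> T n" "\<And>n. T n - E \<in> lmeasurable"
    "\<And>n. emeasure lebesgue (T n - E) < ennreal (1 / real (Suc n))" by metis
  \<comment> \<open>These sets are open, decrease, and contain \<open>E\<close>; their intersection
    exceeds \<open>E\<close> only by the null set \<open>N\<close>. Nonnegativity on open sets
    thereby descends to \<open>E\<close>.\<close>
  define U where "U n = O' \<inter> (\<Inter>k\<le>n. T k)" for n
  define N where "N = O' \<inter> (\<Inter>k. T k) - E"
  have Ns: "N \<in> sets lebesgue" unfolding N_def using O T(1) E by (intro sets.Diff sets.Int) auto
  have "emeasure lebesgue N \<le> 0"
  proof (rule LIMSEQ_le_const)
    show "(\<lambda>n. ennreal (1 / real (Suc n))) \<longlonglongrightarrow> 0"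
      using tendsto_ennrealI[OF LIMSEQ_inverse_real_of_nat] by (simp add: inverse_eq_divide)
    have "emeasure lebesgue N \<le> ennreal (1 / real (Suc n))" for n
    proof -
      have "emeasure lebesgue N \<le> emeasure lebesgue (T n - E)"
        using T(3)[of n] by (intro emeasure_mono) (auto simp: N_def fmeasurable_def)
      then show ?thesis using T(4)[of n] by simp
    qed
    then show "\<exists>N'. \<forall>n\<ge>N'. emeasure lebesgue N \<le> ennreal (1 / real (Suc n))" by auto
  qed
  then have "N \<in> null_sets lebesgue" using Ns by (auto simp: null_sets_def)
  then have "AE x in lebesgue. x \<notin> N" by (rule AE_not_in)
  then have "AE x in lebesgue. x \<in> O' \<longrightarrow> x \<notin> N" by (rule eventually_mono) blast
  then have aeN: "AE x in ?M. x \<notin> N" using Os by (subst AE_restrict_space_iff) simp_all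
  have lim: "AE x in ?M. (\<lambda>n. h x * indicator (U n) x) \<longlonglongrightarrow> h x * indicator E x"
    using aeN AE_space
  proof eventually_elim
    case (elim x)
    show ?case
    proof (cases "x \<in> E")
      case True
      then have "x \<in> U n" for n using T(2) E(2) by (auto simp: U_def)
      then show ?thesis using True by simp
    next
      case False
      then obtain k where "x \<notin> T k" using elim by (auto simp: N_def spM)
      then have "x \<notin> U n" if "n \<ge> k" for n using that by (auto simp: U_def)
      then have "\<forall>\<^sub>F n in sequentially. h x * indicator (U n) x = h x * indicator E x"
        using False unfolding eventually_sequentially by (intro exI[of _ k]) auto
      then show ?thesis by (rule tendsto_eventually)
    qed
  qed
  have Uo: "open (U n)" for n unfolding U_def using O T(1) by (intro open_Int open_INT) auto
  have [measurable]: "(indicator (U n) :: _ \<Rightarrow> real) \<in> borel_measurable ?M" for n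
    using Uo[of n] by (intro borel_measurable_lebesgue_on_borel) auto
  have [measurable]: "E \<in> sets ?M" by (fact EM)
  have "(\<lambda>n. \<integral>x. h x * indicator (U n) x \<partial>?M) \<longlonglongrightarrow> (\<integral>x. h x * indicator E x \<partial>?M)"
  proof (rule integral_dominated_convergence[where w = "\<lambda>x. \<bar>h x\<bar>"])
    show "(\<lambda>x. h x * indicator E x) \<in> borel_measurable ?M" by measurable
    show "(\<lambda>x. h x * indicator (U n) x) \<in> borel_measurable ?M" for n by measurable
    show "AE x in ?M. norm (h x * indicator (U n) x) \<le> \<bar>h x\<bar>" for n
      by (rule AE_I2) (simp add: indicator_def)
  qed (use h lim in auto)
  then have ge: "0 \<le> (\<integral>x. h x * indicator E x \<partial>?M)"
    by (rule LIMSEQ_le_const) (use open_nonneg[OF Uo] in \<open>auto simp: U_def\<close>)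
  have int: "integrable ?M (\<lambda>x. - (h x * indicator E x))"
    using integrable_real_mult_indicator[OF EM h] by (simp add: mult.commute)
  \<comment> \<open>On \<open>E\<close> the integrand is positive by definition, yet its integral
    was just shown to be at most 0; so it vanishes almost everywhere.\<close>
  have "0 = (\<integral>x. - (h x * indicator E x) \<partial>?M)"
  proof (rule antisym)
    show "0 \<le> (\<integral>x. - (h x * indicator E x) \<partial>?M)"
      by (rule integral_nonneg_AE) (auto simp: E_def indicator_def)
  qed (use ge in simp)
  then have "AE x in ?M. - (h x * indicator E x) = 0"
    using integral_nonneg_eq_0_iff_AE[OF int] by (auto simp: E_def indicator_def)
  then show ?thesis using AE_space by eventually_elim (auto simp: E_def indicator_def split: if_splits)
qed

lemma fundamental_zero:
  fixes h :: "'a::euclidean_space \<Rightarrow> real"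
  assumes O: "open O'" and h: "integrable (lebesgue_on O') h"
    and z: "\<And>\<psi>. test_fun O' \<psi> \<Longrightarrow> (\<integral>x. h x * \<psi> x \<partial>lebesgue_on O') = 0"
  shows "AE x in lebesgue_on O'. h x = 0"
  using fundamental_nonneg[OF O h] fundamental_nonneg[OF O, of "\<lambda>x. - h x"] h z
  by (auto elim: eventually_elim2)

text \<open>Null sets add up only countably often, so Lindelof's theorem first reduces the cover by
  balls to a countable one.\<close>

lemma AE_local:
  fixes \<Omega> :: "'a::euclidean_space set"
  assumes "open \<Omega>" and loc: "\<And>y. y \<in> \<Omega> \<Longrightarrow> \<exists>r>0. AE x in lebesgue_on (ball y r). x \<in> \<Omega> \<longrightarrow> P x"
  shows "AE x in lebesgue_on \<Omega>. P x"
proof -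
  obtain r where r: "\<And>y. y \<in> \<Omega> \<Longrightarrow> 0 < r y" "\<And>y. y \<in> \<Omega> \<Longrightarrow> AE x in lebesgue_on (ball y (r y)). x \<in> \<Omega> \<longrightarrow> P x"
    using loc by metis
  define F where "F = (\<lambda>y. ball y (r y)) ` \<Omega>"
  obtain F' where F': "F' \<subseteq> F" "countable F'" "\<Union>F' = \<Union>F"
    using Lindelof[of F] by (auto simp: F_def)
  have cov: "\<Omega> \<subseteq> \<Union>F'" unfolding F'(3) F_def using r(1) by force
  have "AE x in lebesgue. \<forall>A\<in>F'. x \<in> A \<longrightarrow> x \<in> \<Omega> \<longrightarrow> P x"
  proof (subst AE_ball_countable[OF F'(2)], rule ballI)
    fix A assume "A \<in> F'"
    then obtain y where "y \<in> \<Omega>" "A = ball y (r y)" using F'(1) by (auto simp: F_def)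
    then show "AE x in lebesgue. x \<in> A \<longrightarrow> x \<in> \<Omega> \<longrightarrow> P x"
      using r(2)[of y] by (subst (asm) AE_restrict_space_iff) auto
  qed
  then have "AE x in lebesgue. x \<in> \<Omega> \<longrightarrow> P x"
    by eventually_elim (use cov in blast)
  then show ?thesis using assms(1) by (subst AE_restrict_space_iff) auto
qed

section \<open>Mollification\<close>

text \<open>A nonempty open set is never null. This converts an almost everywhere statement into a
  single witness, and is used repeatedly to refute vanishing.\<close>

lemma AE_open_ex:
  fixes U :: "'a::euclidean_space set"
  assumes "open U" "U \<noteq> {}" "AE x in lebesgue. x \<in> U \<longrightarrow> P x"
  shows "\<exists>x\<in>U. P x"
proof (rule ccontr)
  assume "\<not> (\<exists>x\<in>U. P x)"
  then have "AE x in lebesgue. x \<notin> U" using assms(3) by (auto elim!: eventually_mono)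
  moreover have "U \<in> sets lebesgue" using assms(1) by auto
  ultimately have "U \<in> null_sets lebesgue" by (simp add: AE_iff_null_sets)
  then show False using open_not_negligible[OF assms(1,2)] by (simp add: negligible_iff_null_sets)
qed

lemma integral_continuous_pos:
  fixes f :: "'a::euclidean_space \<Rightarrow> real"
  assumes "continuous_on UNIV f" "integrable lborel f" "\<And>x. 0 \<le> f x" "0 < f a"
  shows "0 < (\<integral>x. f x \<partial>lborel)"
proof (rule ccontr)
  assume "\<not> 0 < (\<integral>x. f x \<partial>lborel)"
  moreover have "0 \<le> (\<integral>x. f x \<partial>lborel)" using assms(3) by simp
  ultimately have "(\<integral>x. f x \<partial>lborel) = 0" by linarith
  then have "AE x in lborel. f x = 0"
    using integral_nonneg_eq_0_iff_AE[OF assms(2)] assms(3) by simp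
  then have "AE x in lebesgue. f x = 0" by (rule AE_completion)
  then have "AE x in lebesgue. x \<in> {x. 0 < f x} \<longrightarrow> f x = 0" by (rule eventually_mono) simp
  moreover have "open {x. 0 < f x}" by (intro open_Collect_less assms continuous_on_const)
  ultimately show False
    using AE_open_ex[of "{x. 0 < f x}" "\<lambda>x. f x = 0"] assms(4) by auto
qed

text \<open>Only continuity is demanded, because the normalised mean value kernels must qualify as
  well; smoothness is requested separately where derivatives fall on the kernel.\<close>

definition mollk :: "real \<Rightarrow> ('a::euclidean_space \<Rightarrow> real) \<Rightarrow> bool" where
  "mollk r j \<longleftrightarrow> continuous_on UNIV j \<and> (\<forall>z. 0 \<le> j z) \<and> (\<forall>z. r \<le> norm z \<longrightarrow> j z = 0) \<and>
     (\<integral>z. j z \<partial>lborel) = 1"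

lemma mollkD:
  assumes "mollk r j"
  shows "continuous_on UNIV j" "0 \<le> j z" "r \<le> norm z \<Longrightarrow> j z = 0" "(\<integral>z. j z \<partial>lborel) = 1"
    "j \<in> borel_measurable borel" "integrable lborel j"
proof -
  show c: "continuous_on UNIV j" "0 \<le> j z" "r \<le> norm z \<Longrightarrow> j z = 0" "(\<integral>z. j z \<partial>lborel) = 1"
    using assms by (auto simp: mollk_def)
  then show "j \<in> borel_measurable borel" by (intro borel_measurable_continuous_onI)
  show "integrable lborel j"
    using c(1) assms by (intro cc_integrable[of j "cball 0 r"]) (auto simp: mollk_def)
qed

lemma mollk_bounded:
  assumes "mollk r j"
  obtains C where "0 \<le> C" "\<And>z. j z \<le> C"
proof -
  have "j z = 0" if "z \<notin> cball 0 r" for z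
    using that by (intro mollkD(3)[OF assms]) simp
  then obtain C where "0 \<le> C" "\<And>z. norm (j z) \<le> C"
    using cont_compact_support_bounded[OF mollkD(1)[OF assms] compact_cball] by blast
  then show ?thesis using that[of C] by (metis abs_le_D1 real_norm_def)
qed

lemma mollk_shift:
  assumes "mollk r j"
  shows "(\<integral>y. j (x - y) \<partial>lborel) = 1" "integrable lborel (\<lambda>y. j (x - y))"
proof -
  show "(\<integral>y. j (x - y) \<partial>lborel) = 1"
    using lborel_minus_integral[OF mollkD(5)[OF assms], of x] mollkD(4)[OF assms] by simp
  show "integrable lborel (\<lambda>y. j (x - y))"
  proof (rule cc_integrable[of _ "cball x r"])
    show "continuous_on UNIV (\<lambda>y. j (x - y))"
      by (rule continuous_on_compose2[OF mollkD(1)[OF assms]]) (auto intro!: continuous_intros)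
  qed (auto simp: dist_norm intro!: mollkD(3)[OF assms])
qed

lemma mollk_normalize:
  assumes "continuous_on UNIV k" "\<And>z. 0 \<le> k z" "\<And>z. r \<le> norm z \<Longrightarrow> k z = 0" "0 < k 0"
  shows "mollk r (\<lambda>z. k z / (\<integral>z. k z \<partial>lborel))" "0 < (\<integral>z. k z \<partial>lborel)"
proof -
  have i: "integrable lborel k" using assms by (intro cc_integrable[of k "cball 0 r"]) auto
  show p: "0 < (\<integral>z. k z \<partial>lborel)" by (rule integral_continuous_pos[OF assms(1) i assms(2,4)])
  show "mollk r (\<lambda>z. k z / (\<integral>z. k z \<partial>lborel))"
    using assms p by (auto simp: mollk_def intro!: continuous_intros)
qed

lemma ex_smooth_mollk:
  assumes "0 < r"
  obtains j :: "'a::euclidean_space \<Rightarrow> real" where "mollk r j" "smooth j"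
proof -
  let ?k = "bump 0 (r\<^sup>2) 1 (0::'a)"
  have m: "mollk r (\<lambda>z. ?k z / (\<integral>z. ?k z \<partial>lborel))"
  proof (rule mollk_normalize(1))
    show "continuous_on UNIV ?k" by (intro smooth_continuous smooth_bump)
    show "?k z = 0" if "r \<le> norm z" for z
      using that assms by (intro bump_outside[where r = r]) (auto simp: dist_norm)
    show "0 < ?k 0" using assms by (intro bump_pos[where r = r]) auto
  qed (rule bump_nonneg)
  have "smooth (\<lambda>z. ?k z * (1 / (\<integral>z. ?k z \<partial>lborel)))"
    by (intro smooth_mult smooth_const smooth_bump)
  then show ?thesis using that[OF m] by simp
qed

text \<open>Fubini moves the kernel from the integrable factor to the continuous one. There the
  averages \<open>P n\<close> are bounded by C and converge pointwise to \<psi>, so |v| C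
  dominates.\<close>

lemma moll_lim:
  fixes v :: "'a::euclidean_space \<Rightarrow> real"
  assumes v: "integrable lborel v" and \<psi>: "continuous_on UNIV \<psi>" "compact K" "\<And>x. x \<notin> K \<Longrightarrow> \<psi> x = 0"
    and j: "\<And>n. mollk (r n) (j n)" and r: "r \<longlonglongrightarrow> 0"
  shows "(\<lambda>n. \<integral>y. (\<integral>x. v x * j n (x - y) \<partial>lborel) * \<psi> y \<partial>lborel) \<longlonglongrightarrow> (\<integral>x. v x * \<psi> x \<partial>lborel)"
proof -
  have [measurable]: "v \<in> borel_measurable borel" using borel_measurable_integrable[OF v] by simp
  have [measurable]: "\<psi> \<in> borel_measurable borel" by (intro borel_measurable_continuous_onI \<psi>)
  have [measurable]: "j n \<in> borel_measurable borel" for n by (rule mollkD(5)[OF j])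
  obtain C where C: "0 \<le> C" "\<And>x. norm (\<psi> x) \<le> C" using cont_compact_support_bounded[OF \<psi>] by blast
  have \<psi>i: "integrable lborel \<psi>" by (rule cc_integrable[OF \<psi>])
  define P where "P n x = (\<integral>y. j n (x - y) * \<psi> y \<partial>lborel)" for n x
  have Pi: "integrable lborel (\<lambda>y. j n (x - y) * w y)" if "\<And>y. norm (w y) \<le> D" "w \<in> borel_measurable borel" for n x w D
  proof (rule Bochner_Integration.integrable_bound[OF integrable_mult_right[OF mollk_shift(2)[OF j[of n], of x], of D]])
    show "AE y in lborel. norm (j n (x - y) * w y) \<le> norm (D * j n (x - y))"
    proof (rule AE_I2)
      fix y
      have "norm (w y) \<le> \<bar>D\<bar>" using that(1)[of y] by linarith
      then show "norm (j n (x - y) * w y) \<le> norm (D * j n (x - y))"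
        using mult_right_mono[of "norm (w y)" "\<bar>D\<bar>" "\<bar>j n (x - y)\<bar>"] by (simp add: abs_mult mult.commute)
    qed
  qed (use that(2) in measurable)
  have fub: "(\<integral>y. (\<integral>x. v x * j n (x - y) \<partial>lborel) * \<psi> y \<partial>lborel) = (\<integral>x. v x * P n x \<partial>lborel)" for n
  proof -
    obtain D where D: "0 \<le> D" "\<And>z. j n z \<le> D" using mollk_bounded[OF j[of n]] by blast
    \<comment> \<open>A crude product majorant, with \<open>D\<close> the maximum of the kernel,
      justifies Fubini.\<close>
    have "integrable (lborel \<Otimes>\<^sub>M lborel) (\<lambda>(x, y). \<bar>v x\<bar> * (D * \<bar>\<psi> y\<bar>))"
    proof (rule lborel_pair.Fubini_integrable)
      show "integrable lborel (\<lambda>x. \<integral>y. norm (case (x, y) of (x, y) \<Rightarrow> \<bar>v x\<bar> * (D * \<bar>\<psi> y\<bar>)) \<partial>lborel)"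
        using v by (simp add: abs_mult D)
      show "AE x in lborel. integrable lborel (\<lambda>y. case (x, y) of (x, y) \<Rightarrow> \<bar>v x\<bar> * (D * \<bar>\<psi> y\<bar>))"
        using \<psi>i by simp
    qed measurable
    then have "integrable (lborel \<Otimes>\<^sub>M lborel) (\<lambda>(x, y). v x * j n (x - y) * \<psi> y)"
    proof (rule Bochner_Integration.integrable_bound)
      show "AE z in lborel \<Otimes>\<^sub>M lborel. norm (case z of (x, y) \<Rightarrow> v x * j n (x - y) * \<psi> y) \<le>
          norm (case z of (x, y) \<Rightarrow> \<bar>v x\<bar> * (D * \<bar>\<psi> y\<bar>))"
        using D mollkD(2)[OF j]
        by (auto intro!: AE_I2 simp: abs_mult mult.assoc intro!: mult_left_mono mult_right_mono)
    qed measurable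
    then have "(\<integral>y. (\<integral>x. v x * j n (x - y) * \<psi> y \<partial>lborel) \<partial>lborel) = (\<integral>x. (\<integral>y. v x * j n (x - y) * \<psi> y \<partial>lborel) \<partial>lborel)"
      by (rule lborel_pair.Fubini_integral)
    moreover have "(\<integral>y. v x * j n (x - y) * \<psi> y \<partial>lborel) = v x * P n x" for x
      by (simp add: P_def mult.assoc)
    moreover have "(\<integral>x. v x * j n (x - y) * \<psi> y \<partial>lborel) = (\<integral>x. v x * j n (x - y) \<partial>lborel) * \<psi> y" for y
      by simp
    ultimately show ?thesis by (simp only:)
  qed
  have Pb: "\<bar>P n x\<bar> \<le> C" for n x
  proof -
    have "\<bar>P n x\<bar> \<le> (\<integral>y. norm (j n (x - y) * \<psi> y) \<partial>lborel)"
      unfolding P_def using integral_norm_bound[of lborel "\<lambda>y. j n (x - y) * \<psi> y"] by simp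
    also have "\<dots> \<le> (\<integral>y. C * j n (x - y) \<partial>lborel)"
      using C mollkD(2)[OF j] mollk_shift(2)[OF j] 
      by (intro integral_mono integrable_norm Pi[OF C(2)])
         (auto simp: abs_mult mult.commute[of C] intro!: mult_left_mono)
    also have "\<dots> = C" using mollk_shift(1)[OF j] by simp
    finally show ?thesis .
  qed
  have Plim: "(\<lambda>n. P n x) \<longlonglongrightarrow> \<psi> x" for x
  proof (rule LIMSEQ_I)
    fix e :: real assume e: "0 < e"
    have "isCont \<psi> x" using \<psi>(1) by (simp add: continuous_on_eq_continuous_at)
    then obtain d where d: "0 < d" "\<And>y. dist y x < d \<Longrightarrow> dist (\<psi> y) (\<psi> x) < e / 2"
      using e unfolding continuous_at_eps_delta by (metis half_gt_zero)
    obtain N where N: "\<And>n. n \<ge> N \<Longrightarrow> \<bar>r n\<bar> < d" using LIMSEQ_D[OF r d(1)] by auto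
    have "norm (P n x - \<psi> x) < e" if n: "n \<ge> N" for n
    proof -
      have "P n x - \<psi> x = (\<integral>y. j n (x - y) * \<psi> y \<partial>lborel) - (\<integral>y. j n (x - y) * \<psi> x \<partial>lborel)"
        using mollk_shift[OF j] by (simp add: P_def)
      also have "\<dots> = (\<integral>y. j n (x - y) * (\<psi> y - \<psi> x) \<partial>lborel)"
        using Pi[OF C(2)] mollk_shift(2)[OF j]
        by (subst Bochner_Integration.integral_diff[symmetric]) (auto simp: algebra_simps)
      also have "norm \<dots> \<le> (\<integral>y. norm (j n (x - y) * (\<psi> y - \<psi> x)) \<partial>lborel)" by (rule integral_norm_bound)
      also have "\<dots> \<le> (\<integral>y. j n (x - y) * (e / 2) \<partial>lborel)"
      proof (rule integral_mono)
        show "integrable lborel (\<lambda>y. norm (j n (x - y) * (\<psi> y - \<psi> x)))"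
        proof (intro integrable_norm Pi)
          show "norm (\<psi> y - \<psi> x) \<le> C + C" for y
            using norm_triangle_ineq4[of "\<psi> y" "\<psi> x"] C(2)[of x] C(2)[of y] by linarith
        qed measurable
        show "integrable lborel (\<lambda>y. j n (x - y) * (e / 2))" using mollk_shift(2)[OF j] by simp
        show "norm (j n (x - y) * (\<psi> y - \<psi> x)) \<le> j n (x - y) * (e / 2)" for y
        proof (cases "dist y x < d")
          case True
          then have "\<bar>\<psi> y - \<psi> x\<bar> \<le> e / 2" using d(2)[of y] by (simp add: dist_real_def)
          then have "j n (x - y) * \<bar>\<psi> y - \<psi> x\<bar> \<le> j n (x - y) * (e / 2)"
            using mollkD(2)[OF j] by (rule mult_left_mono)
          then show ?thesis using mollkD(2)[OF j, of n "x - y"] by (simp add: abs_mult)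
        next
          case False
          then have "r n \<le> norm (x - y)" using N[OF n] by (simp add: dist_norm norm_minus_commute)
          then show ?thesis using mollkD(3)[OF j, of n "x - y"] by simp
        qed
      qed
      also have "\<dots> = e / 2" using mollk_shift(1)[OF j] by simp
      finally show ?thesis using e by simp
    qed
    then show "\<exists>N. \<forall>n\<ge>N. norm (P n x - \<psi> x) < e" by blast
  qed
  have [measurable]: "P n \<in> borel_measurable borel" for n
    unfolding P_def by measurable
  have "(\<lambda>n. \<integral>x. v x * P n x \<partial>lborel) \<longlonglongrightarrow> (\<integral>x. v x * \<psi> x \<partial>lborel)"
  proof (rule integral_dominated_convergence[where w = "\<lambda>x. \<bar>v x\<bar> * C"])
    show "AE x in lborel. norm (v x * P n x) \<le> \<bar>v x\<bar> * C" for n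
      using Pb by (auto simp: abs_mult intro!: mult_left_mono)
    show "AE x in lborel. (\<lambda>n. v x * P n x) \<longlonglongrightarrow> v x * \<psi> x"
      by (intro AE_I2 tendsto_mult tendsto_const Plim)
    show "integrable lborel (\<lambda>x. \<bar>v x\<bar> * C)" using v by simp
  qed measurable
  then show ?thesis by (simp only: fub)
qed

text \<open>A Lebesgue measurable function must be replaced by a Borel one before convolution with
  respect to \<open>lborel\<close> is available. Extension by zero outside S makes the new function
  live on the whole space.\<close>

lemma borel_version:
  fixes v :: "'a::euclidean_space \<Rightarrow> real"
  assumes S: "S \<in> sets lebesgue" and v: "integrable (lebesgue_on S) v"
  obtains w where "integrable lborel w" "AE x in lebesgue. w x = indicator S x * v x"
proof -
  have i: "integrable lebesgue (\<lambda>x. indicator S x * v x)"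
    using v S by (simp add: integrable_restrict_space)
  then obtain w where w: "w \<in> borel_measurable lborel" "AE x in lborel. indicator S x * v x = w x"
    using completion_ex_borel_measurable_real[of "\<lambda>x. indicator S x * v x" lborel] by auto
  have ae: "AE x in lebesgue. indicator S x * v x = w x" by (rule AE_completion[OF w(2)])
  have "integrable lebesgue w"
  proof (rule integrable_cong_AE_imp[OF i])
    show "w \<in> borel_measurable lebesgue" using w(1) by (simp add: measurable_completion)
  qed (use ae in \<open>auto elim: eventually_mono\<close>)
  then have "integrable lborel w" using w(1) by (simp add: integrable_completion)
  then show ?thesis using ae by (intro that[of w]) (auto elim: eventually_mono)
qed

lemma version_integral:
  fixes v w F :: "'a::euclidean_space \<Rightarrow> real"
  assumes S0: "S \<in> sets lebesgue" "integrable (lebesgue_on S) v"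
    and w: "integrable lborel w" "AE x in lebesgue. w x = indicator S x * v x"
    and S: "S \<subseteq> T" "T \<in> sets lebesgue"
    and F: "F \<in> borel_measurable borel" "\<And>x. x \<notin> S \<Longrightarrow> F x = 0"
  shows "(\<integral>x. w x * F x \<partial>lborel) = (\<integral>x. v x * F x \<partial>lebesgue_on T)"
proof -
  have wm: "w \<in> borel_measurable lborel" using w(1) by auto
  have m: "(\<lambda>x. w x * F x) \<in> borel_measurable lborel" using wm F(1) by measurable
  have ae: "AE x in lebesgue. w x * F x = indicator T x * (v x * F x)"
    using w(2) by eventually_elim (use S F(2) in \<open>auto simp: indicator_def\<close>)
  have ml: "(\<lambda>x. w x * F x) \<in> borel_measurable lebesgue" using m by (rule measurable_completion)
  have m2: "(\<lambda>x. indicator T x * (v x * F x)) \<in> borel_measurable lebesgue"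
  proof -
    have "(\<lambda>x. indicator S x *\<^sub>R v x) \<in> borel_measurable lebesgue"
      using S0 by (simp add: integrable_restrict_space borel_measurable_integrable del: real_scaleR_def)
    moreover have "F \<in> borel_measurable lebesgue" using F(1) by (simp add: measurable_completion)
    ultimately have "(\<lambda>x. (indicator S x *\<^sub>R v x) * F x) \<in> borel_measurable lebesgue" by measurable
    moreover have "(\<lambda>x. (indicator S x *\<^sub>R v x) * F x) = (\<lambda>x. indicator T x * (v x * F x))"
      using S(1) F(2) by (auto simp: fun_eq_iff indicator_def)
    ultimately show ?thesis by simp
  qed
  have "(\<integral>x. w x * F x \<partial>lborel) = (\<integral>x. w x * F x \<partial>lebesgue)" by (rule integral_completion[symmetric, OF m])
  also have "\<dots> = (\<integral>x. indicator T x * (v x * F x) \<partial>lebesgue)"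
    by (rule integral_cong_AE[OF ml m2 ae])
  also have "\<dots> = (\<integral>x. v x * F x \<partial>lebesgue_on T)" using S(2) by (simp add: integral_restrict_space)
  finally show ?thesis .
qed

lemma smooth_compose_shift: 
  assumes "smooth j"
  shows "smooth (\<lambda>x. j (x - a))" "grad (\<lambda>x. j (x - a)) x = grad j (x - a)"
proof -
  have d: "((\<lambda>x. f (x - a)) has_derivative (\<lambda>h. pd h f (x - a))) (at x)" 
    if "f differentiable (at (x - a))" for f :: "'a \<Rightarrow> real" and x
    by (rule has_derivative_eq_rhs, rule has_derivative_compose[of "\<lambda>x. x - a" "\<lambda>h. h"])
       (auto intro!: derivative_eq_intros diff_has_derivative that)
  have "ck n (\<lambda>x. f (x - a))" if "ck n f" for n f
    using that
  proof (induction n arbitrary: f)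
    case 0
    then show ?case using differentiableI[OF d] by auto
  next
    case (Suc n)
    then have "pd i (\<lambda>x. f (x - a)) = (\<lambda>x. pd i f (x - a))" for i
      using pd_eqI[OF d] by (auto simp: fun_eq_iff)
    then show ?case using Suc differentiableI[OF d] by auto
  qed
  then show "smooth (\<lambda>x. j (x - a))" using assms by (simp add: smooth_iff_ck)
  show "grad (\<lambda>x. j (x - a)) x = grad j (x - a)"
    by (rule euclidean_eqI) (simp add: grad_inner pd_eqI[OF d[OF smooth_diff[OF assms]]])
qed

text \<open>Prepares the fundamental lemma for v - C on a ball, with the pairing expressed through
  the Borel version w.\<close>

lemma version_ball:
  fixes v w \<psi> :: "'a::euclidean_space \<Rightarrow> real"
  assumes S: "S \<in> sets lebesgue" and v: "integrable (lebesgue_on S) v"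
    and w: "integrable lborel w" "AE x in lebesgue. w x = indicator S x * v x"
    and B0: "ball y0 \<rho> \<subseteq> S"
  shows "integrable (lebesgue_on (ball y0 \<rho>)) (\<lambda>x. v x - C)"
    and "test_fun (ball y0 \<rho>) \<psi> \<Longrightarrow> (\<integral>x. (v x - C) * \<psi> x \<partial>lebesgue_on (ball y0 \<rho>))
      = (\<integral>x. w x * \<psi> x \<partial>lborel) - C * (\<integral>y. \<psi> y \<partial>lborel)"
proof -
  have Bs: "ball y0 \<rho> \<in> sets lebesgue" "ball y0 \<rho> \<subseteq> S" using B0 by auto
  have fin: "finite_measure (lebesgue_on (ball y0 \<rho>))"
    by (rule finite_measure_lebesgue_on) (rule lmeasurable_ball)
  have vi: "integrable (lebesgue_on (ball y0 \<rho>)) v"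
  proof -
    have "set_integrable lebesgue S v" using v S by (simp add: set_integrable_def integrable_restrict_space)
    then have "set_integrable lebesgue (ball y0 \<rho>) v" using Bs by (rule set_integrable_subset)
    then show ?thesis using Bs by (simp add: set_integrable_def integrable_restrict_space)
  qed
  have ci: "integrable (lebesgue_on (ball y0 \<rho>)) (\<lambda>x. C)" using fin by (rule finite_measure.integrable_const)
  show "integrable (lebesgue_on (ball y0 \<rho>)) (\<lambda>x. v x - C)" using vi ci by simp
  assume t: "test_fun (ball y0 \<rho>) \<psi>"
    note b = smooth_borel[OF test_fun_smooth[OF t]]
    obtain D where D: "\<And>x. \<bar>\<psi> x\<bar> \<le> D" using test_fun_bounded[OF t] by blast
    have "(\<integral>x. v x * \<psi> x \<partial>lebesgue_on (ball y0 \<rho>)) = (\<integral>x. w x * \<psi> x \<partial>lborel)"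
    proof -
      have w': "AE x in lebesgue. w x * indicator (ball y0 \<rho>) x = indicator (ball y0 \<rho>) x * v x"
        using w(2) by eventually_elim (use Bs in \<open>auto simp: indicator_def\<close>)
      have "(\<integral>x. w x * indicator (ball y0 \<rho>) x * \<psi> x \<partial>lborel) = (\<integral>x. v x * \<psi> x \<partial>lebesgue_on (ball y0 \<rho>))"
        by (rule version_integral[OF Bs(1) vi _ w' order_refl Bs(1) b]) 
           (use w(1) test_fun_outside[OF t] integrable_real_mult_indicator[OF _ w(1), of "ball y0 \<rho>"] in \<open>auto simp: mult.commute\<close>)
      moreover have "w x * indicator (ball y0 \<rho>) x * \<psi> x = w x * \<psi> x" for x
        using test_fun_outside[OF t, of x] by (auto simp: indicator_def)
      ultimately show ?thesis by simp
    qed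
    moreover have "(\<integral>x. C * \<psi> x \<partial>lebesgue_on (ball y0 \<rho>)) = C * (\<integral>y. \<psi> y \<partial>lborel)"
      using integral_lebesgue_on_borel(1)[OF b Bs(1)] test_fun_outside[OF t] by simp
    moreover have i: "integrable (lebesgue_on (ball y0 \<rho>)) (\<lambda>x. u x * \<psi> x)"
      if u: "integrable (lebesgue_on (ball y0 \<rho>)) u" for u
      by (rule Bochner_Integration.integrable_bound[OF integrable_mult_right[OF integrable_norm[OF u], of D]])
         (use D u borel_measurable_lebesgue_on_borel[OF b] in
           \<open>auto intro!: AE_I2 simp: abs_mult mult.commute[of D] intro!: mult_left_mono order_trans[OF D abs_ge_self]\<close>)
    ultimately have e: "(\<integral>x. v x * \<psi> x \<partial>lebesgue_on (ball y0 \<rho>)) = (\<integral>x. w x * \<psi> x \<partial>lborel)"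
        "(\<integral>x. C * \<psi> x \<partial>lebesgue_on (ball y0 \<rho>)) = C * (\<integral>y. \<psi> y \<partial>lborel)" by blast+
    have "(\<integral>x. (v x - C) * \<psi> x \<partial>lebesgue_on (ball y0 \<rho>))
        = (\<integral>x. v x * \<psi> x \<partial>lebesgue_on (ball y0 \<rho>)) - (\<integral>x. C * \<psi> x \<partial>lebesgue_on (ball y0 \<rho>))"
      unfolding left_diff_distrib by (rule Bochner_Integration.integral_diff[OF i[OF vi] i[OF ci]])
    then show "(\<integral>x. (v x - C) * \<psi> x \<partial>lebesgue_on (ball y0 \<rho>))
      = (\<integral>x. w x * \<psi> x \<partial>lborel) - C * (\<integral>y. \<psi> y \<partial>lborel)"
      unfolding e by simp
qed

text \<open>The mollification of v at a fixed scale has derivative zero along each segment, because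
  the gradient of the translated kernel is a test function derivative. It is therefore a constant
  \<open>c n\<close> on the small ball, and \<open>moll_lim\<close> identifies the limit
  weakly.\<close>

lemma weak_const_local:
  fixes v :: "'a::euclidean_space \<Rightarrow> real"
  assumes \<rho>: "0 < \<rho>" "cball y0 (3 * \<rho>) \<subseteq> \<Omega>" and \<Omega>: "open \<Omega>"
    and v: "integrable (lebesgue_on (cball y0 (3 * \<rho>))) v"
    and z: "\<And>\<phi> i. test_fun \<Omega> \<phi> \<Longrightarrow> i \<in> Basis \<Longrightarrow> (\<integral>x. v x * pd i \<phi> x \<partial>lebesgue_on \<Omega>) = 0"
  obtains C where "AE x in lebesgue_on (ball y0 \<rho>). v x = C"
proof -
  define S where "S = cball y0 (3 * \<rho>)"
  have S: "S \<in> sets lebesgue" "S \<subseteq> \<Omega>" using \<rho> by (auto simp: S_def)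
  have \<Omega>s: "\<Omega> \<in> sets lebesgue" using \<Omega> by auto
  obtain w where w: "integrable lborel w" "AE x in lebesgue. w x = indicator S x * v x"
    using borel_version[OF S(1), of v] v unfolding S_def by blast
  have wm[measurable]: "w \<in> borel_measurable borel" using w(1) by auto
  have zero: "(\<integral>x. w x * (grad \<phi> x \<bullet> h) \<partial>lborel) = 0" if "test_fun S \<phi>" for \<phi> h
  proof -
    have t: "test_fun \<Omega> \<phi>" using that S(2) by (rule test_fun_mono)
    have "(\<integral>x. w x * pd i \<phi> x \<partial>lborel) = 0" if i: "i \<in> Basis" for i
      using version_integral[OF S(1) v[folded S_def] w S(2) \<Omega>s, of "pd i \<phi>"] z[OF t i]
        test_fun_outside[OF test_fun_pd[OF \<open>test_fun S \<phi>\<close> i]] smooth_borel[OF smooth_pd[OF test_fun_smooth[OF t] i]]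
      by simp
    moreover have "integrable lborel (\<lambda>x. w x * pd i \<phi> x)" if i: "i \<in> Basis" for i
    proof -
      obtain C where C: "\<And>x. \<bar>pd i \<phi> x\<bar> \<le> C" using test_fun_bounded[OF test_fun_pd[OF t i]] by blast
      have [measurable]: "pd i \<phi> \<in> borel_measurable borel" 
        by (rule smooth_borel[OF smooth_pd[OF test_fun_smooth[OF t] i]])
      show ?thesis
        by (rule Bochner_Integration.integrable_bound[OF integrable_mult_right[OF integrable_norm[OF w(1)], of C]])
           (use C in \<open>auto intro!: AE_I2 simp: abs_mult mult.commute[of C] intro!: mult_left_mono order_trans[OF C abs_ge_self]\<close>)
    qed
    moreover have "w x * (grad \<phi> x \<bullet> h) = (\<Sum>i\<in>Basis. (h \<bullet> i) * (w x * pd i \<phi> x))" for x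
      by (subst euclidean_inner) (simp add: grad_inner sum_distrib_left mult_ac)
    ultimately show ?thesis by simp
  qed
  have cst: "(\<integral>x. w x * j (x - y) \<partial>lborel) = (\<integral>x. w x * j (x - y0) \<partial>lborel)"
    if j: "mollk r j" "smooth j" and r: "r \<le> \<rho>" and y: "y \<in> ball y0 \<rho>" for r j y
  proof -
    define h where "h = y - y0"
    define p where "p t = y0 + t *\<^sub>R h" for t
    have hn: "norm h < \<rho>" using y by (simp add: h_def dist_norm norm_minus_commute)
    \<comment> \<open>The centre moves by at most 2 \<rho> and the kernel has radius at most \<rho>,
      which explains the radius 3 \<rho>. The parameter interval is open and contains [0,1], so
      derivatives exist at both endpoints.\<close>
    have tf: "test_fun S (\<lambda>x. j (x - p t))" if "t \<in> {-1<..<2}" for t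
    proof (rule test_funI[of _ "cball (p t) \<rho>"])
      show "smooth (\<lambda>x. j (x - p t))" by (rule smooth_compose_shift(1)[OF j(2)])
      have "norm (t *\<^sub>R h) \<le> 2 * \<rho>" using that hn by (simp, intro mult_mono) auto
      then show "cball (p t) \<rho> \<subseteq> S" unfolding S_def p_def
        by (simp add: cball_subset_cball_iff dist_norm)
      show "j (x - p t) = 0" if "x \<notin> cball (p t) \<rho>" for x
        using that r by (intro mollkD(3)[OF j(1)]) (auto simp: dist_norm norm_minus_commute)
    qed simp
    have tj: "test_fun UNIV j"
      using j(2) mollkD(3)[OF j(1)] by (intro test_funI[of _ "cball 0 r"]) auto
    obtain C where C: "0 \<le> C" "\<And>x. norm (grad j x) \<le> C" using test_fun_grad_bounded[OF tj] by blast
    have [measurable]: "j \<in> borel_measurable borel" "grad j \<in> borel_measurable borel"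
      using j(2) by (auto intro: smooth_borel smooth_grad_borel)
    have D: "((\<lambda>t. \<integral>x. w x * j (x - p t) \<partial>lborel) has_real_derivative
        (\<integral>x. w x * - (grad j (x - p t) \<bullet> h) \<partial>lborel)) (at t)" if t: "t \<in> {-1<..<2}" for t
    proof (rule DERIV_integral[where a = "-1" and b = 2 and w = "\<lambda>x. \<bar>w x\<bar> * (C * norm h)"])
      fix s :: real and x :: 'a
      have "((\<lambda>t. j (x - p t)) has_derivative (\<lambda>d. grad j (x - p s) \<bullet> (- (d *\<^sub>R h)))) (at s)"
        unfolding p_def
        by (rule has_derivative_eq_rhs, rule has_derivative_compose[of "\<lambda>t. x - (y0 + t *\<^sub>R h)" "\<lambda>t. - (t *\<^sub>R h)"])
           (auto intro!: derivative_eq_intros grad_has_derivative smooth_diff[OF j(2)])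
      then have "((\<lambda>t. j (x - p t)) has_real_derivative - (grad j (x - p s) \<bullet> h)) (at s)"
        unfolding has_field_derivative_def by (rule has_derivative_eq_rhs) (simp add: fun_eq_iff mult.commute)
      then show "((\<lambda>t. w x * j (x - p t)) has_real_derivative w x * - (grad j (x - p s) \<bullet> h)) (at s)"
        by (rule DERIV_cmult)
      have "\<bar>grad j (x - p s) \<bullet> h\<bar> \<le> C * norm h"
        using Cauchy_Schwarz_ineq2[of "grad j (x - p s)" h] mult_right_mono[OF C(2)[of "x - p s"] norm_ge_zero[of h]] by simp
      then show "\<bar>w x * - (grad j (x - p s) \<bullet> h)\<bar> \<le> \<bar>w x\<bar> * (C * norm h)"
        by (simp add: abs_mult mult_left_mono)
    next
      fix s :: real
      obtain E where E: "0 \<le> E" "\<And>z. j z \<le> E" using mollk_bounded[OF j(1)] by blast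
      show "integrable lborel (\<lambda>x. w x * j (x - p s))"
        by (rule Bochner_Integration.integrable_bound[OF integrable_mult_right[OF integrable_norm[OF w(1)], of E]])
           (use E mollkD(2)[OF j(1)] in \<open>auto intro!: AE_I2 simp: abs_mult mult.commute[of E] intro!: mult_left_mono\<close>)
    qed (use w(1) t in auto)
    have D0: "((\<lambda>t. \<integral>x. w x * j (x - p t) \<partial>lborel) has_real_derivative 0) (at t)" if t: "t \<in> {-1<..<2}" for t
      using D[OF t] zero[OF tf[OF t], of h] by (simp add: smooth_compose_shift(2)[OF j(2)])
    have "isCont (\<lambda>t. \<integral>x. w x * j (x - p t) \<partial>lborel) t" if "t \<in> {-1<..<2}" for t
      using D0[OF that] by (rule DERIV_isCont)
    then have co: "continuous_on {0..1} (\<lambda>t. \<integral>x. w x * j (x - p t) \<partial>lborel)"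
      by (intro continuous_at_imp_continuous_on) auto
    have "(\<integral>x. w x * j (x - p 1) \<partial>lborel) = (\<integral>x. w x * j (x - p 0) \<partial>lborel)"
      by (rule DERIV_isconst_end[where f = "\<lambda>t. \<integral>x. w x * j (x - p t) \<partial>lborel"])
         (use D0 co in auto)
    then show ?thesis by (simp add: p_def h_def)
  qed
  define r where "r n = \<rho> / real (Suc n)" for n
  have r: "0 < r n" "r n \<le> \<rho>" for n using \<rho>(1) by (auto simp: r_def divide_le_eq mult_left_le)
  have rlim: "r \<longlonglongrightarrow> 0" unfolding r_def
    using tendsto_mult[OF tendsto_const[of \<rho>] LIMSEQ_inverse_real_of_nat] by (simp add: divide_inverse)
  have "\<exists>j :: 'a \<Rightarrow> real. mollk (r n) j \<and> smooth j" for n using ex_smooth_mollk[OF r(1)[of n]] by blast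
  then obtain j :: "nat \<Rightarrow> 'a \<Rightarrow> real" where j: "\<And>n. mollk (r n) (j n)" "\<And>n. smooth (j n)" by metis
  define c where "c n = (\<integral>x. w x * j n (x - y0) \<partial>lborel)" for n
  have lim: "(\<lambda>n. c n * (\<integral>y. \<psi> y \<partial>lborel)) \<longlonglongrightarrow> (\<integral>x. w x * \<psi> x \<partial>lborel)"
    if t: "test_fun (ball y0 \<rho>) \<psi>" for \<psi>
  proof -
    obtain K where K: "compact K" "\<And>x. x \<notin> K \<Longrightarrow> \<psi> x = 0" by (rule test_fun_support[OF t]) blast
    have e: "(\<integral>x. w x * j n (x - y) \<partial>lborel) * \<psi> y = c n * \<psi> y" for n y
      using cst[OF j(1)[of n] j(2)[of n] r(2)[of n], of y] test_fun_outside[OF t, of y]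
      by (cases "y \<in> ball y0 \<rho>") (auto simp: c_def)
    show ?thesis
      using moll_lim[OF w(1) smooth_continuous[OF test_fun_smooth[OF t]] K j(1) rlim]
      unfolding e by simp
  qed
  \<comment> \<open>One test function of mass one is enough to prove that the constants
    \<open>c n\<close> converge, and its pairing with w names the limit C.\<close>
  obtain k :: "'a \<Rightarrow> real" where k: "mollk (\<rho>/2) k" "smooth k" using ex_smooth_mollk[of "\<rho>/2"] \<rho>(1) by auto
  have tk: "test_fun (ball y0 \<rho>) (\<lambda>x. k (x - y0))"
    by (rule test_funI[of _ "cball y0 (\<rho>/2)"])
       (use \<rho>(1) in \<open>auto simp: smooth_compose_shift(1)[OF k(2)] dist_norm norm_minus_commute intro!: mollkD(3)[OF k(1)]\<close>)
  define C where "C = (\<integral>x. w x * k (x - y0) \<partial>lborel)"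
  have "(\<integral>x. k (x - y0) \<partial>lborel) = 1"
    using lborel_shift_integral[OF mollkD(5)[OF k(1)], of "- y0"] mollkD(4)[OF k(1)] by simp
  then have clim: "c \<longlonglongrightarrow> C" using lim[OF tk] by (simp add: C_def)
  have eq: "(\<integral>x. w x * \<psi> x \<partial>lborel) = C * (\<integral>y. \<psi> y \<partial>lborel)" if t: "test_fun (ball y0 \<rho>) \<psi>" for \<psi>
    by (rule LIMSEQ_unique[OF lim[OF t]]) (intro tendsto_intros clim)
  have "AE x in lebesgue_on (ball y0 \<rho>). v x - C = 0"
  proof (rule fundamental_zero)
    note vb = version_ball[OF S(1) v[folded S_def] w, of y0 \<rho>]
    have "ball y0 \<rho> \<subseteq> S" using \<rho>(1) by (auto simp: S_def)
    then show "integrable (lebesgue_on (ball y0 \<rho>)) (\<lambda>x. v x - C)"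
      "\<And>\<psi>. test_fun (ball y0 \<rho>) \<psi> \<Longrightarrow> (\<integral>x. (v x - C) * \<psi> x \<partial>lebesgue_on (ball y0 \<rho>)) = 0"
      using vb eq by simp_all
  qed simp
  then show ?thesis by (intro that[of C]) simp
qed

text \<open>Around each point v is almost everywhere constant. Overlapping balls meet in a nonempty
  open set, so the local constants agree there, and connectedness makes them equal throughout
  \<Omega>.\<close>

lemma weak_const:
  fixes v :: "'a::euclidean_space \<Rightarrow> real"
  assumes \<Omega>: "open \<Omega>" "connected \<Omega>"
    and v: "\<And>K. compact K \<Longrightarrow> K \<subseteq> \<Omega> \<Longrightarrow> set_integrable lebesgue K v"
    and z: "\<And>\<phi> i. test_fun \<Omega> \<phi> \<Longrightarrow> i \<in> Basis \<Longrightarrow> (\<integral>x. v x * pd i \<phi> x \<partial>lebesgue_on \<Omega>) = 0"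
  obtains C where "AE x in lebesgue_on \<Omega>. v x = C"
proof -
  have "\<exists>r C. 0 < r \<and> ball y r \<subseteq> \<Omega> \<and> (AE x in lebesgue_on (ball y r). v x = C)" if "y \<in> \<Omega>" for y
  proof -
    obtain r where r: "0 < r" "cball y r \<subseteq> \<Omega>" using \<Omega>(1) \<open>y \<in> \<Omega>\<close> open_contains_cball by blast
    define \<rho> where "\<rho> = r / 3"
    have \<rho>: "0 < \<rho>" "cball y (3 * \<rho>) \<subseteq> \<Omega>" using r by (auto simp: \<rho>_def)
    have "integrable (lebesgue_on (cball y (3 * \<rho>))) v"
      using v[OF compact_cball \<rho>(2)] by (simp add: set_integrable_def integrable_restrict_space)
    from weak_const_local[OF \<rho> \<Omega>(1) this z] obtain C where "AE x in lebesgue_on (ball y \<rho>). v x = C" by blast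
    moreover have "ball y \<rho> \<subseteq> \<Omega>" using \<rho> ball_subset_cball[of y \<rho>] subset_cball[of \<rho> "3 * \<rho>" y] by auto
    ultimately show ?thesis using \<rho>(1) by blast
  qed
  then obtain r C where rC: "\<And>y. y \<in> \<Omega> \<Longrightarrow> 0 < r y" "\<And>y. y \<in> \<Omega> \<Longrightarrow> ball y (r y) \<subseteq> \<Omega>"
    "\<And>y. y \<in> \<Omega> \<Longrightarrow> AE x in lebesgue_on (ball y (r y)). v x = C y" by metis
  have ae: "AE x in lebesgue. x \<in> ball y (r y) \<longrightarrow> v x = C y" if "y \<in> \<Omega>" for y
    using rC(3)[OF that] by (subst (asm) AE_restrict_space_iff) auto
  have loc: "C a = C b" if "a \<in> \<Omega>" "b \<in> \<Omega>" "b \<in> ball a (r a)" for a b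
  proof -
    have "open (ball a (r a) \<inter> ball b (r b))" by auto
    moreover have "b \<in> ball a (r a) \<inter> ball b (r b)" using that rC(1) by simp
    moreover have "AE x in lebesgue. x \<in> ball a (r a) \<inter> ball b (r b) \<longrightarrow> C a = C b"
      using ae[OF that(1)] ae[OF that(2)] by eventually_elim auto
    ultimately show ?thesis using AE_open_ex[of "ball a (r a) \<inter> ball b (r b)" "\<lambda>_. C a = C b"] by blast
  qed
  show ?thesis
  proof (cases "\<Omega> = {}")
    case False
    then obtain a where a: "a \<in> \<Omega>" by auto
    have const: "C a = C b" if "b \<in> \<Omega>" for b
    proof (rule connected_local_const[OF \<Omega>(2) a that], rule ballI)
      fix x assume x: "x \<in> \<Omega>"
      show "\<forall>\<^sub>F b in at x within \<Omega>. C x = C b"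
        unfolding eventually_at using rC(1)[OF x] loc[OF x]
        by (intro exI[of _ "r x"]) (auto simp: dist_commute)
    qed
    have "AE x in lebesgue_on \<Omega>. v x = C a"
    proof (rule AE_local[OF \<Omega>(1)])
      fix y assume y: "y \<in> \<Omega>"
      show "\<exists>r>0. AE x in lebesgue_on (ball y r). x \<in> \<Omega> \<longrightarrow> v x = C a"
        using rC(1,3)[OF y] const[OF y] by (intro exI[of _ "r y"]) (auto elim: eventually_mono)
    qed
    then show ?thesis by (rule that)
  next
    case True
    then have "AE x in lebesgue_on \<Omega>. v x = 0" by (intro AE_I2) simp
    then show ?thesis by (rule that)
  qed
qed

section \<open>A local lower bound for positive superharmonic functions\<close>

lemma sq_norm_bump: "bump k a c y x = bumpD k (a - c * (norm (x - y))\<^sup>2)"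
  by (simp add: bump_def power2_norm_eq_inner)

text \<open>Here t is the radius, q the squared distance to the centre and d the dimension; the
  factor t^(-d) makes the mass independent of the radius.\<close>

definition mean_kernel :: "nat \<Rightarrow> real \<Rightarrow> real \<Rightarrow> real" where
  "mean_kernel d t q = inverse (t ^ d) * bumpD 1 (1 - (1 / t\<^sup>2) * q)"

text \<open>The bracket is exactly \<open>laplacian_bump\<close> for the profile of index 0 with a =
  1 and c = 1/t^2, which makes \<open>mean_kernel'_laplacian\<close> a matter of unfolding.\<close>

definition mean_kernel' :: "nat \<Rightarrow> real \<Rightarrow> real \<Rightarrow> real" where
  "mean_kernel' d t q = (t / (2 * t ^ d)) * (4 * (1 / t\<^sup>2)\<^sup>2 * q * bumpD 2 (1 - (1 / t\<^sup>2) * q)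
      - 2 * (1 / t\<^sup>2) * d * bumpD 1 (1 - (1 / t\<^sup>2) * q))"

text \<open>The scale derivative of the normalised kernel is a positive multiple of the Laplacian of a
  bump; this is why weighted means of a superharmonic function decrease with the radius.\<close>

lemma mean_kernel_deriv:
  assumes "0 < t" "0 < d"
  shows "((\<lambda>t. mean_kernel d t q) has_real_derivative mean_kernel' d t q) (at t)"
proof -
  obtain e where d: "d = Suc e" using assms(2) by (cases d) auto
  have 1: "((\<lambda>t. 1 - (1 / t\<^sup>2) * q) has_real_derivative (2 * q / t ^ 3)) (at t)"
    using assms(1) by (auto intro!: derivative_eq_intros simp: field_simps power2_eq_square power3_eq_cube)
  have 2: "((\<lambda>t. bumpD 1 (1 - (1 / t\<^sup>2) * q)) has_real_derivative bumpD 2 (1 - (1 / t\<^sup>2) * q) * (2 * q / t ^ 3)) (at t)"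
    using DERIV_chain2[OF bumpD_deriv[of 1] 1] by (simp add: numeral_2_eq_2)
  have 3: "((\<lambda>t. inverse (t ^ d)) has_real_derivative - (d * t ^ e) * (inverse (t ^ d) * inverse (t ^ d))) (at t)"
  proof -
    have "((\<lambda>t. t ^ d) has_real_derivative d * t ^ e) (at t)"
      using DERIV_pow[of d t] by (simp add: d)
    from DERIV_inverse_fun[OF this] assms(1) show ?thesis
      by (simp add: power2_eq_square)
  qed
  have "((\<lambda>t. mean_kernel d t q) has_real_derivative
     - (d * t ^ e) * (inverse (t ^ d) * inverse (t ^ d)) * bumpD 1 (1 - (1 / t\<^sup>2) * q)
     + bumpD 2 (1 - (1 / t\<^sup>2) * q) * (2 * q / t ^ 3) * inverse (t ^ d)) (at t)"
    unfolding mean_kernel_def by (rule DERIV_mult'[OF 3 2, THEN DERIV_cong]) simp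
  moreover have "- (d * t ^ e) * (inverse (t ^ d) * inverse (t ^ d)) * bumpD 1 (1 - (1 / t\<^sup>2) * q)
     + bumpD 2 (1 - (1 / t\<^sup>2) * q) * (2 * q / t ^ 3) * inverse (t ^ d) = mean_kernel' d t q"
    using assms(1) unfolding mean_kernel'_def d
    by (simp add: field_simps power2_eq_square power3_eq_cube)
  ultimately show ?thesis by simp
qed

lemma mean_kernel_nonneg: "0 < t \<Longrightarrow> 0 \<le> mean_kernel d t q"
  using bumpD_nonneg(2) by (simp add: mean_kernel_def)

lemma mean_kernel_zero: "0 < t \<Longrightarrow> t\<^sup>2 \<le> q \<Longrightarrow> mean_kernel d t q = 0"
  by (simp add: mean_kernel_def bumpD_nonpos field_simps)

text \<open>The restriction s <= 1 matches the argument 1 - q/t^2 of the kernel, which never exceeds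
  1.\<close>

lemma bumpD1_bounded: obtains C where "0 < C" "\<And>s. s \<le> 1 \<Longrightarrow> bumpD 1 s \<le> C"
proof -
  have "compact (bumpD 1 ` {0..1})" by (intro compact_continuous_image bumpD_continuous) simp
  then have "bounded (bumpD 1 ` {0..1})" by (rule compact_imp_bounded)
  then obtain C where "\<forall>y\<in>bumpD 1 ` {0..1}. norm y \<le> C" unfolding bounded_iff by blast
  then have C: "\<And>s. s \<in> {0..1} \<Longrightarrow> norm (bumpD 1 s) \<le> C" by blast
  show ?thesis
  proof (rule that[of "max C 1"])
    fix s :: real assume "s \<le> 1"
    then show "bumpD 1 s \<le> max C 1" using C[of s] bumpD_nonpos[of s 1] by (cases "0 \<le> s") auto
  qed simp
qed

lemma mean_kernel_le:
  assumes "0 < t" "0 \<le> q" "\<And>s. s \<le> 1 \<Longrightarrow> bumpD 1 s \<le> C"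
  shows "mean_kernel d t q \<le> inverse (t ^ d) * C"
  using assms unfolding mean_kernel_def by (intro mult_left_mono assms(3)) auto

text \<open>Supplies the majorant for differentiating a mean in its radius; radii are kept away from
  0, where the kernel is singular.\<close>

lemma mean_kernel'_bounded:
  assumes "0 < a" "0 < d"
  obtains C where "\<And>t q. t \<in> {a..b} \<Longrightarrow> q \<in> {0..Q} \<Longrightarrow> \<bar>mean_kernel' d t q\<bar> \<le> C"
proof -
  have B2: "continuous_on S (\<lambda>x. bumpD k (g x))" if "continuous_on S g" for S :: "(real \<times> real) set" and k g
    using continuous_on_compose2[OF bumpD_continuous[of UNIV] that] by auto
  have "continuous_on ({a..b} \<times> {0..Q}) (\<lambda>p. mean_kernel' d (fst p) (snd p))"
    unfolding mean_kernel'_def using assms(1)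
    by (intro continuous_intros B2) auto
  then have "compact ((\<lambda>p. mean_kernel' d (fst p) (snd p)) ` ({a..b} \<times> {0..Q}))"
    by (intro compact_continuous_image compact_Times) auto
  then have "bounded ((\<lambda>p. mean_kernel' d (fst p) (snd p)) ` ({a..b} \<times> {0..Q}))" by (rule compact_imp_bounded)
  then obtain C where "\<forall>y\<in>(\<lambda>p. mean_kernel' d (fst p) (snd p)) ` ({a..b} \<times> {0..Q}). norm y \<le> C"
    unfolding bounded_iff by blast
  then show ?thesis by (intro that[of C]) force
qed

lemma mean_kernel'_laplacian:
  fixes x y :: "'a::euclidean_space"
  shows "mean_kernel' DIM('a) t ((norm (x - y))\<^sup>2) =
    (t / (2 * t ^ DIM('a))) * (\<Sum>i\<in>Basis. pd i (pd i (bump 0 1 (1 / t\<^sup>2) y)) x)"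
  unfolding laplacian_bump mean_kernel'_def sq_norm_bump power2_norm_eq_inner
  by (simp add: numeral_2_eq_2)

lemma continuous_on_mvk: "0 < t \<Longrightarrow> continuous_on UNIV (\<lambda>x. mean_kernel d t ((norm (x - y))\<^sup>2))"
  unfolding mean_kernel_def
  by (intro continuous_intros continuous_on_compose2[OF bumpD_continuous[of UNIV]]) auto

text \<open>The mean at the fixed radius \<rho> is bounded below uniformly for centres near
  \<open>y0\<close>, since \<Phi> has positive mass there. Means grow as the radius shrinks, so the
  same bound holds at all smaller radii, and letting the radius tend to 0 recovers \<Phi> in the
  weak sense.\<close>

lemma superharmonic_lower_bound:
  fixes \<Phi> :: "'a::euclidean_space \<Rightarrow> real"
  assumes \<Omega>: "open \<Omega>" "y0 \<in> \<Omega>"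
    and loc: "\<And>K. compact K \<Longrightarrow> K \<subseteq> \<Omega> \<Longrightarrow> set_integrable lebesgue K \<Phi>"
    and pos: "\<And>x. x \<in> \<Omega> \<Longrightarrow> 0 < \<Phi> x"
    and sup: "\<And>\<phi>. test_fun \<Omega> \<phi> \<Longrightarrow> (\<And>x. 0 \<le> \<phi> x) \<Longrightarrow>
        (\<integral>x. \<Phi> x * (\<Sum>i\<in>Basis. pd i (pd i \<phi>) x) \<partial>lebesgue_on \<Omega>) \<le> 0"
  obtains r c where "0 < r" "0 < c" "AE x in lebesgue_on (ball y0 r). c \<le> \<Phi> x"
proof -
  let ?d = "DIM('a)"
  have d0: "0 < ?d" by simp
  obtain R where R: "0 < R" "cball y0 R \<subseteq> \<Omega>" using \<Omega> open_contains_cball by blast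
  define \<rho> where "\<rho> = R / 3"
  have \<rho>: "0 < \<rho>" "cball y0 (3 * \<rho>) \<subseteq> \<Omega>" using R by (auto simp: \<rho>_def)
  define S where "S = cball y0 (3 * \<rho>)"
  have S: "S \<in> sets lebesgue" "S \<subseteq> \<Omega>" "S \<in> sets borel" using \<rho> by (auto simp: S_def)
  have \<Omega>s: "\<Omega> \<in> sets lebesgue" using \<Omega> by auto
  have \<Phi>i: "integrable (lebesgue_on S) \<Phi>"
    using loc[of S] S by (simp add: S_def set_integrable_def integrable_restrict_space)
  obtain w0 where w0: "integrable lborel w0" "AE x in lebesgue. w0 x = indicator S x * \<Phi> x"
    using borel_version[OF S(1) \<Phi>i] by blast
  \<comment> \<open>The truncation makes the Borel version nonnegative everywhere, not merely almost
    everywhere; it changes nothing beyond a null set because \<Phi> is positive on \<Omega>.\<close>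
  define w where "w x = indicator S x * max 0 (w0 x)" for x
  have [measurable]: "S \<in> sets borel" by (rule S)
  have [measurable]: "w0 \<in> borel_measurable borel" using w0(1) by auto
  have wm[measurable]: "w \<in> borel_measurable borel" unfolding w_def by measurable
  have w: "integrable lborel w"
    by (rule Bochner_Integration.integrable_bound[OF w0(1)]) (auto simp: w_def indicator_def)
  have wae: "AE x in lebesgue. w x = indicator S x * \<Phi> x"
    using w0(2) by eventually_elim (use pos S(2) in \<open>force simp: w_def indicator_def max_def\<close>)
  have wn: "0 \<le> w x" "x \<notin> S \<Longrightarrow> w x = 0" for x by (auto simp: w_def)
  obtain Bm where Bm: "0 < Bm" "\<And>s. s \<le> 1 \<Longrightarrow> bumpD 1 s \<le> Bm" using bumpD1_bounded by blast
  define A where "A t y = (\<integral>x. w x * mean_kernel ?d t ((norm (x - y))\<^sup>2) \<partial>lborel)" for t y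
  have [measurable]: "(\<lambda>x. mean_kernel ?d t ((norm (x - y))\<^sup>2)) \<in> borel_measurable borel" if "0 < t" for t and y :: 'a
    by (intro borel_measurable_continuous_onI continuous_on_mvk that)
  have Ai: "integrable lborel (\<lambda>x. w x * mean_kernel ?d t ((norm (x - y))\<^sup>2))" if t: "0 < t" for t y
  proof (rule Bochner_Integration.integrable_bound[OF integrable_mult_right[OF w, of "inverse (t ^ ?d) * Bm"]])
    show "AE x in lborel. norm (w x * mean_kernel ?d t ((norm (x - y))\<^sup>2)) \<le> norm (inverse (t ^ ?d) * Bm * w x)"
    proof (rule AE_I2)
      fix x
      have "w x * mean_kernel ?d t ((norm (x - y))\<^sup>2) \<le> w x * (inverse (t ^ ?d) * Bm)"
        by (intro mult_left_mono mean_kernel_le t Bm wn) auto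
      moreover have "0 \<le> w x * mean_kernel ?d t ((norm (x - y))\<^sup>2)" using wn mean_kernel_nonneg[OF t] by simp
      ultimately show "norm (w x * mean_kernel ?d t ((norm (x - y))\<^sup>2)) \<le> norm (inverse (t ^ ?d) * Bm * w x)"
        by (simp add: mult.commute)
    qed
  qed (use t in measurable)
  have lap: "(\<integral>x. w x * mean_kernel' ?d t ((norm (x - y))\<^sup>2) \<partial>lborel) \<le> 0"
    if t: "0 < t" "t < 2 * \<rho>" and y: "y \<in> ball y0 \<rho>" for t y
  proof -
    have sub: "cball y t \<subseteq> S" using t y unfolding S_def by (simp add: cball_subset_cball_iff dist_commute)
    have tf: "test_fun S (bump 0 1 (1 / t\<^sup>2) y)"
      using t(1) by (intro test_fun_bump[where r = t] sub) auto
    define F where "F x = (\<Sum>i\<in>Basis. pd i (pd i (bump 0 1 (1 / t\<^sup>2) y)) x)" for x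
    have tF: "test_fun S F" unfolding F_def by (intro test_fun_sum test_fun_pd tf) 
    have "(\<integral>x. w x * F x \<partial>lborel) = (\<integral>x. \<Phi> x * F x \<partial>lebesgue_on \<Omega>)"
      by (rule version_integral[OF S(1) \<Phi>i w wae S(2) \<Omega>s smooth_borel[OF test_fun_smooth[OF tF]]])
         (use test_fun_outside[OF tF] in blast)
    also have "\<dots> \<le> 0" unfolding F_def by (rule sup[OF test_fun_mono[OF tf S(2)] bump_nonneg(1)])
    finally have "(t / (2 * t ^ ?d)) * (\<integral>x. w x * F x \<partial>lborel) \<le> 0"
      using t by (intro mult_nonneg_nonpos) auto
    then show ?thesis unfolding mean_kernel'_laplacian F_def[symmetric]
      by (simp add: mult.left_commute)
  qed
  have D: "((\<lambda>t. A t y) has_real_derivative (\<integral>x. w x * mean_kernel' ?d t0 ((norm (x - y))\<^sup>2) \<partial>lborel)) (at t0)"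
    if t0: "0 < t0" "t0 < 2 * \<rho>" and y: "y \<in> ball y0 \<rho>" for t0 y
  proof -
    \<comment> \<open>Points of \<open>S\<close> lie within 3 \<rho> of \<open>y0\<close> and the
      centre y within \<rho>, hence the bound 4 \<rho> for their distance. The lower end t0/2 leaves
      room around t0.\<close>
    obtain C where C: "\<And>t q. t \<in> {t0/2..2*\<rho>} \<Longrightarrow> q \<in> {0..(4*\<rho>)\<^sup>2} \<Longrightarrow> \<bar>mean_kernel' ?d t q\<bar> \<le> C"
      using mean_kernel'_bounded[of "t0/2" ?d "2*\<rho>" "(4*\<rho>)\<^sup>2"] t0 by auto
    show ?thesis unfolding A_def
    proof (rule DERIV_integral[where a = "t0/2" and b = "2*\<rho>" and w = "\<lambda>x. w x * C"])
      fix t :: real and x assume t: "t \<in> {t0/2<..<2*\<rho>}"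
      then have tp: "0 < t" using t0 by simp
      show "((\<lambda>t. w x * mean_kernel ?d t ((norm (x - y))\<^sup>2)) has_real_derivative w x * mean_kernel' ?d t ((norm (x - y))\<^sup>2)) (at t)"
        by (rule DERIV_cmult[OF mean_kernel_deriv[OF tp d0]])
      show "\<bar>w x * mean_kernel' ?d t ((norm (x - y))\<^sup>2)\<bar> \<le> w x * C"
      proof (cases "x \<in> S")
        case True
        have "norm (x - y) \<le> norm (x - y0) + norm (y0 - y)" using norm_triangle_ineq[of "x - y0" "y0 - y"] by simp
        also have "\<dots> \<le> 4 * \<rho>" using True y by (simp add: S_def dist_norm norm_minus_commute)
        finally have "(norm (x - y))\<^sup>2 \<le> (4 * \<rho>)\<^sup>2" by (intro power_mono) auto
        then have "\<bar>mean_kernel' ?d t ((norm (x - y))\<^sup>2)\<bar> \<le> C" using t by (intro C) auto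
        then show ?thesis using wn(1)[of x] by (simp add: abs_mult mult_left_mono)
      qed (simp add: wn)
    next
      show "(\<lambda>x. w x * mean_kernel' ?d t0 ((norm (x - y))\<^sup>2)) \<in> borel_measurable lborel"
      proof -
        have "smooth (\<lambda>x. \<Sum>i\<in>Basis. pd i (pd i (bump 0 1 (1 / t0\<^sup>2) y)) x)"
          by (intro smooth_sum smooth_pd smooth_bump)
        from smooth_borel[OF this] show ?thesis unfolding mean_kernel'_laplacian by measurable
      qed
      show "integrable lborel (\<lambda>x. w x * C)" using w by simp
      show "integrable lborel (\<lambda>x. w x * mean_kernel ?d t ((norm (x - y))\<^sup>2))" if "t \<in> {t0/2<..<2*\<rho>}" for t
        using that t0 by (intro Ai) auto
    qed (use t0 in auto)
  qed
  have mono: "A \<rho> y \<le> A s y" if s: "0 < s" "s \<le> \<rho>" and y: "y \<in> ball y0 \<rho>" for s y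
  proof (rule DERIV_nonpos_imp_nonincreasing[OF s(2)])
    fix t assume "s \<le> t" "t \<le> \<rho>"
    then have t: "0 < t" "t < 2 * \<rho>" using s \<rho> by auto
    show "\<exists>z. ((\<lambda>t. A t y) has_real_derivative z) (at t) \<and> z \<le> 0"
      using D[OF t y] lap[OF t y] by blast
  qed
  \<comment> \<open>Two points of \<open>V\<close> are at distance at most \<rho>/2, so at radius
    \<rho> the kernel argument is at least 3/4. The minimum of the profile on [3/4, 1], attained at
    \<open>s0\<close>, is therefore a positive lower bound.\<close>
  define V where "V = ball y0 (\<rho> / 4)"
  have VS: "V \<subseteq> S" "V \<in> sets borel" "V \<in> sets lebesgue" using \<rho> by (auto simp: V_def S_def)
  obtain s0 where s0: "s0 \<in> {3/4..1}" "\<And>s. s \<in> {3/4..1} \<Longrightarrow> bumpD 1 s0 \<le> bumpD 1 s"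
    using continuous_attains_inf[OF compact_Icc _ bumpD_continuous[of "{3/4..1::real}" 1]] by auto
  have b0: "0 < bumpD 1 s0" using bumpD1_pos[of s0] s0(1) by simp
  define I where "I = (\<integral>x. w x * indicator V x \<partial>lborel)"
  have Ii: "integrable lborel (\<lambda>x. w x * indicator V x)"
    using integrable_real_mult_indicator[of V lborel w] w VS(2) by (simp add: mult.commute)
  have I0: "0 < I"
  proof (rule ccontr)
    assume "\<not> 0 < I"
    moreover have "0 \<le> I" unfolding I_def using wn by simp
    ultimately have "(\<integral>x. w x * indicator V x \<partial>lborel) = 0" unfolding I_def by linarith
    then have "AE x in lborel. w x * indicator V x = 0"
      using integral_nonneg_eq_0_iff_AE[OF Ii] wn by simp
    then have "AE x in lebesgue. w x * indicator V x = 0" by (rule AE_completion)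
    then have "AE x in lebesgue. x \<in> V \<longrightarrow> False"
      using wae
    proof eventually_elim
      case (elim x)
      show ?case
      proof
        assume "x \<in> V"
        then have "x \<in> S" "\<Phi> x = 0" using elim VS by auto
        then show False using pos[of x] S(2) by auto
      qed
    qed
    then show False using AE_open_ex[of V "\<lambda>_. False"] \<rho>(1) by (auto simp: V_def)
  qed
  \<comment> \<open>Kernel normalisation times the smallest profile value times the mass of w on
    \<open>V\<close>; the mass is positive because \<open>V\<close> is not null.\<close>
  define c0 where "c0 = inverse (\<rho> ^ ?d) * bumpD 1 s0 * I"
  have c00: "0 < c0" using I0 b0 \<rho>(1) by (simp add: c0_def)
  have Ac0: "c0 \<le> A \<rho> y" if y: "y \<in> V" for y
  proof -
    have "c0 = (\<integral>x. (inverse (\<rho> ^ ?d) * bumpD 1 s0) * (w x * indicator V x) \<partial>lborel)"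
      by (simp add: c0_def I_def)
    also have "\<dots> \<le> A \<rho> y" unfolding A_def
    proof (rule integral_mono)
      show "integrable lborel (\<lambda>x. (inverse (\<rho> ^ ?d) * bumpD 1 s0) * (w x * indicator V x))" using Ii by simp
      show "integrable lborel (\<lambda>x. w x * mean_kernel ?d \<rho> ((norm (x - y))\<^sup>2))" by (rule Ai[OF \<rho>(1)])
      fix x
      show "(inverse (\<rho> ^ ?d) * bumpD 1 s0) * (w x * indicator V x) \<le> w x * mean_kernel ?d \<rho> ((norm (x - y))\<^sup>2)"
      proof (cases "x \<in> V")
        case True
        have "norm (x - y) \<le> norm (x - y0) + norm (y0 - y)" using norm_triangle_ineq[of "x - y0" "y0 - y"] by simp
        also have "\<dots> \<le> \<rho> / 2" using True y by (simp add: V_def dist_norm norm_minus_commute)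
        finally have "(norm (x - y))\<^sup>2 \<le> (\<rho> / 2)\<^sup>2" by (intro power_mono) auto
        then have "(1 / \<rho>\<^sup>2) * (norm (x - y))\<^sup>2 \<le> 1/4" using \<rho>(1) by (simp add: field_simps power2_eq_square)
        then have "bumpD 1 s0 \<le> bumpD 1 (1 - (1 / \<rho>\<^sup>2) * (norm (x - y))\<^sup>2)" by (intro s0(2)) auto
        then have "inverse (\<rho> ^ ?d) * bumpD 1 s0 \<le> mean_kernel ?d \<rho> ((norm (x - y))\<^sup>2)"
          unfolding mean_kernel_def using \<rho>(1) by (intro mult_left_mono) auto
        then have "w x * (inverse (\<rho> ^ ?d) * bumpD 1 s0) \<le> w x * mean_kernel ?d \<rho> ((norm (x - y))\<^sup>2)"
          using wn(1) by (rule mult_left_mono)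
        then show ?thesis using True by (simp add: mult_ac)
      next
        case False
        then show ?thesis using wn(1)[of x] mean_kernel_nonneg[OF \<rho>(1)] by simp
      qed
    qed
    finally show ?thesis .
  qed
  define \<kappa> where "\<kappa> s = (\<integral>z. mean_kernel ?d s ((norm (z::'a))\<^sup>2) \<partial>lborel)" for s
  \<comment> \<open>The kernel is at most its height on a ball of radius s, and the volume factor
    s^d cancels s^(-d). This bound on the mass is uniform in the radius.\<close>
  define \<kappa>m where "\<kappa>m = Bm * unit_ball_vol (real ?d)"
  have moll: "mollk s (\<lambda>z::'a. mean_kernel ?d s ((norm z)\<^sup>2) / \<kappa> s)" "0 < \<kappa> s" if s: "0 < s" for s
  proof -
    have c: "continuous_on UNIV (\<lambda>z::'a. mean_kernel ?d s ((norm z)\<^sup>2))" using continuous_on_mvk[OF s, of ?d 0] by simp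
    have z: "mean_kernel ?d s ((norm z)\<^sup>2) = 0" if "s \<le> norm z" for z :: 'a
      using that s by (intro mean_kernel_zero power_mono) auto
    have p: "0 < mean_kernel ?d s ((norm (0::'a))\<^sup>2)" using s bumpD1_pos[of 1] by (simp add: mean_kernel_def)
    show "mollk s (\<lambda>z::'a. mean_kernel ?d s ((norm z)\<^sup>2) / \<kappa> s)" "0 < \<kappa> s"
      unfolding \<kappa>_def using mollk_normalize[OF c mean_kernel_nonneg[OF s] z p] by blast+
  qed
  have \<kappa>le: "\<kappa> s \<le> \<kappa>m" if s: "0 < s" for s
  proof -
    have "\<kappa> s \<le> (\<integral>z. (inverse (s ^ ?d) * Bm) * indicator (cball 0 s) (z::'a) \<partial>lborel)"
      unfolding \<kappa>_def
    proof (rule integral_mono)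
      show "integrable lborel (\<lambda>z::'a. mean_kernel ?d s ((norm z)\<^sup>2))"
        using continuous_on_mvk[OF s, of ?d 0] s
        by (intro cc_integrable[of _ "cball 0 s"]) (auto intro!: mean_kernel_zero power_mono)
      show "integrable lborel (\<lambda>z::'a. (inverse (s ^ ?d) * Bm) * indicator (cball 0 s) z)"
        by (rule integrable_const_ball)
      show "mean_kernel ?d s ((norm z)\<^sup>2) \<le> inverse (s ^ ?d) * Bm * indicator (cball 0 s) z" for z :: 'a
      proof (cases "z \<in> cball 0 s")
        case True
        then show ?thesis using mean_kernel_le[OF s _ Bm(2), of "(norm z)\<^sup>2" ?d] by simp
      next
        case False
        then have "s\<^sup>2 \<le> (norm z)\<^sup>2" using s by (intro power_mono) auto
        then show ?thesis using mean_kernel_zero[OF s] False by simp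
      qed
    qed
    also have "\<dots> = inverse (s ^ ?d) * Bm * (unit_ball_vol (real ?d) * s ^ ?d)"
      using s by (simp add: content_cball)
    also have "\<dots> = \<kappa>m" using s by (simp add: \<kappa>m_def)
    finally show ?thesis .
  qed
  have \<kappa>m0: "0 < \<kappa>m" using moll(2)[OF \<rho>(1)] \<kappa>le[OF \<rho>(1)] by linarith
  define c where "c = c0 / \<kappa>m"
  have c: "0 < c" using c00 \<kappa>m0 by (simp add: c_def)
  define r where "r n = \<rho> / real (Suc n)" for n
  have r: "0 < r n" "r n \<le> \<rho>" for n using \<rho>(1) by (auto simp: r_def divide_le_eq mult_left_le)
  have rlim: "r \<longlonglongrightarrow> 0" unfolding r_def
    using tendsto_mult[OF tendsto_const[of \<rho>] LIMSEQ_inverse_real_of_nat] by (simp add: divide_inverse)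
  define j where "j n = (\<lambda>z::'a. mean_kernel ?d (r n) ((norm z)\<^sup>2) / \<kappa> (r n))" for n
  have j: "mollk (r n) (j n)" for n unfolding j_def by (rule moll[OF r(1)])
  have jA: "(\<integral>x. w x * j n (x - y) \<partial>lborel) = A (r n) y / \<kappa> (r n)" for n y
    by (simp add: j_def A_def)
  have jc: "c \<le> (\<integral>x. w x * j n (x - y) \<partial>lborel)" if y: "y \<in> V" for n y
  proof -
    have "c0 \<le> A (r n) y" using Ac0[OF y] mono[OF r, of y n] y \<rho>(1) by (auto simp: V_def)
    then have "c0 / \<kappa>m \<le> A (r n) y / \<kappa> (r n)"
      using c00 moll(2)[OF r(1)] \<kappa>le[OF r(1)] by (intro frac_le) auto
    then show ?thesis by (simp add: jA c_def)
  qed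
  \<comment> \<open>The weak form of w >= c on \<open>V\<close>: it holds for the mollified
    functions, whose values on the support of \<psi> are at least c, and passes to the
    limit.\<close>
  have wpsi: "c * (\<integral>y. \<psi> y \<partial>lborel) \<le> (\<integral>x. w x * \<psi> x \<partial>lborel)"
    if t: "test_fun V \<psi>" and p: "\<And>x. 0 \<le> \<psi> x" for \<psi>
  proof -
    obtain K where K: "compact K" "\<And>x. x \<notin> K \<Longrightarrow> \<psi> x = 0" by (rule test_fun_support[OF t]) blast
    have [measurable]: "\<psi> \<in> borel_measurable borel" by (rule smooth_borel[OF test_fun_smooth[OF t]])
    note \<psi>i = test_fun_integrable[OF t]
    have lim: "(\<lambda>n. \<integral>y. (\<integral>x. w x * j n (x - y) \<partial>lborel) * \<psi> y \<partial>lborel) \<longlonglongrightarrow> (\<integral>x. w x * \<psi> x \<partial>lborel)"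
      by (rule moll_lim[OF w smooth_continuous[OF test_fun_smooth[OF t]] K j rlim])
    have le: "c * (\<integral>y. \<psi> y \<partial>lborel) \<le> (\<integral>y. (\<integral>x. w x * j n (x - y) \<partial>lborel) * \<psi> y \<partial>lborel)" for n
    proof -
      have [measurable]: "j n \<in> borel_measurable borel" by (rule mollkD(5)[OF j])
      obtain E where E: "0 \<le> E" "\<And>z. j n z \<le> E" using mollk_bounded[OF j] by blast
      have bd: "\<bar>\<integral>x. w x * j n (x - y) \<partial>lborel\<bar> \<le> (\<integral>x. w x * E \<partial>lborel)" for y
      proof -
        have i: "integrable lborel (\<lambda>x. w x * j n (x - y))"
          using Ai[OF r(1), of n y] by (simp add: j_def)
        have "(\<integral>x. w x * j n (x - y) \<partial>lborel) \<le> (\<integral>x. w x * E \<partial>lborel)"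
          using i w E wn by (intro integral_mono) (auto intro: mult_left_mono)
        moreover have "0 \<le> (\<integral>x. w x * j n (x - y) \<partial>lborel)" using wn mollkD(2)[OF j] by simp
        ultimately show ?thesis by simp
      qed
      have "integrable lborel (\<lambda>y. (\<integral>x. w x * j n (x - y) \<partial>lborel) * \<psi> y)"
      proof (rule Bochner_Integration.integrable_bound[OF integrable_mult_right[OF \<psi>i, of "\<integral>x. w x * E \<partial>lborel"]])
        show "AE y in lborel. norm ((\<integral>x. w x * j n (x - y) \<partial>lborel) * \<psi> y) \<le> norm ((\<integral>x. w x * E \<partial>lborel) * \<psi> y)"
          unfolding real_norm_def abs_mult
          by (intro AE_I2 mult_right_mono order_trans[OF bd abs_ge_self]) simp
      qed measurable
      then have "(\<integral>y. c * \<psi> y \<partial>lborel) \<le> (\<integral>y. (\<integral>x. w x * j n (x - y) \<partial>lborel) * \<psi> y \<partial>lborel)"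
      proof (rule integral_mono[rotated])
        show "c * \<psi> y \<le> (\<integral>x. w x * j n (x - y) \<partial>lborel) * \<psi> y" for y
          using jc[of y n] p[of y] test_fun_outside[OF t, of y]
          by (cases "y \<in> V") (auto intro: mult_right_mono)
      qed (use \<psi>i in simp)
      then show "c * (\<integral>y. \<psi> y \<partial>lborel) \<le> (\<integral>y. (\<integral>x. w x * j n (x - y) \<partial>lborel) * \<psi> y \<partial>lborel)" by simp
    qed
    show ?thesis by (rule LIMSEQ_le_const[OF lim]) (use le in blast)
  qed
  note vb = version_ball[OF S(1) \<Phi>i w wae VS(1)[unfolded V_def], where C = c]
  have "AE x in lebesgue_on (ball y0 (\<rho> / 4)). 0 \<le> \<Phi> x - c"
  proof (rule fundamental_nonneg)
    show "0 \<le> (\<integral>x. (\<Phi> x - c) * \<psi> x \<partial>lebesgue_on (ball y0 (\<rho> / 4)))"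
      if "test_fun (ball y0 (\<rho> / 4)) \<psi>" "\<And>x. 0 \<le> \<psi> x" for \<psi>
      using vb(2)[OF that(1)] wpsi[unfolded V_def, OF that] by simp
  qed (use vb(1) in auto)
  then show ?thesis using \<rho>(1) c by (intro that[of "\<rho>/4" c]) auto
qed

lemma superharmonic_lower_bound_compact:
  fixes \<Phi> :: "'a::euclidean_space \<Rightarrow> real"
  assumes \<Omega>: "open \<Omega>" and K: "compact K" "K \<subseteq> \<Omega>"
    and loc: "\<And>K. compact K \<Longrightarrow> K \<subseteq> \<Omega> \<Longrightarrow> set_integrable lebesgue K \<Phi>"
    and pos: "\<And>x. x \<in> \<Omega> \<Longrightarrow> 0 < \<Phi> x"
    and sup: "\<And>\<phi>. test_fun \<Omega> \<phi> \<Longrightarrow> (\<And>x. 0 \<le> \<phi> x) \<Longrightarrow>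
        (\<integral>x. \<Phi> x * (\<Sum>i\<in>Basis. pd i (pd i \<phi>) x) \<partial>lebesgue_on \<Omega>) \<le> 0"
  obtains c where "0 < c" "AE x in lebesgue. x \<in> K \<longrightarrow> c \<le> \<Phi> x"
proof -
  have "\<exists>r c. 0 < r \<and> 0 < c \<and> (AE x in lebesgue. x \<in> ball y r \<longrightarrow> c \<le> \<Phi> x)" if "y \<in> K" for y
  proof -
    have y: "y \<in> \<Omega>" using that K(2) by blast
    show ?thesis
    proof (rule superharmonic_lower_bound[OF \<Omega> y, of \<Phi>])
      fix r c :: real assume "0 < r" "0 < c" "AE x in lebesgue_on (ball y r). c \<le> \<Phi> x"
      then show ?thesis by (intro exI[of _ r] exI[of _ c]) (auto simp: AE_restrict_space_iff)
    qed (fact loc pos sup)+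
  qed
  then obtain r c where rc: "\<And>y. y \<in> K \<Longrightarrow> 0 < r y" "\<And>y. y \<in> K \<Longrightarrow> 0 < c y"
    "\<And>y. y \<in> K \<Longrightarrow> AE x in lebesgue. x \<in> ball y (r y) \<longrightarrow> c y \<le> \<Phi> x" by metis
  have cov: "K \<subseteq> (\<Union>y\<in>K. ball y (r y))" using rc(1) by force
  obtain D where D: "D \<subseteq> K" "finite D" "K \<subseteq> (\<Union>y\<in>D. ball y (r y))"
    by (rule compactE_image[OF K(1) _ cov]) auto
  \<comment> \<open>The inserted 1 keeps the minimum defined when the finite subcover is
    empty.\<close>
  define m where "m = Min (insert 1 (c ` D))"
  have m: "0 < m" unfolding m_def using D rc(2) by (subst Min_gr_iff) auto
  have ml: "m \<le> c y" if "y \<in> D" for y unfolding m_def using that D(2) by (intro Min_le) auto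
  have "AE x in lebesgue. \<forall>y\<in>D. x \<in> ball y (r y) \<longrightarrow> c y \<le> \<Phi> x"
    using D rc(3) by (intro AE_finite_allI) auto
  then have "AE x in lebesgue. x \<in> K \<longrightarrow> m \<le> \<Phi> x"
  proof eventually_elim
    case (elim x)
    show ?case
    proof
      assume "x \<in> K"
      then obtain y where "y \<in> D" "x \<in> ball y (r y)" using D(3) by auto
      then show "m \<le> \<Phi> x" using elim ml[of y] by force
    qed
  qed
  then show ?thesis using m that by blast
qed

section \<open>Rellich compactness\<close>

text \<open>By Cauchy-Schwarz the square of an average is at most the average of the squares.
  Tonelli then reduces the claim to single translations, all of length below r where the kernel is
  nonzero, and \<open>L2norm_translate_le\<close> applies.\<close>

lemma moll_diff_le:
  fixes f :: "'a::euclidean_space \<Rightarrow> real"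
  assumes t: "test_fun \<Omega> f" and j: "mollk r j" and r: "0 \<le> r"
  defines "u \<equiv> \<lambda>x. f x - (\<integral>h. j h * f (x + h) \<partial>lborel)"
  shows "L2 lborel u" "L2norm lborel u \<le> r * L2norm lborel (grad f)"
proof -
  note L = test_fun_L2[OF t]
  have [measurable]: "f \<in> borel_measurable borel" by (rule smooth_borel[OF test_fun_smooth[OF t]])
  have [measurable]: "j \<in> borel_measurable borel" by (rule mollkD(5)[OF j])
  note j0 = mollkD(2)[OF j] and ji = mollkD(6)[OF j]
  obtain C where C: "0 \<le> C" "\<And>x. \<bar>f x\<bar> \<le> C" using test_fun_bounded[OF t] by blast
  have um[measurable]: "u \<in> borel_measurable borel" unfolding u_def by measurable
  have bi: "integrable lborel (\<lambda>h. j h * b h)" if "b \<in> borel_measurable borel" "\<And>h. \<bar>b h\<bar> \<le> D" for b D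
  proof (rule Bochner_Integration.integrable_bound[OF integrable_mult_right[OF ji, of D]])
    show "AE h in lborel. norm (j h * b h) \<le> norm (D * j h)"
    proof (rule AE_I2)
      fix h
      have "j h * \<bar>b h\<bar> \<le> j h * D" using that(2) j0 by (intro mult_left_mono) auto
      moreover have "0 \<le> D" using that(2)[of h] by linarith
      ultimately show "norm (j h * b h) \<le> norm (D * j h)" using j0[of h] by (simp add: abs_mult mult.commute)
    qed
  qed (use that(1) in measurable)
  have d2: "\<bar>f x - f (x + h)\<bar> \<le> 2 * C" for x h using C(2)[of x] C(2)[of "x + h"] by linarith
  have d4: "\<bar>(f x - f (x + h))\<^sup>2\<bar> \<le> (2 * C)\<^sup>2" for x h
    using power_mono[OF d2[of x h], of 2] by simp
  have sqi: "integrable lborel (\<lambda>h. j h * (f x - f (x + h))\<^sup>2)" for x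
    by (rule bi[OF _ d4]) measurable
  have pt: "(u x)\<^sup>2 \<le> (\<integral>h. j h * (f x - f (x + h))\<^sup>2 \<partial>lborel)" for x
  proof -
    \<comment> \<open>Splitting the kernel into two square roots gives one factor of norm one, since
      the kernel has mass one.\<close>
    define a where "a h = sqrt (j h)" for h
    define b where "b h = sqrt (j h) * (f x - f (x + h))" for h
    have a: "L2 lborel a" unfolding L2_def a_def using ji j0 by simp
    have b: "L2 lborel b" unfolding L2_def b_def using sqi[of x] j0 by (simp add: power_mult_distrib)
    have "u x = (\<integral>h. j h * f x \<partial>lborel) - (\<integral>h. j h * f (x + h) \<partial>lborel)"
      using mollkD(4)[OF j] ji by (simp add: u_def)
    also have "\<dots> = (\<integral>h. j h * f x - j h * f (x + h) \<partial>lborel)"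
      by (rule Bochner_Integration.integral_diff[symmetric]) (rule bi[of _ C], measurable, rule C(2))+
    also have "\<dots> = (\<integral>h. a h \<bullet> b h \<partial>lborel)"
      unfolding a_def b_def using j0 by (intro Bochner_Integration.integral_cong) (auto simp: algebra_simps simp flip: power2_eq_square)
    finally have "\<bar>u x\<bar> \<le> L2norm lborel a * L2norm lborel b" using CS_inner[OF a b] by simp
    also have "L2norm lborel a = 1" using mollkD(4)[OF j] j0 by (simp add: L2norm_def a_def)
    finally have "\<bar>u x\<bar>\<^sup>2 \<le> (L2norm lborel b)\<^sup>2" by (intro power_mono) auto
    also have "\<dots> = (\<integral>h. j h * (f x - f (x + h))\<^sup>2 \<partial>lborel)"
      using j0 by (simp add: L2norm_sq b_def power_mult_distrib)
    finally show ?thesis by simp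
  qed
  define G where "G = (r * L2norm lborel (grad f))\<^sup>2"
  have "(\<integral>\<^sup>+x. ennreal ((u x)\<^sup>2) \<partial>lborel) \<le> (\<integral>\<^sup>+x. (\<integral>\<^sup>+h. ennreal (j h * (f x - f (x + h))\<^sup>2) \<partial>lborel) \<partial>lborel)"
  proof (rule nn_integral_mono)
    fix x
    show "ennreal ((u x)\<^sup>2) \<le> (\<integral>\<^sup>+h. ennreal (j h * (f x - f (x + h))\<^sup>2) \<partial>lborel)"
      using pt[of x] j0 by (subst nn_integral_eq_integral[OF sqi]) (auto intro: ennreal_leI)
  qed
  also have "\<dots> = (\<integral>\<^sup>+h. (\<integral>\<^sup>+x. ennreal (j h * (f x - f (x + h))\<^sup>2) \<partial>lborel) \<partial>lborel)"
    by (rule lborel_pair.Fubini') measurable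
  also have "\<dots> \<le> (\<integral>\<^sup>+h. ennreal (j h * G) \<partial>lborel)"
  proof (rule nn_integral_mono)
    fix h
    have l: "L2 lborel (\<lambda>x. f x - f (x + h))" by (intro L2_diff L L2_shift)
    have "(\<integral>\<^sup>+x. ennreal (j h * (f x - f (x + h))\<^sup>2) \<partial>lborel) = ennreal (\<integral>x. j h * (f x - f (x + h))\<^sup>2 \<partial>lborel)"
      using l j0 by (intro nn_integral_eq_integral) (auto simp: L2_def)
    also have "(\<integral>x. j h * (f x - f (x + h))\<^sup>2 \<partial>lborel) = j h * (L2norm lborel (\<lambda>x. f (x + h) - f x))\<^sup>2"
      by (simp add: L2norm_sq power2_commute)
    also have "j h * (L2norm lborel (\<lambda>x. f (x + h) - f x))\<^sup>2 \<le> j h * G"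
    proof (cases "r \<le> norm h")
      case True
      then show ?thesis using mollkD(3)[OF j True] by simp
    next
      case False
      then have "L2norm lborel (\<lambda>x. f (x + h) - f x) \<le> r * L2norm lborel (grad f)"
        using L2norm_translate_le[OF t, of h] mult_right_mono[of "norm h" r "L2norm lborel (grad f)"] by simp
      then show ?thesis unfolding G_def using j0 by (intro mult_left_mono power_mono) auto
    qed
    finally show "(\<integral>\<^sup>+x. ennreal (j h * (f x - f (x + h))\<^sup>2) \<partial>lborel) \<le> ennreal (j h * G)"
      by (simp add: ennreal_leI)
  qed
  also have "\<dots> = ennreal (\<integral>h. j h * G \<partial>lborel)"
    using ji j0 by (intro nn_integral_eq_integral) (auto simp: G_def)
  also have "(\<integral>h. j h * G \<partial>lborel) = G" using mollkD(4)[OF j] by simp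
  finally have le: "(\<integral>\<^sup>+x. ennreal ((u x)\<^sup>2) \<partial>lborel) \<le> ennreal G" .
  have i: "integrable lborel (\<lambda>x. (u x)\<^sup>2)"
    by (rule integrableI_bounded) (use le in \<open>auto intro: le_less_trans[OF _ ennreal_less_top]\<close>)
  then show "L2 lborel u" by (simp add: L2_def)
  have "ennreal ((L2norm lborel u)\<^sup>2) \<le> ennreal G"
    using le nn_integral_eq_integral[OF i] by (simp add: L2norm_sq)
  then have "(L2norm lborel u)\<^sup>2 \<le> G" by (subst (asm) ennreal_le_iff) (simp_all add: G_def)
  then show "L2norm lborel u \<le> r * L2norm lborel (grad f)"
    unfolding G_def by (rule power2_le_imp_le) (use r in simp)
qed

text \<open>Mollified functions spread beyond \<Omega>, so their norm over \<Omega> is only bounded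
  by the norm over the whole space.\<close>

lemma L2norm_restrict_le:
  assumes u: "L2 lborel u" and \<Omega>: "\<Omega> \<in> sets lebesgue"
  shows "L2 (lebesgue_on \<Omega>) u" "L2norm (lebesgue_on \<Omega>) u \<le> L2norm lborel u"
proof -
  have um: "u \<in> borel_measurable borel" using u by (simp add: L2_def)
  have i: "integrable lebesgue (\<lambda>x. (norm (u x))\<^sup>2)"
    using u um by (subst integrable_completion) (auto simp: L2_def)
  then have "integrable lebesgue (\<lambda>x. indicator \<Omega> x *\<^sub>R (norm (u x))\<^sup>2)"
    using integrable_mult_indicator[OF \<Omega>] by blast
  note i2 = this
  then have "integrable (lebesgue_on \<Omega>) (\<lambda>x. (norm (u x))\<^sup>2)"
    using \<Omega> by (simp add: integrable_restrict_space)
  then show "L2 (lebesgue_on \<Omega>) u"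
    using borel_measurable_lebesgue_on_borel[OF um] by (simp add: L2_def)
  have "(\<integral>x. (norm (u x))\<^sup>2 \<partial>lebesgue_on \<Omega>) = (\<integral>x. indicator \<Omega> x *\<^sub>R (norm (u x))\<^sup>2 \<partial>lebesgue)"
    using \<Omega> by (simp add: integral_restrict_space)
  also have "\<dots> \<le> (\<integral>x. (norm (u x))\<^sup>2 \<partial>lebesgue)"
    by (rule integral_mono[OF i2 i]) (simp add: indicator_def)
  also have "\<dots> = (\<integral>x. (norm (u x))\<^sup>2 \<partial>lborel)" using um by (intro integral_completion) measurable
  finally show "L2norm (lebesgue_on \<Omega>) u \<le> L2norm lborel u" by (simp add: L2norm_def)
qed

text \<open>Mollification at a fixed small scale moves each function by at most a multiple of that scale in
  L2, and the mollified sequence is equicontinuous.\<close>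

lemma rellich_step:
  fixes f :: "nat \<Rightarrow> 'a::euclidean_space \<Rightarrow> real"
  assumes \<Omega>: "open \<Omega>" "bounded \<Omega>" and t: "\<And>n. test_fun \<Omega> (f n)"
    and C: "\<And>n. L2norm lborel (f n) \<le> C" "\<And>n. L2norm lborel (grad (f n)) \<le> C" and e: "0 < e"
  shows "\<exists>s :: nat \<Rightarrow> nat. strict_mono s \<and> (\<forall>i j. L2norm lborel (\<lambda>x. f (s i) x - f (s j) x) \<le> e)"
proof -
  let ?M = "lebesgue_on \<Omega>"
  have \<Omega>l: "\<Omega> \<in> lmeasurable" "\<Omega> \<in> sets lebesgue" using \<Omega> by (auto simp: lmeasurable_open)
  interpret M: finite_measure ?M by (rule finite_measure_lebesgue_on[OF \<Omega>l(1)])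
  have C0: "0 \<le> C" using C(1)[of 0] L2norm_nonneg[of lborel "f 0"] by linarith
  define \<mu> where "\<mu> = sqrt (measure ?M (space ?M))"
  have \<mu>: "0 \<le> \<mu>" by (simp add: \<mu>_def)
  \<comment> \<open>The gradient of a difference has norm at most 2C, so mollifying at this scale
    costs at most e/2. The 1 covers C = 0.\<close>
  define r where "r = e / (4 * (C + 1))"
  have r: "0 < r" using e C0 by (simp add: r_def)
  have rC: "r * (2 * C) \<le> e / 2" using e C0 by (simp add: r_def field_simps)
  obtain j :: "'a \<Rightarrow> real" where j: "mollk r j" "smooth j" using ex_smooth_mollk[OF r] by blast
  have tj: "test_fun UNIV j" using j mollkD(3)[OF j(1)] by (intro test_funI[of _ "cball 0 r"]) auto
  obtain L where L: "0 \<le> L" "\<And>x. norm (grad j x) \<le> L" using test_fun_grad_bounded[OF tj] by blast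
  obtain E where E: "0 \<le> E" "\<And>x. \<bar>j x\<bar> \<le> E" using test_fun_bounded[OF tj] by blast
  have [measurable]: "j \<in> borel_measurable borel" by (rule mollkD(5)[OF j(1)])
  have [measurable]: "f n \<in> borel_measurable borel" for n by (rule smooth_borel[OF test_fun_smooth[OF t]])
  have fi: "integrable lborel (f n)" for n by (rule test_fun_integrable[OF t])
  \<comment> \<open>Bounded measure turns the L2 bound into an L1 bound, which is what convolution
    with a bounded or Lipschitz kernel consumes.\<close>
  have f1: "(\<integral>x. \<bar>f n x\<bar> \<partial>lborel) \<le> C * \<mu>" for n
  proof -
    have "(\<integral>x. \<bar>f n x\<bar> \<partial>lborel) = (\<integral>x. norm (f n x) \<partial>?M)"
      using test_fun_outside[OF t] \<Omega>l by (subst integral_lebesgue_on_borel(1)) auto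
    also have "\<dots> \<le> L2norm ?M (f n) * \<mu>"
      unfolding \<mu>_def by (rule M.L2_integrable(2)[OF test_fun_L2_on(1)[OF t \<Omega>l(2)]])
    also have "L2norm ?M (f n) = L2norm lborel (f n)"
      using test_fun_outside[OF t] by (intro L2_lebesgue_on test_fun_L2[OF t] \<Omega>l) auto
    also have "L2norm lborel (f n) * \<mu> \<le> C * \<mu>" by (intro mult_right_mono C \<mu>)
    finally show ?thesis .
  qed
  define F where "F n x = (\<integral>h. j h * f n (x + h) \<partial>lborel)" for n x
  \<comment> \<open>Shifting the variable puts x into the kernel alone, so the size and the
    Lipschitz constant of \<open>F n\<close> depend on j and the common L1 bound only.\<close>
  have Fz: "F n x = (\<integral>z. j (z - x) * f n z \<partial>lborel)" for n x
    using lborel_shift_integral[of "\<lambda>z. j (z - x) * f n z" x] by (simp add: F_def add.commute)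
  have ji: "integrable lborel (\<lambda>z. b z * f n z)" "\<bar>\<integral>z. b z * f n z \<partial>lborel\<bar> \<le> D * (C * \<mu>)"
    if b: "b \<in> borel_measurable borel" "\<And>z. \<bar>b z\<bar> \<le> D" for b D n
  proof -
    have D: "0 \<le> D" using b(2)[of 0] by linarith
    have bd: "norm (b z * f n z) \<le> D * \<bar>f n z\<bar>" for z
      using b(2)[of z] by (simp add: abs_mult mult_right_mono)
    show i: "integrable lborel (\<lambda>z. b z * f n z)"
      by (rule Bochner_Integration.integrable_bound[OF integrable_mult_right[OF integrable_norm[OF fi[of n]], of D]])
         (use b bd D in \<open>auto simp: abs_mult\<close>)
    have "\<bar>\<integral>z. b z * f n z \<partial>lborel\<bar> \<le> (\<integral>z. norm (b z * f n z) \<partial>lborel)"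
      using integral_norm_bound[of lborel "\<lambda>z. b z * f n z"] by simp
    also have "\<dots> \<le> (\<integral>z. D * \<bar>f n z\<bar> \<partial>lborel)"
      by (rule integral_mono[OF integrable_norm[OF i] _ bd]) (use fi in simp)
    also have "\<dots> \<le> D * (C * \<mu>)" using f1[of n] D by (simp add: mult_left_mono)
    finally show "\<bar>\<integral>z. b z * f n z \<partial>lborel\<bar> \<le> D * (C * \<mu>)" .
  qed
  have Fb: "\<bar>F n x\<bar> \<le> E * (C * \<mu>)" for n x unfolding Fz by (rule ji(2)) (use E in auto)
  have Fl: "\<bar>F n x - F n y\<bar> \<le> L * norm (x - y) * (C * \<mu>)" for n x y
  proof -
    have "F n x - F n y = (\<integral>z. (j (z - x) - j (z - y)) * f n z \<partial>lborel)"
      unfolding Fz left_diff_distrib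
      by (rule Bochner_Integration.integral_diff[symmetric]; rule ji(1)[of _ E]) (use E in auto)
    also have "\<bar>\<dots>\<bar> \<le> L * norm (x - y) * (C * \<mu>)"
    proof (rule ji(2))
      show "\<bar>j (z - x) - j (z - y)\<bar> \<le> L * norm (x - y)" for z
        using test_fun_lipschitz[OF j(2) L(2), of "z - x" "z - y"] by (simp add: norm_minus_commute)
    qed measurable
    finally show ?thesis .
  qed
  have eq: "\<exists>d. 0 < d \<and> (\<forall>n y. y \<in> closure \<Omega> \<and> norm (x - y) < d \<longrightarrow> norm (F n x - F n y) < e)" if "0 < e" for x e
  proof -
    define d where "d = e / (L * (C * \<mu>) + 1)"
    have p: "0 < L * (C * \<mu>) + 1" using L C0 \<mu> by (simp add: add_nonneg_pos)
    have "norm (F n x - F n y) < e" if "norm (x - y) < d" for n y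
    proof -
      have "norm (F n x - F n y) \<le> (L * (C * \<mu>)) * norm (x - y)" using Fl[of n x y] by (simp add: mult_ac)
      also have "\<dots> \<le> (L * (C * \<mu>) + 1) * norm (x - y)" by (intro mult_right_mono) auto
      also have "\<dots> < (L * (C * \<mu>) + 1) * d" using that p by (intro mult_strict_left_mono)
      also have "\<dots> = e" using p by (simp add: d_def)
      finally show ?thesis .
    qed
    moreover have "0 < d" using that p by (simp add: d_def)
    ultimately show ?thesis by blast
  qed
  have cl: "compact (closure \<Omega>)" using \<Omega>(2) by (simp add: compact_closure)
  \<comment> \<open>Arzela-Ascoli on the compact closure of \<Omega>, with the uniform bound and the
    equicontinuity just obtained.\<close>
  obtain g k where k: "strict_mono (k :: nat \<Rightarrow> nat)"
    "\<And>e. 0 < e \<Longrightarrow> \<exists>N. \<forall>n x. n \<ge> N \<and> x \<in> closure \<Omega> \<longrightarrow> norm (F (k n) x - g x) < e"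
    using Arzela_Ascoli[OF cl, of F "E * (C * \<mu>)"] Fb eq by (metis real_norm_def)
  \<comment> \<open>Two mollified functions will differ by at most 2e' uniformly; multiplied by the
    root \<mu> of the measure this uses the other half of e.\<close>
  define e' where "e' = e / (4 * (\<mu> + 1))"
  have e': "0 < e'" using e \<mu> by (simp add: e'_def)
  have e'\<mu>: "(2 * e') * \<mu> \<le> e / 2" using e \<mu> by (simp add: e'_def field_simps)
  obtain N where N: "\<And>n x. n \<ge> N \<Longrightarrow> x \<in> closure \<Omega> \<Longrightarrow> norm (F (k n) x - g x) < e'"
    using k(2)[OF e'] by blast
  \<comment> \<open>The shift discards the initial terms, so the estimate holds for every pair of
    indices.\<close>
  define s where "s n = k (n + N)" for n
  have s: "strict_mono s" using k(1) by (auto simp: s_def strict_mono_def)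
  have le: "L2norm lborel (\<lambda>x. f (s a) x - f (s b) x) \<le> e" for a b
  proof -
    define u where "u x = f (s a) x - f (s b) x" for x
    define Fu where "Fu x = (\<integral>h. j h * u (x + h) \<partial>lborel)" for x
    have tu: "test_fun \<Omega> u" unfolding u_def by (intro test_fun_diff t)
    have Fu: "Fu x = F (s a) x - F (s b) x" for x
    proof -
      have "integrable lborel (\<lambda>h. j h * f n (x + h))" for n
        using lborel_shift_integrable[OF ji(1)[of "\<lambda>z. j (z - x)" E n], of x] E by (simp add: add.commute)
      then show ?thesis by (simp add: Fu_def F_def u_def right_diff_distrib)
    qed
    note md = moll_diff_le[OF tu j(1) less_imp_le[OF r], folded Fu_def]
    have Lu: "L2 ?M u" by (rule test_fun_L2_on(1)[OF tu \<Omega>l(2)])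
    have LF: "L2 ?M Fu"
      using L2_diff[OF Lu L2norm_restrict_le(1)[OF md(1) \<Omega>l(2)]] by simp
    have gu: "L2norm lborel (grad u) \<le> 2 * C"
    proof -
      have "grad u = (\<lambda>x. grad (f (s a)) x - grad (f (s b)) x)"
        unfolding u_def by (intro ext grad_diff smooth_diff test_fun_smooth[OF t])
      then have "L2norm lborel (grad u) = L2norm lborel (\<lambda>x. grad (f (s a)) x - grad (f (s b)) x)" by simp
      also have "\<dots> \<le> L2norm lborel (grad (f (s a))) + L2norm lborel (grad (f (s b)))"
        using L2norm_triangle_diff[OF test_fun_L2(2)[OF t] L2_zero test_fun_L2(2)[OF t], of "s a" "s b"]
        by (simp add: L2norm_minus_commute[of lborel "\<lambda>x. 0"] L2norm_def)
      also have "\<dots> \<le> 2 * C" using C(2)[of "s a"] C(2)[of "s b"] by simp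
      finally show ?thesis .
    qed
    have "L2norm lborel u = L2norm ?M u"
      using test_fun_outside[OF tu] by (intro L2_lebesgue_on(2)[symmetric] test_fun_L2[OF tu] \<Omega>l) auto
    also have "\<dots> \<le> L2norm ?M (\<lambda>x. u x - Fu x) + L2norm ?M Fu" by (rule L2norm_triangle_sub[OF Lu LF])
    also have "L2norm ?M (\<lambda>x. u x - Fu x) \<le> L2norm lborel (\<lambda>x. u x - Fu x)" by (rule L2norm_restrict_le(2)[OF md(1) \<Omega>l(2)])
    also have "L2norm lborel (\<lambda>x. u x - Fu x) \<le> r * L2norm lborel (grad u)" by (rule md(2))
    also have "r * L2norm lborel (grad u) \<le> r * (2 * C)" using gu r by (intro mult_left_mono) auto
    also have "r * (2 * C) \<le> e / 2" by (rule rC)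
    also have "L2norm ?M Fu \<le> L2norm ?M (\<lambda>x. 2 * e')"
    proof (rule L2norm_mono_AE)
      show "AE x in ?M. norm (Fu x) \<le> norm (2 * e')"
      proof (rule AE_I2)
        fix x assume "x \<in> space ?M"
        then have "x \<in> closure \<Omega>" using closure_subset by auto
        then show "norm (Fu x) \<le> norm (2 * e')"
          using N[of "a + N" x] N[of "b + N" x] e' by (simp add: Fu s_def)
      qed
    qed (use LF M.L2_const in \<open>auto simp: L2_def\<close>)
    also have "L2norm ?M (\<lambda>x. 2 * e') = (2 * e') * \<mu>"
      using e' by (simp add: L2norm_def \<mu>_def real_sqrt_mult mult.commute)
    also note e'\<mu>
    finally show ?thesis unfolding u_def by simp
  qed
  show ?thesis by (rule exI[of _ s]) (use s le in blast)
qed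

text \<open>Diagonal extraction over the tolerances 1/(n+1). The requirement \<open>P n\<close>
  bounds all pairwise distances along a sequence and is therefore inherited by subsequences.\<close>

lemma rellich:
  fixes f :: "nat \<Rightarrow> 'a::euclidean_space \<Rightarrow> real"
  assumes \<Omega>: "open \<Omega>" "bounded \<Omega>" and t: "\<And>n. test_fun \<Omega> (f n)"
    and C: "\<And>n. L2norm lborel (f n) \<le> C" "\<And>n. L2norm lborel (grad (f n)) \<le> C"
  obtains s :: "nat \<Rightarrow> nat" where "strict_mono s" "L2Cauchy lborel (\<lambda>n. f (s n))"
proof -
  define P where "P n s \<longleftrightarrow> (\<forall>i j. L2norm lborel (\<lambda>x. f (s i) x - f (s j) x) \<le> 1 / real (Suc n))" for n and s :: "nat \<Rightarrow> nat"
  interpret subseqs P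
  proof
    fix n and s :: "nat \<Rightarrow> nat" assume "strict_mono s"
    show "\<exists>r'. strict_mono r' \<and> P n (s \<circ> r')"
      using rellich_step[OF \<Omega>, of "\<lambda>n. f (s n)" C "1 / real (Suc n)"] t C by (simp add: P_def)
  qed
  have PD: "L2norm lborel (\<lambda>x. f (s i) x - f (s j) x) \<le> 1 / real (Suc n)" if "P n s" for n s i j
    using that unfolding P_def by blast
  \<comment> \<open>Only the tail of the diagonal sequence from index k+1 on is a subsequence of
    stage k, hence the threshold \<open>Suc k\<close> below.\<close>
  have hold: "P k (diagseq \<circ> ((+) (Suc k)))" for k
    by (rule diagseq_holds) (simp add: P_def)
  have "L2Cauchy lborel (\<lambda>n. f (diagseq n))"
    unfolding L2Cauchy_def
  proof (intro conjI allI impI)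
    show "L2 lborel (f (diagseq n))" for n by (rule test_fun_L2(1)[OF t])
    fix e :: real assume "0 < e"
    then obtain k where k: "1 / real (Suc k) < e" using nat_approx_posE by blast
    show "\<exists>N. \<forall>m\<ge>N. \<forall>n\<ge>N. L2norm lborel (\<lambda>x. f (diagseq m) x - f (diagseq n) x) < e"
    proof (intro exI allI impI)
      fix m n assume mn: "Suc k \<le> m" "Suc k \<le> n"
      have "L2norm lborel (\<lambda>x. f (diagseq m) x - f (diagseq n) x) \<le> 1 / real (Suc k)"
        using PD[OF hold[of k], of "m - Suc k" "n - Suc k"] mn by simp
      then show "L2norm lborel (\<lambda>x. f (diagseq m) x - f (diagseq n) x) < e" using k by simp
    qed
  qed
  then show ?thesis using subseq_diagseq that by blast
qed

section \<open>The space of functions vanishing on the boundary\<close>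

locale bounded_open =
  fixes \<Omega> :: "'a::euclidean_space set"
  assumes open_Omega: "open \<Omega>" and bounded_Omega: "bounded \<Omega>"
begin

abbreviation "M \<equiv> lebesgue_on \<Omega>"

lemma Omega_sets: "\<Omega> \<in> lmeasurable" "\<Omega> \<in> sets lebesgue"
  using open_Omega bounded_Omega by (auto simp: lmeasurable_open)

sublocale finite_measure M
  by (rule finite_measure_lebesgue_on[OF Omega_sets(1)])

lemma LINT_M:
  fixes F :: "'a \<Rightarrow> 'b::{banach, second_countable_topology}"
  shows "(LINT x:\<Omega>|lebesgue. F x) = (\<integral>x. F x \<partial>M)"
  unfolding set_lebesgue_integral_def using Omega_sets by (simp add: integral_restrict_space)

lemma nn_M: "(\<integral>\<^sup>+x\<in>\<Omega>. F x \<partial>lebesgue) = (\<integral>\<^sup>+x. F x \<partial>M)"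
  using Omega_sets by (subst nn_integral_restrict_space) (auto simp: mult.commute)

lemma L2_iff_nn:
  fixes u :: "'a \<Rightarrow> 'b::euclidean_space"
  assumes "u \<in> borel_measurable M"
  shows "L2 M u \<longleftrightarrow> (\<integral>\<^sup>+x. ennreal ((norm (u x))\<^sup>2) \<partial>M) < \<infinity>"
proof -
  have "(\<lambda>x. (norm (u x))\<^sup>2) \<in> borel_measurable M" using assms by measurable
  then show ?thesis using assms unfolding L2_def by (simp add: integrable_iff_bounded)
qed

lemma L2norm_nn: "L2 M u \<Longrightarrow> (\<integral>\<^sup>+x. ennreal ((norm (u x))\<^sup>2) \<partial>M) = ennreal ((L2norm M u)\<^sup>2)"
  unfolding L2norm_sq by (rule nn_integral_eq_integral) (auto simp: L2_def)

lemma test_L2: "test_fun \<Omega> \<phi> \<Longrightarrow> L2 M \<phi>" "test_fun \<Omega> \<phi> \<Longrightarrow> L2 M (grad \<phi>)"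
  by (rule test_fun_L2_on[OF _ Omega_sets(2)], assumption)+

lemma test_L2norm:
  assumes "test_fun \<Omega> \<phi>"
  shows "L2norm lborel \<phi> = L2norm M \<phi>" "L2norm lborel (grad \<phi>) = L2norm M (grad \<phi>)"
  using L2_lebesgue_on(2)[OF test_fun_L2(1)[OF assms] Omega_sets(2)]
    L2_lebesgue_on(2)[OF test_fun_L2(2)[OF assms] Omega_sets(2)] test_fun_outside[OF assms] by auto

lemma test_measurable:
  assumes "test_fun \<Omega> \<phi>"
  shows "\<phi> \<in> borel_measurable M" "grad \<phi> \<in> borel_measurable M"
  using test_L2[OF assms] by (auto simp: L2_def)

text \<open>Turns the single extended real limit of the definition into two L2 limits, the form in
  which membership is used from here on.\<close>

lemma H01_iff:
  "H01 \<Omega> f Df \<longleftrightarrow> (\<exists>\<phi>. (\<forall>n. test_fun \<Omega> (\<phi> n)) \<and> L2conv M \<phi> f \<and> L2conv M (\<lambda>n. grad (\<phi> n)) Df)"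
  (is "_ = ?R")
proof -
  have split: "(\<integral>\<^sup>+x. ennreal ((\<phi> x - f x)\<^sup>2 + (norm (grad \<phi> x - Df x))\<^sup>2) \<partial>M)
     = ennreal ((L2norm M (\<lambda>x. \<phi> x - f x))\<^sup>2 + (L2norm M (\<lambda>x. grad \<phi> x - Df x))\<^sup>2)"
    if "test_fun \<Omega> \<phi>" "L2 M f" "L2 M Df" for \<phi>
  proof -
    have l: "L2 M (\<lambda>x. \<phi> x - f x)" "L2 M (\<lambda>x. grad \<phi> x - Df x)"
      by (rule L2_diff[OF test_L2(1)[OF that(1)] that(2)], rule L2_diff[OF test_L2(2)[OF that(1)] that(3)])
    then have "(\<integral>\<^sup>+x. ennreal ((norm (\<phi> x - f x))\<^sup>2) + ennreal ((norm (grad \<phi> x - Df x))\<^sup>2) \<partial>M)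
      = ennreal ((L2norm M (\<lambda>x. \<phi> x - f x))\<^sup>2) + ennreal ((L2norm M (\<lambda>x. grad \<phi> x - Df x))\<^sup>2)"
      by (subst nn_integral_add) (simp_all only: L2norm_nn, auto simp: L2_def)
    then show ?thesis by simp
  qed
  show ?thesis
  proof
    assume H: "H01 \<Omega> f Df"
    have L: "L2 M f" "L2 M Df" using H unfolding H01_def nn_M by (auto simp: L2_iff_nn)
    obtain \<phi> where \<phi>: "\<And>n. test_fun \<Omega> (\<phi> n)"
      "(\<lambda>n. \<integral>\<^sup>+x. ennreal ((\<phi> n x - f x)\<^sup>2 + (norm (grad (\<phi> n) x - Df x))\<^sup>2) \<partial>M) \<longlonglongrightarrow> 0"
      using H unfolding H01_def nn_M by blast
    define a where "a n = (L2norm M (\<lambda>x. \<phi> n x - f x))\<^sup>2" for n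
    define b where "b n = (L2norm M (\<lambda>x. grad (\<phi> n) x - Df x))\<^sup>2" for n
    have ab: "0 \<le> a n" "0 \<le> b n" for n by (auto simp: a_def b_def)
    have "(\<lambda>n. ennreal (a n + b n)) \<longlonglongrightarrow> ennreal 0"
      using \<phi>(2) unfolding split[OF \<phi>(1) L] a_def b_def by simp
    then have lim: "(\<lambda>n. a n + b n) \<longlonglongrightarrow> 0"
      by (subst (asm) tendsto_ennreal_iff) (auto simp: ab intro!: always_eventually add_nonneg_nonneg)
    have "a \<longlonglongrightarrow> 0" "b \<longlonglongrightarrow> 0"
      by (rule squeeze_null[OF _ lim]; simp add: ab)+
    from tendsto_real_sqrt[OF this(1)] tendsto_real_sqrt[OF this(2)]
    have "(\<lambda>n. L2norm M (\<lambda>x. \<phi> n x - f x)) \<longlonglongrightarrow> 0" "(\<lambda>n. L2norm M (\<lambda>x. grad (\<phi> n) x - Df x)) \<longlonglongrightarrow> 0"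
      by (simp_all add: a_def b_def)
    then show ?R using \<phi>(1) L by (intro exI[of _ \<phi>]) (auto simp: L2conv_def intro!: test_L2)
  next
    assume ?R
    then obtain \<phi> where \<phi>: "\<And>n. test_fun \<Omega> (\<phi> n)" and c: "L2conv M \<phi> f" "L2conv M (\<lambda>n. grad (\<phi> n)) Df" by blast
    note L = L2convD(2)[OF c(1)] L2convD(2)[OF c(2)]
    have "(\<lambda>n. ennreal ((L2norm M (\<lambda>x. \<phi> n x - f x))\<^sup>2 + (L2norm M (\<lambda>x. grad (\<phi> n) x - Df x))\<^sup>2)) \<longlonglongrightarrow> ennreal (0\<^sup>2 + 0\<^sup>2)"
      by (intro tendsto_ennrealI tendsto_intros L2convD(3)[OF c(1)] L2convD(3)[OF c(2)])
    then have "(\<lambda>n. \<integral>\<^sup>+x. ennreal ((\<phi> n x - f x)\<^sup>2 + (norm (grad (\<phi> n) x - Df x))\<^sup>2) \<partial>M) \<longlonglongrightarrow> 0"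
      unfolding split[OF \<phi> L] by simp
    moreover have "(\<integral>\<^sup>+x. ennreal ((f x)\<^sup>2) \<partial>M) < \<infinity>" "(\<integral>\<^sup>+x. ennreal ((norm (Df x))\<^sup>2) \<partial>M) < \<infinity>"
      using L2_iff_nn[of f] L2_iff_nn[of Df] L by (auto simp: L2_def)
    ultimately show "H01 \<Omega> f Df"
      unfolding H01_def nn_M using \<phi> L by (auto simp: L2_def)
  qed
qed

lemma H01_L2: "H01 \<Omega> f Df \<Longrightarrow> L2 M f" "H01 \<Omega> f Df \<Longrightarrow> L2 M Df"
  by (auto simp: H01_iff L2conv_def)

lemma H01_test: "test_fun \<Omega> \<phi> \<Longrightarrow> H01 \<Omega> \<phi> (grad \<phi>)"
  unfolding H01_iff by (intro exI[of _ "\<lambda>_. \<phi>"]) (auto intro!: L2conv_const test_L2)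

text \<open>A further subsequence adds almost everywhere convergence, which is what nonlinear
  coefficients such as \<open>rcp d (\<phi> n x)\<close> require.\<close>

lemma H01_approx:
  assumes "H01 \<Omega> f Df"
  obtains \<phi> where "\<And>n. test_fun \<Omega> (\<phi> n)" "L2conv M \<phi> f" "L2conv M (\<lambda>n. grad (\<phi> n)) Df"
    "AE x in M. (\<lambda>n. \<phi> n x) \<longlonglongrightarrow> f x"
proof -
  obtain \<phi> where \<phi>: "\<And>n. test_fun \<Omega> (\<phi> n)" and c: "L2conv M \<phi> f" "L2conv M (\<lambda>n. grad (\<phi> n)) Df"
    using assms unfolding H01_iff by blast
  obtain r where r: "strict_mono r" "AE x in M. (\<lambda>n. \<phi> (r n) x) \<longlonglongrightarrow> f x"
    using L2conv_AE_subseq[OF c(1)] by blast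
  show ?thesis
    by (rule that[of "\<lambda>n. \<phi> (r n)"])
       (use \<phi> r L2conv_subseq[OF c(1) r(1)] L2conv_subseq[OF c(2) r(1)] in auto)
qed

lemma H01_lincomb:
  assumes "H01 \<Omega> f Df" "H01 \<Omega> g Dg"
  shows "H01 \<Omega> (\<lambda>x. f x + c * g x) (\<lambda>x. Df x + c *\<^sub>R Dg x)"
proof -
  obtain \<phi> where \<phi>: "\<And>n. test_fun \<Omega> (\<phi> n)" "L2conv M \<phi> f" "L2conv M (\<lambda>n. grad (\<phi> n)) Df"
    using assms(1) unfolding H01_iff by blast
  obtain \<psi> where \<psi>: "\<And>n. test_fun \<Omega> (\<psi> n)" "L2conv M \<psi> g" "L2conv M (\<lambda>n. grad (\<psi> n)) Dg"
    using assms(2) unfolding H01_iff by blast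
  have g: "grad (\<lambda>x. \<phi> n x + c * \<psi> n x) = (\<lambda>x. grad (\<phi> n) x + c *\<^sub>R grad (\<psi> n) x)" for n
  proof
    fix x
    have d: "\<phi> n differentiable at x" "\<psi> n differentiable at x"
      by (rule smooth_diff[OF test_fun_smooth[OF \<phi>(1)]], rule smooth_diff[OF test_fun_smooth[OF \<psi>(1)]])
    then have "(\<lambda>x. c * \<psi> n x) differentiable at x" by simp
    then show "grad (\<lambda>x. \<phi> n x + c * \<psi> n x) x = grad (\<phi> n) x + c *\<^sub>R grad (\<psi> n) x"
      using d by (simp add: grad_add grad_cmult)
  qed
  show ?thesis unfolding H01_iff
  proof (intro exI[of _ "\<lambda>n x. \<phi> n x + c * \<psi> n x"] conjI allI)
    show "test_fun \<Omega> (\<lambda>x. \<phi> n x + c * \<psi> n x)" for n by (intro test_fun_add test_fun_cmult \<phi> \<psi>)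
    show "L2conv M (\<lambda>n x. \<phi> n x + c * \<psi> n x) (\<lambda>x. f x + c * g x)"
      using L2conv_add[OF \<phi>(2) L2conv_scaleR[OF \<psi>(2), of c]] by simp
    show "L2conv M (\<lambda>n. grad (\<lambda>x. \<phi> n x + c * \<psi> n x)) (\<lambda>x. Df x + c *\<^sub>R Dg x)"
      unfolding g by (intro L2conv_add L2conv_scaleR \<phi> \<psi>)
  qed
qed

lemma H01_near:
  assumes "H01 \<Omega> f Df" "0 < e"
  shows "\<exists>\<phi>. test_fun \<Omega> \<phi> \<and> L2norm M (\<lambda>x. \<phi> x - f x) < e \<and> L2norm M (\<lambda>x. grad \<phi> x - Df x) < e"
proof -
  obtain \<phi> where \<phi>: "\<And>n. test_fun \<Omega> (\<phi> n)" "L2conv M \<phi> f" "L2conv M (\<lambda>n. grad (\<phi> n)) Df"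
    using assms(1) unfolding H01_iff by blast
  have "\<forall>\<^sub>F n in sequentially. L2norm M (\<lambda>x. \<phi> n x - f x) < e \<and> L2norm M (\<lambda>x. grad (\<phi> n) x - Df x) < e"
    using order_tendstoD(2)[OF L2convD(3)[OF \<phi>(2)] assms(2)] order_tendstoD(2)[OF L2convD(3)[OF \<phi>(3)] assms(2)]
    by eventually_elim simp
  then show ?thesis using \<phi>(1) by (auto simp: eventually_sequentially)
qed

lemma H01_near_seq:
  assumes "\<And>n. H01 \<Omega> (u n) (Du n)"
  obtains \<phi> where "\<And>n. test_fun \<Omega> (\<phi> n)" "\<And>n. L2norm M (\<lambda>x. \<phi> n x - u n x) < 1 / real (Suc n)"
    "\<And>n. L2norm M (\<lambda>x. grad (\<phi> n) x - Du n x) < 1 / real (Suc n)"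
proof -
  have "\<exists>\<phi>. test_fun \<Omega> \<phi> \<and> L2norm M (\<lambda>x. \<phi> x - u n x) < 1 / real (Suc n) \<and> L2norm M (\<lambda>x. grad \<phi> x - Du n x) < 1 / real (Suc n)" for n
    by (rule H01_near[OF assms]) simp
  then show ?thesis using that by metis
qed

lemma L2conv_perturb:
  fixes u v :: "nat \<Rightarrow> 'a \<Rightarrow> 'b::euclidean_space"
  assumes c: "L2conv M u w" and v: "\<And>n. L2 M (v n)" and d: "\<And>n. L2norm M (\<lambda>x. v n x - u n x) < 1 / real (Suc n)"
  shows "L2conv M v w"
proof -
  note C = L2convD[OF c]
  have lim: "(\<lambda>n. 1 / real (Suc n) + L2norm M (\<lambda>x. u n x - w x)) \<longlonglongrightarrow> 0"
    using tendsto_add[OF LIMSEQ_inverse_real_of_nat C(3)] by (simp add: inverse_eq_divide)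
  have "L2norm M (\<lambda>x. v n x - w x) \<le> 1 / real (Suc n) + L2norm M (\<lambda>x. u n x - w x)" for n
    using L2norm_triangle_diff[OF v[of n] C(1)[of n] C(2)] d[of n] by linarith
  then have "(\<lambda>n. L2norm M (\<lambda>x. v n x - w x)) \<longlonglongrightarrow> 0"
    by (intro squeeze_null[OF _ lim]) simp
  then show ?thesis using v C(2) by (simp add: L2conv_def)
qed

text \<open>Each member is replaced by a test function within 1/(n+1) in value and gradient; the
  replaced sequence has the same limits.\<close>

lemma H01_closed:
  assumes H: "\<And>n. H01 \<Omega> (u n) (Du n)" and c: "L2conv M u v" "L2conv M Du Dv"
  shows "H01 \<Omega> v Dv"
proof -
  obtain \<phi> where \<phi>: "\<And>n. test_fun \<Omega> (\<phi> n)" "\<And>n. L2norm M (\<lambda>x. \<phi> n x - u n x) < 1 / real (Suc n)"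
    "\<And>n. L2norm M (\<lambda>x. grad (\<phi> n) x - Du n x) < 1 / real (Suc n)"
    by (rule H01_near_seq[of u Du, OF H]) blast
  show ?thesis unfolding H01_iff
    by (intro exI[of _ \<phi>] conjI allI \<phi>(1)
        L2conv_perturb[OF c(1) test_L2(1)[OF \<phi>(1)] \<phi>(2)] L2conv_perturb[OF c(2) test_L2(2)[OF \<phi>(1)] \<phi>(3)])
qed

lemma L2Cauchy_perturb:
  fixes u v :: "nat \<Rightarrow> 'a \<Rightarrow> 'b::euclidean_space"
  assumes c: "L2Cauchy M v" and u: "\<And>n. L2 M (u n)" and d: "\<And>n. L2norm M (\<lambda>x. v n x - u n x) < a n"
    and a: "a \<longlonglongrightarrow> 0"
  shows "L2Cauchy M u"
  unfolding L2Cauchy_def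
proof (intro conjI allI impI u)
  fix e :: real assume e: "0 < e"
  have v: "L2 M (v n)" for n using c by (simp add: L2Cauchy_def)
  obtain N1 where N1: "\<forall>m\<ge>N1. \<forall>n\<ge>N1. L2norm M (\<lambda>x. v m x - v n x) < e / 3"
    using L2CauchyD[OF c, of "e/3"] e by auto
  obtain N2 where N2: "\<forall>n\<ge>N2. norm (a n - 0) < e / 3" using LIMSEQ_D[OF a, of "e/3"] e by auto
  show "\<exists>N. \<forall>m\<ge>N. \<forall>n\<ge>N. L2norm M (\<lambda>x. u m x - u n x) < e"
  proof (intro exI[of _ "max N1 N2"] allI impI)
    fix m n assume "max N1 N2 \<le> m" "max N1 N2 \<le> n"
    then have "L2norm M (\<lambda>x. v m x - v n x) < e / 3" "\<bar>a m\<bar> < e / 3" "\<bar>a n\<bar> < e / 3" using N1 N2 by auto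
    then show "L2norm M (\<lambda>x. u m x - u n x) < e"
      using L2norm_triangle_diff[OF u[of m] v[of m] u[of n]] L2norm_triangle_diff[OF v[of m] v[of n] u[of n]]
        d[of m] d[of n] L2norm_minus_commute[of M "u m" "v m"] by linarith
  qed
qed

lemma H01_rellich:
  assumes H: "\<And>n. H01 \<Omega> (u n) (Du n)" and C: "\<And>n. L2norm M (u n) \<le> C" "\<And>n. L2norm M (Du n) \<le> C"
  obtains s :: "nat \<Rightarrow> nat" where "strict_mono s" "L2Cauchy M (\<lambda>n. u (s n))"
proof -
  obtain \<phi> where \<phi>: "\<And>n. test_fun \<Omega> (\<phi> n)" "\<And>n. L2norm M (\<lambda>x. \<phi> n x - u n x) < 1 / real (Suc n)"
    "\<And>n. L2norm M (\<lambda>x. grad (\<phi> n) x - Du n x) < 1 / real (Suc n)"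
    by (rule H01_near_seq[of u Du, OF H]) blast
  \<comment> \<open>The approximating test functions differ from the given ones by less than 1, so
    the bound for \<open>rellich\<close> grows from C to C + 1.\<close>
  have le1: "1 / real (Suc n) \<le> 1" for n by simp
  have b1: "L2norm lborel (\<phi> n) \<le> C + 1" for n
    using L2norm_triangle_sub[OF test_L2(1)[OF \<phi>(1)[of n]] H01_L2(1)[OF H[of n]]] C(1)[of n] \<phi>(2)[of n] le1[of n]
    unfolding test_L2norm(1)[OF \<phi>(1)] by linarith
  have b2: "L2norm lborel (grad (\<phi> n)) \<le> C + 1" for n
    using L2norm_triangle_sub[OF test_L2(2)[OF \<phi>(1)[of n]] H01_L2(2)[OF H[of n]]] C(2)[of n] \<phi>(3)[of n] le1[of n]
    unfolding test_L2norm(2)[OF \<phi>(1)] by linarith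
  obtain s :: "nat \<Rightarrow> nat" where s: "strict_mono s" "L2Cauchy lborel (\<lambda>n. \<phi> (s n))"
    by (rule rellich[of \<Omega> \<phi> "C + 1", OF open_Omega bounded_Omega \<phi>(1) b1 b2]) blast
  have c: "L2Cauchy M (\<lambda>n. \<phi> (s n))"
    using s(2) test_L2norm(1)[OF test_fun_diff[OF \<phi>(1) \<phi>(1)]] test_L2(1)[OF \<phi>(1)] by (simp add: L2Cauchy_def)
  have l: "(\<lambda>n. 1 / real (Suc (s n))) \<longlonglongrightarrow> 0"
    using LIMSEQ_subseq_LIMSEQ[OF LIMSEQ_inverse_real_of_nat s(1)] by (simp add: o_def inverse_eq_divide)
  have "L2Cauchy M (\<lambda>n. u (s n))"
    by (rule L2Cauchy_perturb[OF c _ _ l]) (rule H01_L2(1)[OF H], rule \<phi>(2))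
  with s(1) show ?thesis by (rule that)
qed

definition eigen :: "real \<Rightarrow> ('a \<Rightarrow> real) \<Rightarrow> ('a \<Rightarrow> 'a) \<Rightarrow> bool" where
  "eigen lam u Du \<longleftrightarrow> H01 \<Omega> u Du \<and>
     (\<forall>\<phi>. test_fun \<Omega> \<phi> \<longrightarrow> (\<integral>x. Du x \<bullet> grad \<phi> x \<partial>M) = lam * (\<integral>x. u x * \<phi> x \<partial>M))"

text \<open>Both sides are continuous in the test object, so density of test functions suffices.
  This allows \<Phi> to be tested with competitors and an eigenfunction with itself.\<close>

lemma eigen_H01:
  assumes e: "eigen lam u Du" and v: "H01 \<Omega> v Dv"
  shows "(\<integral>x. Du x \<bullet> Dv x \<partial>M) = lam * (\<integral>x. u x * v x \<partial>M)"
proof -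
  have u: "H01 \<Omega> u Du" using e by (simp add: eigen_def)
  obtain \<phi> where \<phi>: "\<And>n. test_fun \<Omega> (\<phi> n)" "L2conv M \<phi> v" "L2conv M (\<lambda>n. grad (\<phi> n)) Dv"
    using v unfolding H01_iff by blast
  have "(\<lambda>n. \<integral>x. Du x \<bullet> grad (\<phi> n) x \<partial>M) \<longlonglongrightarrow> (\<integral>x. Du x \<bullet> Dv x \<partial>M)"
    by (rule L2conv_inner1[OF L2conv_const[OF H01_L2(2)[OF u]] \<phi>(3)])
  moreover have "(\<lambda>n. lam * (\<integral>x. u x * \<phi> n x \<partial>M)) \<longlonglongrightarrow> lam * (\<integral>x. u x * v x \<partial>M)"
    using L2conv_inner1[OF L2conv_const[OF H01_L2(1)[OF u]] \<phi>(2)] by (intro tendsto_intros) simp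
  moreover have "(\<integral>x. Du x \<bullet> grad (\<phi> n) x \<partial>M) = lam * (\<integral>x. u x * \<phi> n x \<partial>M)" for n
    using e \<phi>(1) by (simp add: eigen_def)
  ultimately show ?thesis by (simp add: LIMSEQ_unique)
qed

lemma eigen_energy:
  assumes "eigen lam u Du"
  shows "(L2norm M Du)\<^sup>2 = lam * (L2norm M u)\<^sup>2"
  using eigen_H01[OF assms, of u Du] assms
  by (simp add: eigen_def L2norm_sq power2_norm_eq_inner flip: power2_eq_square)

lemma dirichlet_eigenpair_iff:
  "dirichlet_eigenpair \<Omega> lam u \<longleftrightarrow> (\<exists>Du. eigen lam u Du) \<and> 0 < L2norm M u"
proof -
  have "(0 < (\<integral>\<^sup>+x. ennreal ((u x)\<^sup>2) \<partial>M)) = (0 < L2norm M u)" if "L2 M u"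
    using L2norm_nn[OF that] L2norm_nonneg[of M u] by (auto simp: less_le)
  then show ?thesis
    unfolding dirichlet_eigenpair_def nn_M LINT_M eigen_def using H01_L2(1) by blast
qed

text \<open>\<open>H01\<close> is defined by closure; this identifies the limiting gradient as a
  weak derivative.\<close>

lemma H01_by_parts:
  assumes H: "H01 \<Omega> v Dv" and t: "test_fun \<Omega> \<phi>" and i: "i \<in> Basis"
  shows "(\<integral>x. v x * pd i \<phi> x \<partial>M) = - (\<integral>x. (Dv x \<bullet> i) * \<phi> x \<partial>M)"
proof -
  obtain f where f: "\<And>n. test_fun \<Omega> (f n)" "L2conv M f v" "L2conv M (\<lambda>n. grad (f n)) Dv"
    using H unfolding H01_iff by blast
  have "(\<lambda>n. \<integral>x. f n x * pd i \<phi> x \<partial>M) \<longlonglongrightarrow> (\<integral>x. v x * pd i \<phi> x \<partial>M)"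
    using L2conv_inner1[OF f(2) L2conv_const[OF test_L2(1)[OF test_fun_pd[OF t i]]]] by simp
  moreover have "(\<lambda>n. - (\<integral>x. (grad (f n) x \<bullet> i) * \<phi> x \<partial>M)) \<longlonglongrightarrow> - (\<integral>x. (Dv x \<bullet> i) * \<phi> x \<partial>M)"
    using L2conv_inner1[OF L2conv_inner_left[OF f(3)] L2conv_const[OF test_L2(1)[OF t]]] by (intro tendsto_minus) simp
  moreover have "(\<integral>x. f n x * pd i \<phi> x \<partial>M) = - (\<integral>x. (grad (f n) x \<bullet> i) * \<phi> x \<partial>M)" for n
  proof -
    have b: "(\<lambda>x. f n x * pd i \<phi> x) \<in> borel_measurable borel" "(\<lambda>x. pd i (f n) x * \<phi> x) \<in> borel_measurable borel"
      by (intro smooth_borel smooth_mult smooth_pd test_fun_smooth[OF f(1)] test_fun_smooth[OF t] i)+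
    have "(\<integral>x. f n x * pd i \<phi> x \<partial>M) = (\<integral>x. f n x * pd i \<phi> x \<partial>lborel)"
      by (rule integral_lebesgue_on_borel(1)[OF b(1) Omega_sets(2)]) (use test_fun_outside[OF f(1)] in simp)
    also have "\<dots> = - (\<integral>x. pd i (f n) x * \<phi> x \<partial>lborel)"
      by (rule integral_by_parts[OF f(1) test_fun_smooth[OF t] i])
    also have "(\<integral>x. pd i (f n) x * \<phi> x \<partial>lborel) = (\<integral>x. pd i (f n) x * \<phi> x \<partial>M)"
      by (rule integral_lebesgue_on_borel(1)[OF b(2) Omega_sets(2), symmetric]) (use test_fun_outside[OF t] in simp)
    finally show ?thesis using i by (simp add: grad_inner)
  qed
  ultimately show ?thesis by (simp add: LIMSEQ_unique)
qed

end

section \<open>The ground state transform\<close>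

text \<open>A smooth bounded substitute for \<open>1 / s\<close> which remains meaningful for the approximating test
  functions, whose sign is not controlled.\<close>

definition rcp :: "real \<Rightarrow> real \<Rightarrow> real" where
  "rcp d s = s * inverse (s * s + d * d)"

definition rcp' :: "real \<Rightarrow> real \<Rightarrow> real" where
  "rcp' d s = (d * d - s * s) * (inverse (s * s + d * d) * inverse (s * s + d * d))"

lemma rcp_den: "0 < d \<Longrightarrow> 0 < s * s + d * (d::real)"
  by (simp add: add_nonneg_pos)

lemma rcp_deriv:
  assumes "0 < d"
  shows "(rcp d has_real_derivative rcp' d s) (at s)"
proof -
  note p = rcp_den[OF assms, of s]
  have q: "((\<lambda>s. s * s + d * d) has_real_derivative 2 * s) (at s)" by (auto intro!: derivative_eq_intros)
  have ne: "s * s + d * d \<noteq> 0" using p by linarith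
  from DERIV_mult[OF DERIV_ident DERIV_inverse_fun[OF q ne]]
  have "(rcp d has_real_derivative 1 * inverse (s * s + d * d)
      + - (2 * s * inverse ((s * s + d * d) ^ Suc (Suc 0))) * s) (at s)"
    unfolding rcp_def[abs_def] .
  moreover have "1 * inverse (s * s + d * d) + - (2 * s * inverse ((s * s + d * d) ^ Suc (Suc 0))) * s = rcp' d s"
  proof -
    define w where "w = inverse (s * s + d * d)"
    have "(s * s + d * d) * w = 1" unfolding w_def using ne by (rule right_inverse)
    then have "w = ((s * s + d * d) * w) * w" by simp
    then have "w - 2 * s * (w * w) * s = (d * d - s * s) * (w * w)" by (simp add: algebra_simps)
    then show ?thesis unfolding rcp'_def w_def by simp
  qed
  ultimately show ?thesis by (simp only:)
qed

text \<open>Two regimes: the bounds in d serve at fixed d, where the argument is a test function of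
  unknown sign; the bounds in s are uniform in d and serve as d tends to 0, where the argument is
  \<Phi> > 0.\<close>

lemma rcp_bounds:
  assumes "0 < d"
  shows "\<bar>rcp d s\<bar> \<le> 1 / d" "\<bar>rcp' d s\<bar> \<le> 1 / (d * d)"
    "0 < s \<Longrightarrow> \<bar>rcp d s\<bar> \<le> 1 / s" "0 < s \<Longrightarrow> \<bar>rcp' d s\<bar> \<le> 1 / (s * s)"
proof -
  note p = rcp_den[OF assms, of s]
  have "0 \<le> (\<bar>s\<bar> - d) * (\<bar>s\<bar> - d)" "0 \<le> \<bar>s\<bar> * d" using assms by auto
  then have a: "\<bar>s\<bar> * d \<le> s * s + d * d" by (simp add: algebra_simps)
  show "\<bar>rcp d s\<bar> \<le> 1 / d"
    using a p assms by (simp add: rcp_def abs_mult field_simps)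
  have b: "\<bar>d * d - s * s\<bar> \<le> s * s + d * d" by (simp add: abs_le_iff)
  have r: "\<bar>rcp' d s\<bar> \<le> inverse (s * s + d * d)"
  proof -
    have "\<bar>rcp' d s\<bar> = \<bar>d * d - s * s\<bar> * (inverse (s * s + d * d) * inverse (s * s + d * d))"
      using p by (simp add: rcp'_def abs_mult)
    also have "\<dots> \<le> (s * s + d * d) * (inverse (s * s + d * d) * inverse (s * s + d * d))"
      using b p by (intro mult_right_mono) auto
    also have "\<dots> = (s * s + d * d) * inverse (s * s + d * d) * inverse (s * s + d * d)" by (simp only: mult.assoc)
    also have "(s * s + d * d) * inverse (s * s + d * d) = 1" using p by (intro right_inverse) linarith
    also have "1 * inverse (s * s + d * d) = inverse (s * s + d * d)" by simp
    finally show ?thesis .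
  qed
  have "inverse (s * s + d * d) \<le> inverse (d * d)" using assms by (intro le_imp_inverse_le) auto
  with r show "\<bar>rcp' d s\<bar> \<le> 1 / (d * d)" by (simp add: inverse_eq_divide)
  show "\<bar>rcp d s\<bar> \<le> 1 / s" if "0 < s"
    using that p by (simp add: rcp_def abs_mult field_simps)
  show "\<bar>rcp' d s\<bar> \<le> 1 / (s * s)" if "0 < s"
  proof -
    have "inverse (s * s + d * d) \<le> inverse (s * s)" using that by (intro le_imp_inverse_le) auto
    with r show ?thesis by (simp add: inverse_eq_divide)
  qed
qed

lemma rcp_tendsto:
  assumes "0 < d" "f \<longlonglongrightarrow> l"
  shows "(\<lambda>n. rcp d (f n)) \<longlonglongrightarrow> rcp d l" "(\<lambda>n. rcp' d (f n)) \<longlonglongrightarrow> rcp' d l"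
  unfolding rcp_def rcp'_def using rcp_den[OF assms(1), of l] by (auto intro!: tendsto_intros assms)

lemma rcp_limit:
  assumes "0 < s"
  shows "(\<lambda>n. rcp (1 / real (Suc n)) s) \<longlonglongrightarrow> inverse s"
    "(\<lambda>n. rcp' (1 / real (Suc n)) s) \<longlonglongrightarrow> - (inverse s * inverse s)"
proof -
  have d: "(\<lambda>n. 1 / real (Suc n)) \<longlonglongrightarrow> 0" using LIMSEQ_inverse_real_of_nat by (simp add: inverse_eq_divide)
  have "(\<lambda>n. rcp (1 / real (Suc n)) s) \<longlonglongrightarrow> s * inverse (s * s + 0 * 0)"
    unfolding rcp_def by (rule tendsto_mult[OF tendsto_const tendsto_inverse[OF tendsto_add[OF tendsto_const tendsto_mult[OF d d]]]])
       (use assms in simp)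
  moreover have "s * inverse (s * s + 0 * 0) = inverse s" using assms by (simp add: field_simps)
  ultimately show "(\<lambda>n. rcp (1 / real (Suc n)) s) \<longlonglongrightarrow> inverse s" by (simp only:)
  have "(\<lambda>n. rcp' (1 / real (Suc n)) s) \<longlonglongrightarrow> (0 * 0 - s * s) * (inverse (s * s + 0 * 0) * inverse (s * s + 0 * 0))"
    unfolding rcp'_def
    by (intro tendsto_mult tendsto_diff tendsto_inverse tendsto_add tendsto_const d) (use assms in auto)
  moreover have "(0 * 0 - s * s) * (inverse (s * s + 0 * 0) * inverse (s * s + 0 * 0)) = - (inverse s * inverse s)"
    using assms by (simp add: field_simps)
  ultimately show "(\<lambda>n. rcp' (1 / real (Suc n)) s) \<longlonglongrightarrow> - (inverse s * inverse s)" by (simp only:)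
qed

lemma rcp_measurable [measurable]: "rcp d \<in> borel_measurable borel" "rcp' d \<in> borel_measurable borel"
  unfolding rcp_def[abs_def] rcp'_def[abs_def] by measurable

lemma smooth_rcp: "0 < d \<Longrightarrow> smooth f \<Longrightarrow> smooth (\<lambda>x. rcp d (f x))"
  unfolding rcp_def
  by (intro smooth_mult smooth_inverse smooth_add smooth_const) (auto simp: rcp_den[THEN less_imp_neq, symmetric])

lemma grad_rcp: "0 < d \<Longrightarrow> smooth f \<Longrightarrow> grad (\<lambda>x. rcp d (f x)) x = rcp' d (f x) *\<^sub>R grad f x"
  by (rule grad_compose[OF smooth_diff rcp_deriv])

context bounded_open
begin

lemma integrable_bmult_inner:
  assumes "L2 M u" "L2 M v" "b \<in> borel_measurable M" "AE x in M. \<bar>b x\<bar> \<le> C"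
  shows "integrable M (\<lambda>x. b x * (u x \<bullet> v x))"
  by (rule L2conv_inner(2)[OF L2conv_const[OF assms(1)] L2conv_const[OF assms(2)], of "\<lambda>n. b"])
     (use assms in auto)

lemma set_integrable_compact:
  fixes v :: "'a \<Rightarrow> 'b::euclidean_space"
  assumes "integrable M v" "compact K" "K \<subseteq> \<Omega>"
  shows "set_integrable lebesgue K v"
proof -
  have "set_integrable lebesgue \<Omega> v" using assms(1) Omega_sets by (simp add: set_integrable_def integrable_restrict_space)
  then show ?thesis by (rule set_integrable_subset[OF _ fmeasurableD[OF lmeasurable_compact[OF assms(2)]] assms(3)])
qed

end

text \<open>The value \<open>lam\<close> is merely an eigenvalue with an everywhere positive
  eigenfunction; its minimality enters as an assumption of \<open>spectral_gap\<close>.\<close>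

locale ground_state = bounded_open +
  fixes \<Phi> :: "'a \<Rightarrow> real" and D\<Phi> :: "'a \<Rightarrow> 'a" and lam :: real
  assumes nonempty: "\<Omega> \<noteq> {}" and connected: "connected \<Omega>"
    and eig: "eigen lam \<Phi> D\<Phi>" and pos: "\<And>x. x \<in> \<Omega> \<Longrightarrow> 0 < \<Phi> x"
begin

lemma H01_Phi: "H01 \<Omega> \<Phi> D\<Phi>"
  using eig by (simp add: eigen_def)

lemmas Phi_L2 = H01_L2[OF H01_Phi]

lemma Phi_measurable [measurable]: "\<Phi> \<in> borel_measurable M" "D\<Phi> \<in> borel_measurable M"
  using Phi_L2 by (auto simp: L2_def)

lemma Phi_L2norm: "0 < L2norm M \<Phi>"
proof (rule ccontr)
  assume "\<not> 0 < L2norm M \<Phi>"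
  then have "L2norm M \<Phi> = 0" using L2norm_nonneg[of M \<Phi>] by linarith
  then have "(\<integral>x. (norm (\<Phi> x))\<^sup>2 \<partial>M) = 0" using L2norm_sq[of M \<Phi>] by simp
  then have "AE x in M. (norm (\<Phi> x))\<^sup>2 = 0"
    using integral_nonneg_eq_0_iff_AE[of M "\<lambda>x. (norm (\<Phi> x))\<^sup>2"] Phi_L2(1) by (simp add: L2_def)
  then have "AE x in lebesgue. x \<in> \<Omega> \<longrightarrow> (norm (\<Phi> x))\<^sup>2 = 0"
    using Omega_sets by (subst (asm) AE_restrict_space_iff) auto
  then show False using AE_open_ex[OF open_Omega nonempty] pos by fastforce
qed

text \<open>Energy divided by squared norm. The sign is used twice: for superharmonicity of \<Phi>
  and for the Cauchy estimate in \<open>picone\<close>.\<close>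

lemma lam_nonneg: "0 \<le> lam"
  using eigen_energy[OF eig] Phi_L2norm by (metis zero_le_power2 zero_less_power zero_le_mult_iff not_less)

text \<open>Moving one derivative onto \<Phi> gives minus the pairing of D\<Phi> with grad \<phi>,
  which the eigenvalue equation turns into -lam times a nonnegative integral.\<close>

lemma Phi_superharmonic:
  assumes t: "test_fun \<Omega> \<phi>" and p: "\<And>x. 0 \<le> \<phi> x"
  shows "(\<integral>x. \<Phi> x * (\<Sum>i\<in>Basis. pd i (pd i \<phi>) x) \<partial>M) \<le> 0"
proof -
  have i1: "integrable M (\<lambda>x. \<Phi> x * pd i (pd i \<phi>) x)" if "i \<in> Basis" for i
    by (intro integrable_mult_L2 Phi_L2 test_L2(1) test_fun_pd that t)
  have i2: "integrable M (\<lambda>x. (D\<Phi> x \<bullet> i) * pd i \<phi> x)" if "i \<in> Basis" for i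
    by (intro integrable_mult_L2 L2_inner_left Phi_L2 test_L2(1) test_fun_pd that t)
  have "(\<integral>x. \<Phi> x * (\<Sum>i\<in>Basis. pd i (pd i \<phi>) x) \<partial>M) = (\<Sum>i\<in>Basis. \<integral>x. \<Phi> x * pd i (pd i \<phi>) x \<partial>M)"
    unfolding sum_distrib_left by (rule Bochner_Integration.integral_sum[OF i1])
  also have "\<dots> = (\<Sum>i\<in>Basis. - (\<integral>x. (D\<Phi> x \<bullet> i) * pd i \<phi> x \<partial>M))"
    by (intro sum.cong refl H01_by_parts[OF H01_Phi] test_fun_pd t)
  also have "\<dots> = - (\<integral>x. (\<Sum>i\<in>Basis. (D\<Phi> x \<bullet> i) * pd i \<phi> x) \<partial>M)"
    by (subst Bochner_Integration.integral_sum[OF i2]) (auto simp: sum_negf)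
  also have "(\<lambda>x. \<Sum>i\<in>Basis. (D\<Phi> x \<bullet> i) * pd i \<phi> x) = (\<lambda>x. D\<Phi> x \<bullet> grad \<phi> x)"
    by (rule ext, subst euclidean_inner) (simp add: grad_inner)
  also have "- (\<integral>x. D\<Phi> x \<bullet> grad \<phi> x \<partial>M) = - (lam * (\<integral>x. \<Phi> x * \<phi> x \<partial>M))"
    using eig t by (simp add: eigen_def)
  also have "\<dots> \<le> 0"
  proof -
    have "0 \<le> (\<integral>x. \<Phi> x * \<phi> x \<partial>M)"
      by (rule integral_nonneg_AE, rule AE_I2) (use mult_nonneg_nonneg[OF less_imp_le[OF pos] p] in simp)
    then show ?thesis using lam_nonneg by simp
  qed
  finally show ?thesis .
qed

lemma Phi_lower:
  assumes "compact K" "K \<subseteq> \<Omega>"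
  obtains c where "0 < c" "AE x in M. x \<in> K \<longrightarrow> c \<le> \<Phi> x"
proof (rule superharmonic_lower_bound_compact[OF open_Omega assms, of \<Phi>])
  show "set_integrable lebesgue K \<Phi>" if "compact K" "K \<subseteq> \<Omega>" for K
    by (rule set_integrable_compact[OF L2_integrable(1)[OF Phi_L2(1)] that])
  fix c :: real assume c: "0 < c" "AE x in lebesgue. x \<in> K \<longrightarrow> c \<le> \<Phi> x"
  show thesis
  proof (rule that[OF c(1)])
    show "AE x in M. x \<in> K \<longrightarrow> c \<le> \<Phi> x"
      using c(2) Omega_sets by (subst AE_restrict_space_iff) (auto elim: eventually_mono)
  qed
qed (blast intro: pos Phi_superharmonic)+

text \<open>Although \<Phi> may degenerate towards the boundary, only its values on the compact set
  K matter, and there it has a positive essential lower bound.\<close>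

lemma quotient_bounded:
  assumes K: "compact K" "K \<subseteq> \<Omega>" and \<zeta>: "\<And>x. x \<notin> K \<Longrightarrow> \<zeta> x = 0" "\<And>x. \<bar>\<zeta> x\<bar> \<le> E"
  obtains C where "0 \<le> C" "AE x in M. 1 / \<Phi> x * \<bar>\<zeta> x\<bar> \<le> C \<and> 1 / (\<Phi> x * \<Phi> x) * \<bar>\<zeta> x\<bar> \<le> C"
proof -
  obtain c where c: "0 < c" "AE x in M. x \<in> K \<longrightarrow> c \<le> \<Phi> x" by (rule Phi_lower[OF K])
  have E: "0 \<le> E" using \<zeta>(2)[of undefined] by linarith
  define C where "C = max (1 / c * E) (1 / (c * c) * E)"
  have C: "0 \<le> C" using c(1) E by (simp add: C_def le_max_iff_disj)
  have "AE x in M. 1 / \<Phi> x * \<bar>\<zeta> x\<bar> \<le> C \<and> 1 / (\<Phi> x * \<Phi> x) * \<bar>\<zeta> x\<bar> \<le> C"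
    using c(2)
  proof eventually_elim
    case (elim x)
    show ?case
    proof (cases "x \<in> K")
      case True
      then have "c \<le> \<Phi> x" using elim by simp
      then have "1 / \<Phi> x \<le> 1 / c" "1 / (\<Phi> x * \<Phi> x) \<le> 1 / (c * c)"
        using c(1) by (auto intro!: divide_left_mono mult_mono)
      then have "1 / \<Phi> x * \<bar>\<zeta> x\<bar> \<le> 1 / c * E" "1 / (\<Phi> x * \<Phi> x) * \<bar>\<zeta> x\<bar> \<le> 1 / (c * c) * E"
        using \<zeta>(2)[of x] c(1) by (intro mult_mono; simp)+
      then show ?thesis by (simp add: C_def le_max_iff_disj)
    qed (simp add: \<zeta> C)
  qed
  with C show ?thesis by (rule that)
qed

text \<open>One constant serves all d > 0; this is the uniform coefficient bound for letting the
  regularisation tend to zero.\<close>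

lemma test_quotient_bounded:
  assumes t: "test_fun \<Omega> \<zeta>"
  obtains C where "0 \<le> C" "AE x in M. 1 / \<Phi> x * \<bar>\<zeta> x\<bar> \<le> C \<and> 1 / (\<Phi> x * \<Phi> x) * \<bar>\<zeta> x\<bar> \<le> C"
    "AE x in M. \<forall>d>0. \<bar>rcp d (\<Phi> x) * \<zeta> x\<bar> \<le> C \<and> \<bar>rcp' d (\<Phi> x) * \<zeta> x\<bar> \<le> C"
proof -
  obtain K where K: "compact K" "K \<subseteq> \<Omega>" "\<And>x. x \<notin> K \<Longrightarrow> \<zeta> x = 0" by (rule test_fun_support[OF t]) blast
  obtain E where E: "\<And>x. \<bar>\<zeta> x\<bar> \<le> E" by (rule test_fun_bounded[OF t]) blast
  obtain C where C: "0 \<le> C" "AE x in M. 1 / \<Phi> x * \<bar>\<zeta> x\<bar> \<le> C \<and> 1 / (\<Phi> x * \<Phi> x) * \<bar>\<zeta> x\<bar> \<le> C"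
    using quotient_bounded[OF K(1,2), of \<zeta> E] K(3) E by blast
  have "AE x in M. \<forall>d>0. \<bar>rcp d (\<Phi> x) * \<zeta> x\<bar> \<le> C \<and> \<bar>rcp' d (\<Phi> x) * \<zeta> x\<bar> \<le> C"
    using C(2) AE_space
  proof eventually_elim
    case (elim x)
    then have p: "0 < \<Phi> x" using pos by simp
    show ?case
    proof (intro allI impI)
      fix d :: real assume d: "0 < d"
      have "\<bar>rcp d (\<Phi> x) * \<zeta> x\<bar> \<le> 1 / \<Phi> x * \<bar>\<zeta> x\<bar>" "\<bar>rcp' d (\<Phi> x) * \<zeta> x\<bar> \<le> 1 / (\<Phi> x * \<Phi> x) * \<bar>\<zeta> x\<bar>"
        unfolding abs_mult by (intro mult_right_mono rcp_bounds[OF d] p; simp)+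
      then show "\<bar>rcp d (\<Phi> x) * \<zeta> x\<bar> \<le> C \<and> \<bar>rcp' d (\<Phi> x) * \<zeta> x\<bar> \<le> C" using elim by linarith
    qed
  qed
  with C show ?thesis by (rule that)
qed

text \<open>The product rule for v rcp(\<Phi>). With d fixed, \<Phi> and v are both replaced by test
  functions, for which the rule is classical and the product is again a test function; every
  coefficient stays bounded, so the three integrals converge.\<close>

lemma weak_rcp:
  assumes d: "0 < d" and H: "H01 \<Omega> v Dv" and t: "test_fun \<Omega> \<phi>" and i: "i \<in> Basis"
  shows "(\<integral>x. rcp d (\<Phi> x) * (v x * pd i \<phi> x) \<partial>M) =
    - ((\<integral>x. rcp d (\<Phi> x) * ((Dv x \<bullet> i) * \<phi> x) \<partial>M) + (\<integral>x. (rcp' d (\<Phi> x) * \<phi> x) * (v x * (D\<Phi> x \<bullet> i)) \<partial>M))"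
proof -
  obtain p where p: "\<And>n. test_fun \<Omega> (p n)" "L2conv M p \<Phi>" "L2conv M (\<lambda>n. grad (p n)) D\<Phi>"
    "AE x in M. (\<lambda>n. p n x) \<longlonglongrightarrow> \<Phi> x" by (rule H01_approx[OF H01_Phi]) blast
  obtain f where f: "\<And>n. test_fun \<Omega> (f n)" "L2conv M f v" "L2conv M (\<lambda>n. grad (f n)) Dv"
    using H unfolding H01_iff by blast
  have [measurable]: "p n \<in> borel_measurable M" for n by (rule test_measurable(1)[OF p(1)])
  have [measurable]: "\<phi> \<in> borel_measurable M" by (rule test_measurable(1)[OF t])
  obtain E where E: "\<And>x. \<bar>\<phi> x\<bar> \<le> E" by (rule test_fun_bounded[OF t]) blast
  have E0: "0 \<le> E" using E[of undefined] by linarith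
  have l1: "AE x in M. (\<lambda>n. rcp d (p n x)) \<longlonglongrightarrow> rcp d (\<Phi> x)"
    using p(4) by eventually_elim (rule rcp_tendsto(1)[OF d])
  have l2: "AE x in M. (\<lambda>n. rcp' d (p n x) * \<phi> x) \<longlonglongrightarrow> rcp' d (\<Phi> x) * \<phi> x"
    using p(4) by eventually_elim (intro tendsto_mult tendsto_const rcp_tendsto(2)[OF d])
  have b2: "\<bar>rcp' d s * \<phi> x\<bar> \<le> 1 / (d * d) * E" for s x
    unfolding abs_mult using rcp_bounds(2)[OF d] E d by (intro mult_mono) auto
  note P = L2conv_const[OF test_L2(1)[OF test_fun_pd[OF t i]]] and Q = L2conv_const[OF test_L2(1)[OF t]]
  have L1: "(\<lambda>n. \<integral>x. rcp d (p n x) * (f n x * pd i \<phi> x) \<partial>M) \<longlonglongrightarrow> (\<integral>x. rcp d (\<Phi> x) * (v x * pd i \<phi> x) \<partial>M)"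
    using L2conv_inner(1)[OF f(2) P _ _ _ l1, of "1/d"] rcp_bounds(1)[OF d] by simp
  have L2: "(\<lambda>n. \<integral>x. rcp d (p n x) * ((grad (f n) x \<bullet> i) * \<phi> x) \<partial>M) \<longlonglongrightarrow> (\<integral>x. rcp d (\<Phi> x) * ((Dv x \<bullet> i) * \<phi> x) \<partial>M)"
    using L2conv_inner(1)[OF L2conv_inner_left[OF f(3)] Q _ _ _ l1, of "1/d"] rcp_bounds(1)[OF d] by simp
  have L3: "(\<lambda>n. \<integral>x. (rcp' d (p n x) * \<phi> x) * (f n x * (grad (p n) x \<bullet> i)) \<partial>M) \<longlonglongrightarrow>
      (\<integral>x. (rcp' d (\<Phi> x) * \<phi> x) * (v x * (D\<Phi> x \<bullet> i)) \<partial>M)"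
    using L2conv_inner(1)[OF f(2) L2conv_inner_left[OF p(3)] _ _ _ l2, of "1/(d*d) * E"] b2 by simp
  have eq: "(\<integral>x. rcp d (p n x) * (f n x * pd i \<phi> x) \<partial>M) = - ((\<integral>x. rcp d (p n x) * ((grad (f n) x \<bullet> i) * \<phi> x) \<partial>M)
      + (\<integral>x. (rcp' d (p n x) * \<phi> x) * (f n x * (grad (p n) x \<bullet> i)) \<partial>M))" for n
  proof -
    let ?F = "\<lambda>x. f n x * rcp d (p n x)"
    have sp: "smooth (\<lambda>x. rcp d (p n x))" by (rule smooth_rcp[OF d test_fun_smooth[OF p(1)]])
    have tF: "test_fun \<Omega> ?F" by (rule test_fun_mult[OF f(1) sp])
    have g: "grad ?F x \<bullet> i = rcp d (p n x) * (grad (f n) x \<bullet> i) + rcp' d (p n x) * (f n x * (grad (p n) x \<bullet> i))" for x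
      using smooth_diff[OF test_fun_smooth[OF f(1)[of n]], of x] smooth_diff[OF sp, of x]
      by (simp add: grad_mult grad_rcp[OF d test_fun_smooth[OF p(1)]] inner_add_left algebra_simps)
    have i1: "integrable M (\<lambda>x. rcp d (p n x) * ((grad (f n) x \<bullet> i) * \<phi> x))"
      using integrable_bmult_inner[OF L2_inner_left[OF test_L2(2)[OF f(1)[of n]]] test_L2(1)[OF t], of "\<lambda>x. rcp d (p n x)" "1/d" i]
        rcp_bounds(1)[OF d] by simp
    have i2: "integrable M (\<lambda>x. (rcp' d (p n x) * \<phi> x) * (f n x * (grad (p n) x \<bullet> i)))"
      using integrable_bmult_inner[OF test_L2(1)[OF f(1)[of n]] L2_inner_left[OF test_L2(2)[OF p(1)[of n]]],
          of "\<lambda>x. rcp' d (p n x) * \<phi> x" "1/(d*d) * E" i] b2 by simp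
    have "(\<integral>x. ?F x * pd i \<phi> x \<partial>M) = - (\<integral>x. (grad ?F x \<bullet> i) * \<phi> x \<partial>M)"
      by (rule H01_by_parts[OF H01_test[OF tF] t i])
    also have "(\<integral>x. (grad ?F x \<bullet> i) * \<phi> x \<partial>M) = (\<integral>x. rcp d (p n x) * ((grad (f n) x \<bullet> i) * \<phi> x) +
        (rcp' d (p n x) * \<phi> x) * (f n x * (grad (p n) x \<bullet> i)) \<partial>M)"
      unfolding g by (intro Bochner_Integration.integral_cong) (auto simp: algebra_simps)
    also have "\<dots> = (\<integral>x. rcp d (p n x) * ((grad (f n) x \<bullet> i) * \<phi> x) \<partial>M)
      + (\<integral>x. (rcp' d (p n x) * \<phi> x) * (f n x * (grad (p n) x \<bullet> i)) \<partial>M)"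
      by (rule Bochner_Integration.integral_add[OF i1 i2])
    finally show ?thesis by (simp add: mult_ac)
  qed
  show ?thesis
    by (rule LIMSEQ_unique[OF L1[unfolded eq]]) (intro tendsto_minus tendsto_add L2 L3)
qed

text \<open>The eigenvalue equation tested with \<phi>^2 rcp(p_n), where p_n are test functions
  tending to \<Phi>. The true factor rcp(\<Phi>) appears only in the limit.\<close>

lemma equation_rcp:
  assumes d: "0 < d" and t: "test_fun \<Omega> \<phi>"
  shows "(\<integral>x. (rcp d (\<Phi> x) * (2 * \<phi> x)) * (D\<Phi> x \<bullet> grad \<phi> x) \<partial>M)
    + (\<integral>x. (rcp' d (\<Phi> x) * (\<phi> x * \<phi> x)) * (D\<Phi> x \<bullet> D\<Phi> x) \<partial>M)
    = lam * (\<integral>x. (rcp d (\<Phi> x) * \<phi> x) * (\<Phi> x * \<phi> x) \<partial>M)"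
proof -
  obtain p where p: "\<And>n. test_fun \<Omega> (p n)" "L2conv M p \<Phi>" "L2conv M (\<lambda>n. grad (p n)) D\<Phi>"
    "AE x in M. (\<lambda>n. p n x) \<longlonglongrightarrow> \<Phi> x" by (rule H01_approx[OF H01_Phi]) blast
  have [measurable]: "p n \<in> borel_measurable M" for n by (rule test_measurable(1)[OF p(1)])
  have [measurable]: "\<phi> \<in> borel_measurable M" by (rule test_measurable(1)[OF t])
  obtain E where E: "\<And>x. \<bar>\<phi> x\<bar> \<le> E" by (rule test_fun_bounded[OF t]) blast
  have E0: "0 \<le> E" using E[of undefined] by linarith
  have l: "AE x in M. (\<lambda>n. rcp d (p n x) * (2 * \<phi> x)) \<longlonglongrightarrow> rcp d (\<Phi> x) * (2 * \<phi> x)"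
     "AE x in M. (\<lambda>n. rcp d (p n x) * \<phi> x) \<longlonglongrightarrow> rcp d (\<Phi> x) * \<phi> x"
     "AE x in M. (\<lambda>n. rcp' d (p n x) * (\<phi> x * \<phi> x)) \<longlonglongrightarrow> rcp' d (\<Phi> x) * (\<phi> x * \<phi> x)"
    by (rule eventually_mono[OF p(4)], intro tendsto_mult tendsto_const rcp_tendsto[OF d], assumption)+
  have b: "\<bar>rcp d s * (2 * \<phi> x)\<bar> \<le> 1 / d * (2 * E)" "\<bar>rcp d s * \<phi> x\<bar> \<le> 1 / d * E"
    "\<bar>rcp' d s * (\<phi> x * \<phi> x)\<bar> \<le> 1 / (d * d) * (E * E)" for s x
    unfolding abs_mult using rcp_bounds(1,2)[OF d] E E0 d by (intro mult_mono; simp)+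
  note R = L2conv_const[OF Phi_L2(2)] and Q = L2conv_const[OF test_L2(1)[OF t]] and G = L2conv_const[OF test_L2(2)[OF t]]
  have L1: "(\<lambda>n. \<integral>x. (rcp d (p n x) * (2 * \<phi> x)) * (D\<Phi> x \<bullet> grad \<phi> x) \<partial>M) \<longlonglongrightarrow>
      (\<integral>x. (rcp d (\<Phi> x) * (2 * \<phi> x)) * (D\<Phi> x \<bullet> grad \<phi> x) \<partial>M)"
    by (rule L2conv_inner(1)[OF R G _ _ _ l(1), of "1 / d * (2 * E)"]) (use b in auto)
  have L2: "(\<lambda>n. \<integral>x. (rcp' d (p n x) * (\<phi> x * \<phi> x)) * (D\<Phi> x \<bullet> grad (p n) x) \<partial>M) \<longlonglongrightarrow>
      (\<integral>x. (rcp' d (\<Phi> x) * (\<phi> x * \<phi> x)) * (D\<Phi> x \<bullet> D\<Phi> x) \<partial>M)"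
    by (rule L2conv_inner(1)[OF R p(3) _ _ _ l(3), of "1 / (d * d) * (E * E)"]) (use b in auto)
  have L3: "(\<lambda>n. \<integral>x. (rcp d (p n x) * \<phi> x) * (\<Phi> x * \<phi> x) \<partial>M) \<longlonglongrightarrow> (\<integral>x. (rcp d (\<Phi> x) * \<phi> x) * (\<Phi> x * \<phi> x) \<partial>M)"
    using L2conv_inner(1)[OF L2conv_const[OF Phi_L2(1)] Q _ _ _ l(2), of "1 / d * E"] b by simp
  have eq: "lam * (\<integral>x. (rcp d (p n x) * \<phi> x) * (\<Phi> x * \<phi> x) \<partial>M) =
      (\<integral>x. (rcp d (p n x) * (2 * \<phi> x)) * (D\<Phi> x \<bullet> grad \<phi> x) \<partial>M)
      + (\<integral>x. (rcp' d (p n x) * (\<phi> x * \<phi> x)) * (D\<Phi> x \<bullet> grad (p n) x) \<partial>M)" for n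
  proof -
    let ?F = "\<lambda>x. \<phi> x * \<phi> x * rcp d (p n x)"
    have sp: "smooth (\<lambda>x. rcp d (p n x))" by (rule smooth_rcp[OF d test_fun_smooth[OF p(1)]])
    have s\<phi>: "smooth \<phi>" by (rule test_fun_smooth[OF t])
    have tF: "test_fun \<Omega> ?F" by (intro test_fun_mult t sp s\<phi>)
    have g: "grad ?F x = (rcp d (p n x) * (2 * \<phi> x)) *\<^sub>R grad \<phi> x + (rcp' d (p n x) * (\<phi> x * \<phi> x)) *\<^sub>R grad (p n) x" for x
    proof -
      have "grad ?F x = (\<phi> x * \<phi> x) *\<^sub>R grad (\<lambda>x. rcp d (p n x)) x + rcp d (p n x) *\<^sub>R grad (\<lambda>x. \<phi> x * \<phi> x) x"
        by (rule grad_mult[OF smooth_diff[OF smooth_mult[OF s\<phi> s\<phi>]] smooth_diff[OF sp]])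
      also have "grad (\<lambda>x. \<phi> x * \<phi> x) x = (2 * \<phi> x) *\<^sub>R grad \<phi> x"
        by (subst grad_mult[OF smooth_diff[OF s\<phi>] smooth_diff[OF s\<phi>]]) (simp flip: scaleR_add_left)
      also have "grad (\<lambda>x. rcp d (p n x)) x = rcp' d (p n x) *\<^sub>R grad (p n) x"
        by (rule grad_rcp[OF d test_fun_smooth[OF p(1)]])
      finally show ?thesis by (simp add: mult_ac add.commute)
    qed
    have i1: "integrable M (\<lambda>x. (rcp d (p n x) * (2 * \<phi> x)) * (D\<Phi> x \<bullet> grad \<phi> x))"
      by (rule integrable_bmult_inner[OF Phi_L2(2) test_L2(2)[OF t], of _ "1 / d * (2 * E)"]) (use b in auto)
    have i2: "integrable M (\<lambda>x. (rcp' d (p n x) * (\<phi> x * \<phi> x)) * (D\<Phi> x \<bullet> grad (p n) x))"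
      by (rule integrable_bmult_inner[OF Phi_L2(2) test_L2(2)[OF p(1)], of _ "1 / (d * d) * (E * E)"]) (use b in auto)
    have "lam * (\<integral>x. \<Phi> x * ?F x \<partial>M) = (\<integral>x. D\<Phi> x \<bullet> grad ?F x \<partial>M)"
      using eig tF by (simp add: eigen_def)
    also have "\<dots> = (\<integral>x. (rcp d (p n x) * (2 * \<phi> x)) * (D\<Phi> x \<bullet> grad \<phi> x)
       + (rcp' d (p n x) * (\<phi> x * \<phi> x)) * (D\<Phi> x \<bullet> grad (p n) x) \<partial>M)"
      unfolding g by (simp only: inner_add_right inner_scaleR_right)
    also have "\<dots> = (\<integral>x. (rcp d (p n x) * (2 * \<phi> x)) * (D\<Phi> x \<bullet> grad \<phi> x) \<partial>M)
      + (\<integral>x. (rcp' d (p n x) * (\<phi> x * \<phi> x)) * (D\<Phi> x \<bullet> grad (p n) x) \<partial>M)"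
      by (rule Bochner_Integration.integral_add[OF i1 i2])
    finally show ?thesis by (simp add: mult_ac)
  qed
  have "(\<lambda>n. lam * (\<integral>x. (rcp d (p n x) * \<phi> x) * (\<Phi> x * \<phi> x) \<partial>M)) \<longlonglongrightarrow>
     (\<integral>x. (rcp d (\<Phi> x) * (2 * \<phi> x)) * (D\<Phi> x \<bullet> grad \<phi> x) \<partial>M)
    + (\<integral>x. (rcp' d (\<Phi> x) * (\<phi> x * \<phi> x)) * (D\<Phi> x \<bullet> D\<Phi> x) \<partial>M)"
    unfolding eq by (intro tendsto_add L1 L2)
  then show ?thesis by (rule LIMSEQ_unique) (intro tendsto_mult tendsto_const L3)
qed

text \<open>For v = g \<Phi> this is \<Phi> grad g, written without differentiating a quotient. It
  is linear in the pair (v, Dv) and vanishes on \<Omega> at (\<Phi>, D\<Phi>).\<close>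

definition ground_grad :: "('a \<Rightarrow> real) \<Rightarrow> ('a \<Rightarrow> 'a) \<Rightarrow> 'a \<Rightarrow> 'a" where
  "ground_grad v Dv x = Dv x - (v x / \<Phi> x) *\<^sub>R D\<Phi> x"

lemma ground_grad_measurable:
  assumes "v \<in> borel_measurable M" "Dv \<in> borel_measurable M"
  shows "ground_grad v Dv \<in> borel_measurable M"
  unfolding ground_grad_def[abs_def] using assms by measurable

lemma rcp_Phi_limit:
  "AE x in M. (\<lambda>n. rcp (1 / real (Suc n)) (\<Phi> x) * \<zeta> x) \<longlonglongrightarrow> inverse (\<Phi> x) * \<zeta> x"
  "AE x in M. (\<lambda>n. rcp' (1 / real (Suc n)) (\<Phi> x) * \<zeta> x) \<longlonglongrightarrow> - (inverse (\<Phi> x) * inverse (\<Phi> x)) * \<zeta> x"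
  by (intro AE_I2 tendsto_mult tendsto_const rcp_limit pos; simp)+

text \<open>\<open>weak_rcp\<close> with d tending to 0. The compact support of \<phi> supplies the
  bounds, although v/\<Phi> need not be square integrable on \<Omega>.\<close>

lemma weak_quotient:
  assumes H: "H01 \<Omega> v Dv" and t: "test_fun \<Omega> \<phi>" and i: "i \<in> Basis"
  shows "(\<integral>x. (v x / \<Phi> x) * pd i \<phi> x \<partial>M) = - (\<integral>x. ((ground_grad v Dv x \<bullet> i) / \<Phi> x) * \<phi> x \<partial>M)"
    and "integrable M (\<lambda>x. ((ground_grad v Dv x \<bullet> i) / \<Phi> x) * \<phi> x)"
proof -
  note tp = test_fun_pd[OF t i]
  have [measurable]: "\<phi> \<in> borel_measurable M" "pd i \<phi> \<in> borel_measurable M"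
    by (rule test_measurable(1)[OF t], rule test_measurable(1)[OF tp])
  obtain C1 where C1: "AE x in M. \<forall>d>0. \<bar>rcp d (\<Phi> x) * pd i \<phi> x\<bar> \<le> C1 \<and> \<bar>rcp' d (\<Phi> x) * pd i \<phi> x\<bar> \<le> C1"
    by (rule test_quotient_bounded[OF tp]) blast
  obtain C2 where C2: "AE x in M. \<forall>d>0. \<bar>rcp d (\<Phi> x) * \<phi> x\<bar> \<le> C2 \<and> \<bar>rcp' d (\<Phi> x) * \<phi> x\<bar> \<le> C2"
    by (rule test_quotient_bounded[OF t]) blast
  define d where "d n = 1 / real (Suc n)" for n
  have d: "0 < d n" for n by (simp add: d_def)
  have b: "AE x in M. \<bar>rcp (d n) (\<Phi> x) * pd i \<phi> x\<bar> \<le> C1" "AE x in M. \<bar>rcp (d n) (\<Phi> x) * \<phi> x\<bar> \<le> C2"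
    "AE x in M. \<bar>rcp' (d n) (\<Phi> x) * \<phi> x\<bar> \<le> C2" for n
    using C1 C2 d[of n] by (auto elim: eventually_mono)
  note l = rcp_Phi_limit[folded d_def]
  note V = L2conv_const[OF H01_L2(1)[OF H]] and DV = L2conv_inner_left[OF L2conv_const[OF H01_L2(2)[OF H]], of i]
    and one = L2conv_const[OF L2_const[of "1::real"]] and DP = L2conv_inner_left[OF L2conv_const[OF Phi_L2(2)], of i]
  have m: "(\<lambda>x. rcp (d n) (\<Phi> x) * pd i \<phi> x) \<in> borel_measurable M" "(\<lambda>x. inverse (\<Phi> x) * pd i \<phi> x) \<in> borel_measurable M"
    "(\<lambda>x. rcp (d n) (\<Phi> x) * \<phi> x) \<in> borel_measurable M" "(\<lambda>x. inverse (\<Phi> x) * \<phi> x) \<in> borel_measurable M"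
    "(\<lambda>x. rcp' (d n) (\<Phi> x) * \<phi> x) \<in> borel_measurable M" "(\<lambda>x. - (inverse (\<Phi> x) * inverse (\<Phi> x)) * \<phi> x) \<in> borel_measurable M" for n
    by measurable
  note L1 = L2conv_inner[OF V one m(1,2) b(1) l(1)]
  note L2 = L2conv_inner[OF DV one m(3,4) b(2) l(1)]
  note L3 = L2conv_inner[OF V DP m(5,6) b(3) l(2)]
  have eq: "(\<integral>x. rcp (d n) (\<Phi> x) * pd i \<phi> x * (v x \<bullet> 1) \<partial>M) =
     - ((\<integral>x. rcp (d n) (\<Phi> x) * \<phi> x * ((Dv x \<bullet> i) \<bullet> 1) \<partial>M) + (\<integral>x. rcp' (d n) (\<Phi> x) * \<phi> x * (v x \<bullet> (D\<Phi> x \<bullet> i)) \<partial>M))" for n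
    using weak_rcp[OF d H t i, of n] by (simp add: mult_ac)
  have "(\<integral>x. inverse (\<Phi> x) * pd i \<phi> x * (v x \<bullet> 1) \<partial>M) =
    - ((\<integral>x. inverse (\<Phi> x) * \<phi> x * ((Dv x \<bullet> i) \<bullet> 1) \<partial>M) + (\<integral>x. - (inverse (\<Phi> x) * inverse (\<Phi> x)) * \<phi> x * (v x \<bullet> (D\<Phi> x \<bullet> i)) \<partial>M))"
    by (rule LIMSEQ_unique[OF L1(1)[unfolded eq]]) (intro tendsto_minus tendsto_add L2(1) L3(1))
  also have "\<dots> = - (\<integral>x. inverse (\<Phi> x) * \<phi> x * ((Dv x \<bullet> i) \<bullet> 1) + - (inverse (\<Phi> x) * inverse (\<Phi> x)) * \<phi> x * (v x \<bullet> (D\<Phi> x \<bullet> i)) \<partial>M)"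
    by (subst Bochner_Integration.integral_add[OF L2(2) L3(2)]) simp
  also have g: "(\<lambda>x. inverse (\<Phi> x) * \<phi> x * ((Dv x \<bullet> i) \<bullet> 1) + - (inverse (\<Phi> x) * inverse (\<Phi> x)) * \<phi> x * (v x \<bullet> (D\<Phi> x \<bullet> i)))
    = (\<lambda>x. ((ground_grad v Dv x \<bullet> i) / \<Phi> x) * \<phi> x)"
    by (auto simp: ground_grad_def inner_diff_left fun_eq_iff divide_inverse algebra_simps)
  finally show "(\<integral>x. (v x / \<Phi> x) * pd i \<phi> x \<partial>M) = - (\<integral>x. ((ground_grad v Dv x \<bullet> i) / \<Phi> x) * \<phi> x \<partial>M)"
    by (simp add: divide_inverse mult_ac)
  show "integrable M (\<lambda>x. ((ground_grad v Dv x \<bullet> i) / \<Phi> x) * \<phi> x)"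
    using Bochner_Integration.integrable_add[OF L2(2) L3(2)] unfolding g .
qed

text \<open>Testing the eigenvalue equation with \<open>\<phi>\<^sup>2 / \<Phi>\<close>.\<close>

lemma picone_test:
  assumes t: "test_fun \<Omega> \<phi>"
  shows "L2 M (ground_grad \<phi> (grad \<phi>))"
    "(L2norm M (ground_grad \<phi> (grad \<phi>)))\<^sup>2 = (L2norm M (grad \<phi>))\<^sup>2 - lam * (L2norm M \<phi>)\<^sup>2"
proof -
  have s: "smooth \<phi>" by (rule test_fun_smooth[OF t])
  have [measurable]: "\<phi> \<in> borel_measurable M" by (rule test_measurable(1)[OF t])
  have t2: "test_fun \<Omega> (\<lambda>x. 2 * \<phi> x)" "test_fun \<Omega> (\<lambda>x. \<phi> x * \<phi> x)"
    by (intro test_fun_cmult test_fun_mult t s)+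
  obtain C1 where C1: "AE x in M. \<forall>d>0. \<bar>rcp d (\<Phi> x) * (2 * \<phi> x)\<bar> \<le> C1 \<and> \<bar>rcp' d (\<Phi> x) * (2 * \<phi> x)\<bar> \<le> C1"
    by (rule test_quotient_bounded[OF t2(1)]) blast
  obtain C2 where C2: "AE x in M. \<forall>d>0. \<bar>rcp d (\<Phi> x) * (\<phi> x * \<phi> x)\<bar> \<le> C2 \<and> \<bar>rcp' d (\<Phi> x) * (\<phi> x * \<phi> x)\<bar> \<le> C2"
    by (rule test_quotient_bounded[OF t2(2)]) blast
  obtain C3 where C3: "AE x in M. \<forall>d>0. \<bar>rcp d (\<Phi> x) * \<phi> x\<bar> \<le> C3 \<and> \<bar>rcp' d (\<Phi> x) * \<phi> x\<bar> \<le> C3"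
    by (rule test_quotient_bounded[OF t]) blast
  define d where "d n = 1 / real (Suc n)" for n
  have d: "0 < d n" for n by (simp add: d_def)
  have b: "AE x in M. \<bar>rcp (d n) (\<Phi> x) * (2 * \<phi> x)\<bar> \<le> C1" "AE x in M. \<bar>rcp' (d n) (\<Phi> x) * (\<phi> x * \<phi> x)\<bar> \<le> C2"
    "AE x in M. \<bar>rcp (d n) (\<Phi> x) * \<phi> x\<bar> \<le> C3" for n
    using C1 C2 C3 d[of n] by (auto elim: eventually_mono)
  note l = rcp_Phi_limit[folded d_def]
  note R = L2conv_const[OF Phi_L2(2)] and Q = L2conv_const[OF test_L2(1)[OF t]] and G = L2conv_const[OF test_L2(2)[OF t]]
  have m: "(\<lambda>x. rcp (d n) (\<Phi> x) * (2 * \<phi> x)) \<in> borel_measurable M" "(\<lambda>x. inverse (\<Phi> x) * (2 * \<phi> x)) \<in> borel_measurable M"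
    "(\<lambda>x. rcp' (d n) (\<Phi> x) * (\<phi> x * \<phi> x)) \<in> borel_measurable M"
    "(\<lambda>x. - (inverse (\<Phi> x) * inverse (\<Phi> x)) * (\<phi> x * \<phi> x)) \<in> borel_measurable M"
    "(\<lambda>x. rcp (d n) (\<Phi> x) * \<phi> x) \<in> borel_measurable M" "(\<lambda>x. inverse (\<Phi> x) * \<phi> x) \<in> borel_measurable M" for n
    by measurable
  note L1 = L2conv_inner[OF R G m(1,2) b(1) l(1)]
  note L2 = L2conv_inner[OF R R m(3,4) b(2) l(2)]
  note L3 = L2conv_inner(1)[OF L2conv_const[OF Phi_L2(1)] Q m(5,6) b(3) l(1)]
  \<comment> \<open>This is 2 (\<phi>/\<Phi>) D\<Phi> . grad \<phi> - (\<phi>/\<Phi>)^2 |D\<Phi>|^2.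
    Expanding the square of \<open>ground_grad\<close> gives |grad \<phi>|^2 - I, while the tested
    equation evaluates the integral of I as lam times that of \<phi>^2.\<close>
  define I where "I x = inverse (\<Phi> x) * (2 * \<phi> x) * (D\<Phi> x \<bullet> grad \<phi> x) + - (inverse (\<Phi> x) * inverse (\<Phi> x)) * (\<phi> x * \<phi> x) * (D\<Phi> x \<bullet> D\<Phi> x)" for x
  have Ii: "integrable M I" unfolding I_def by (rule Bochner_Integration.integrable_add[OF L1(2) L2(2)])
  have "(\<lambda>n. lam * (\<integral>x. rcp (d n) (\<Phi> x) * \<phi> x * (\<Phi> x \<bullet> \<phi> x) \<partial>M)) \<longlonglongrightarrow> (\<integral>x. I x \<partial>M)"
    using tendsto_add[OF L1(1) L2(1)] equation_rcp[OF d t] L1(2) L2(2) unfolding I_def by simp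
  moreover have "(\<lambda>n. lam * (\<integral>x. rcp (d n) (\<Phi> x) * \<phi> x * (\<Phi> x \<bullet> \<phi> x) \<partial>M)) \<longlonglongrightarrow>
     lam * (\<integral>x. inverse (\<Phi> x) * \<phi> x * (\<Phi> x \<bullet> \<phi> x) \<partial>M)"
    by (intro tendsto_mult tendsto_const L3)
  ultimately have e1: "(\<integral>x. I x \<partial>M) = lam * (\<integral>x. inverse (\<Phi> x) * \<phi> x * (\<Phi> x \<bullet> \<phi> x) \<partial>M)"
    by (rule LIMSEQ_unique)
  have e2: "(\<integral>x. inverse (\<Phi> x) * \<phi> x * (\<Phi> x \<bullet> \<phi> x) \<partial>M) = (L2norm M \<phi>)\<^sup>2"
    unfolding L2norm_sq
  proof (rule Bochner_Integration.integral_cong[OF refl])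
    fix x assume "x \<in> space M"
    then have "\<Phi> x \<noteq> 0" using pos[of x] by simp
    then show "inverse (\<Phi> x) * \<phi> x * (\<Phi> x \<bullet> \<phi> x) = (norm (\<phi> x))\<^sup>2" by (simp add: power2_eq_square)
  qed
  have ex: "(norm (ground_grad \<phi> (grad \<phi>) x))\<^sup>2 = (norm (grad \<phi> x))\<^sup>2 - I x" for x
    unfolding ground_grad_def I_def power2_norm_eq_inner
    by (simp add: inner_simps divide_inverse inner_commute[of "grad \<phi> x" "D\<Phi> x"] algebra_simps)
  have gi: "integrable M (\<lambda>x. (norm (grad \<phi> x))\<^sup>2)" using test_L2(2)[OF t] by (simp add: L2_def)
  show "L2 M (ground_grad \<phi> (grad \<phi>))" unfolding L2_def ex
    using gi Ii by (intro conjI ground_grad_measurable test_measurable t Bochner_Integration.integrable_diff)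
  show "(L2norm M (ground_grad \<phi> (grad \<phi>)))\<^sup>2 = (L2norm M (grad \<phi>))\<^sup>2 - lam * (L2norm M \<phi>)\<^sup>2"
    using gi Ii e1 e2 unfolding L2norm_sq ex by simp
qed

text \<open>The identity for differences of test functions, with lam >= 0, bounds the transformed
  difference by the gradient difference. The transforms thus form an L2 Cauchy sequence, and an
  almost everywhere convergent subsequence identifies the limit.\<close>

lemma picone:
  assumes H: "H01 \<Omega> v Dv"
  shows "L2 M (ground_grad v Dv)" "(L2norm M (ground_grad v Dv))\<^sup>2 = (L2norm M Dv)\<^sup>2 - lam * (L2norm M v)\<^sup>2"
proof -
  obtain f where f: "\<And>n. test_fun \<Omega> (f n)" "L2conv M f v" "L2conv M (\<lambda>n. grad (f n)) Dv"
    "AE x in M. (\<lambda>n. f n x) \<longlonglongrightarrow> v x" by (rule H01_approx[OF H]) blast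
  obtain r where r: "strict_mono r" "AE x in M. (\<lambda>n. grad (f (r n)) x) \<longlonglongrightarrow> Dv x"
    using L2conv_AE_subseq[OF f(3)] by blast
  let ?T = "\<lambda>n. ground_grad (f (r n)) (grad (f (r n)))"
  have lin: "?T m x - ?T n x = ground_grad (\<lambda>x. f (r m) x - f (r n) x) (grad (\<lambda>x. f (r m) x - f (r n) x)) x" for m n x
    using smooth_diff[OF test_fun_smooth[OF f(1)]]
    by (simp add: ground_grad_def grad_diff diff_divide_distrib scaleR_diff_left)
  have cau: "L2Cauchy M ?T"
    unfolding L2Cauchy_def
  proof (intro conjI allI impI)
    show "L2 M (?T n)" for n by (rule picone_test(1)[OF f(1)])
    fix e :: real assume e: "0 < e"
    obtain N where N: "\<forall>m\<ge>N. \<forall>n\<ge>N. L2norm M (\<lambda>x. grad (f (r m)) x - grad (f (r n)) x) < e"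
      using L2CauchyD[OF L2conv_Cauchy[OF L2conv_subseq[OF f(3) r(1)]] e] by blast
    show "\<exists>N. \<forall>m\<ge>N. \<forall>n\<ge>N. L2norm M (\<lambda>x. ?T m x - ?T n x) < e"
    proof (intro exI[of _ N] allI impI)
      fix m n assume mn: "N \<le> m" "N \<le> n"
      let ?w = "\<lambda>x. f (r m) x - f (r n) x"
      have tw: "test_fun \<Omega> ?w" by (intro test_fun_diff f)
      have "(L2norm M (ground_grad ?w (grad ?w)))\<^sup>2 \<le> (L2norm M (grad ?w))\<^sup>2"
        using picone_test(2)[OF tw] lam_nonneg by simp
      then have le: "L2norm M (ground_grad ?w (grad ?w)) \<le> L2norm M (grad ?w)" by (rule power2_le_imp_le) simp
      have g: "grad ?w = (\<lambda>x. grad (f (r m)) x - grad (f (r n)) x)"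
        by (intro ext grad_diff smooth_diff test_fun_smooth[OF f(1)])
      have "L2norm M (grad ?w) < e" unfolding g using N mn by blast
      then show "L2norm M (\<lambda>x. ?T m x - ?T n x) < e" unfolding lin using le by linarith
    qed
  qed
  have lim: "AE x in M. (\<lambda>n. ?T n x) \<longlonglongrightarrow> ground_grad v Dv x"
    using f(4) r(2) AE_space
  proof eventually_elim
    case (elim x)
    have "(\<lambda>n. f (r n) x) \<longlonglongrightarrow> v x" using LIMSEQ_subseq_LIMSEQ[OF elim(1) r(1)] by (simp add: o_def)
    moreover have "\<Phi> x \<noteq> 0" using elim(3) pos[of x] by simp
    ultimately show ?case unfolding ground_grad_def using elim(2) by (intro tendsto_intros)
  qed
  have Hm: "v \<in> borel_measurable M" "Dv \<in> borel_measurable M" using H01_L2[OF H] by (auto simp: L2_def)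
  have c: "L2conv M ?T (ground_grad v Dv)"
    by (rule L2Cauchy_AE_limit[OF cau lim ground_grad_measurable[OF Hm]])
  then show "L2 M (ground_grad v Dv)" by (rule L2convD)
  have "(\<lambda>n. (L2norm M (?T n))\<^sup>2) \<longlonglongrightarrow> (L2norm M (ground_grad v Dv))\<^sup>2" by (intro tendsto_power L2conv_L2norm c)
  moreover have "(\<lambda>n. (L2norm M (grad (f (r n))))\<^sup>2 - lam * (L2norm M (f (r n)))\<^sup>2) \<longlonglongrightarrow> (L2norm M Dv)\<^sup>2 - lam * (L2norm M v)\<^sup>2"
    by (intro tendsto_intros L2conv_L2norm L2conv_subseq[OF f(2) r(1)] L2conv_subseq[OF f(3) r(1)])
  ultimately show "(L2norm M (ground_grad v Dv))\<^sup>2 = (L2norm M Dv)\<^sup>2 - lam * (L2norm M v)\<^sup>2"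
    by (simp add: picone_test(2)[OF f(1)] LIMSEQ_unique)
qed

end

section \<open>Simplicity of the first eigenvalue and the spectral gap\<close>

lemma L2norm_eq_0_AE:
  assumes "L2 M u" "L2norm M u = 0"
  shows "AE x in M. u x = 0"
proof -
  have "(\<integral>x. (norm (u x))\<^sup>2 \<partial>M) = 0" using L2norm_sq[of M u] assms(2) by simp
  then have "AE x in M. (norm (u x))\<^sup>2 = 0"
    using integral_nonneg_eq_0_iff_AE[of M "\<lambda>x. (norm (u x))\<^sup>2"] assms(1) by (simp add: L2_def)
  then show ?thesis by eventually_elim simp
qed

lemma L2norm_sq_real: "(L2norm M u)\<^sup>2 = (\<integral>x. u x * u x \<partial>M)" for u :: "'a \<Rightarrow> real"
  by (simp only: L2norm_sq real_norm_def power2_abs) (simp only: power2_eq_square)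

text \<open>Used twice: with Q = \<Phi> to produce competitors orthogonal to the ground state, and
  with Q the root of the weight, where the coefficient becomes the weighted mean.\<close>

lemma projection_orthogonal:
  fixes P Q :: "'a \<Rightarrow> real"
  assumes "L2 M P" "L2 M Q" "L2norm M Q \<noteq> 0"
  shows "(\<integral>x. (P x + (- ((\<integral>y. P y * Q y \<partial>M) / (L2norm M Q)\<^sup>2)) * Q x) * Q x \<partial>M) = 0"
proof -
  define a where "a = (\<integral>y. P y * Q y \<partial>M) / (L2norm M Q)\<^sup>2"
  have q: "(\<integral>x. Q x * Q x \<partial>M) = (L2norm M Q)\<^sup>2" by (rule L2norm_sq_real[symmetric])
  have "(\<integral>x. (P x + (- a) * Q x) * Q x \<partial>M) = (\<integral>x. P x * Q x + (- a) * (Q x * Q x) \<partial>M)"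
    by (simp add: algebra_simps)
  also have "\<dots> = (\<integral>x. P x * Q x \<partial>M) + (\<integral>x. (- a) * (Q x * Q x) \<partial>M)"
    by (rule Bochner_Integration.integral_add) (intro integrable_mult_right integrable_mult_L2 assms)+
  also have "\<dots> = 0" using assms(3) q by (simp add: a_def)
  finally show ?thesis by (simp add: a_def)
qed

text \<open>Pythagoras: changing the coefficient adds a multiple of Q, which is orthogonal to the
  residual.\<close>

lemma projection_minimal:
  fixes P Q :: "'a \<Rightarrow> real"
  assumes P: "L2 M P" and Q: "L2 M Q" "L2norm M Q \<noteq> 0"
  shows "L2norm M (\<lambda>x. P x + (- ((\<integral>y. P y * Q y \<partial>M) / (L2norm M Q)\<^sup>2)) * Q x) \<le> L2norm M (\<lambda>x. P x + c * Q x)"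
proof -
  define a where "a = (\<integral>y. P y * Q y \<partial>M) / (L2norm M Q)\<^sup>2"
  have l: "L2 M (\<lambda>x. P x + (- a) * Q x)" "L2 M (\<lambda>x. (c + a) * Q x)"
    by (intro L2_add P L2_cmult Q)+
  have "(\<integral>x. (P x + (- a) * Q x) \<bullet> ((c + a) * Q x) \<partial>M) = (c + a) * (\<integral>x. (P x + (- a) * Q x) * Q x \<partial>M)"
    by (simp add: mult_ac flip: integral_mult_right_zero)
  also have "\<dots> = 0" using projection_orthogonal[OF P Q] by (simp add: a_def)
  finally have "(L2norm M (\<lambda>x. (P x + (- a) * Q x) + (c + a) * Q x))\<^sup>2
      = (L2norm M (\<lambda>x. P x + (- a) * Q x))\<^sup>2 + (L2norm M (\<lambda>x. (c + a) * Q x))\<^sup>2"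
    using L2norm_add_sq[OF l] by simp
  moreover have "(\<lambda>x. (P x + (- a) * Q x) + (c + a) * Q x) = (\<lambda>x. P x + c * Q x)" by (simp add: fun_eq_iff algebra_simps)
  ultimately have "(L2norm M (\<lambda>x. P x + (- a) * Q x))\<^sup>2 \<le> (L2norm M (\<lambda>x. P x + c * Q x))\<^sup>2" by simp
  then show ?thesis unfolding a_def by (rule power2_le_imp_le) simp
qed

text \<open>The first order condition at a minimum, in the form needed for the Rayleigh quotient;
  the sign of E is arbitrary.\<close>

lemma linear_coeff_zero:
  fixes A E :: real
  assumes "\<And>t. 0 \<le> 2 * t * A + t\<^sup>2 * E"
  shows "A = 0"
proof -
  \<comment> \<open>With t = -A/e the expression becomes (E - 2e) A^2 / e^2, whose first factor is
    negative.\<close>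
  define e where "e = \<bar>E\<bar> + 1"
  have e: "0 < e" "E < 2 * e" by (auto simp: e_def)
  have "0 \<le> 2 * (- A / e) * A + (- A / e)\<^sup>2 * E" by (rule assms)
  then have "0 \<le> (2 * (- A / e) * A + (- A / e)\<^sup>2 * E) * (e * e)" using e by simp
  also have "\<dots> = (E - 2 * e) * (A * A)" using e by (simp add: field_simps power2_eq_square)
  finally have "0 \<le> (E - 2 * e) * (A * A)" .
  then have "A * A \<le> 0" using e by (simp add: zero_le_mult_iff)
  then show ?thesis by (metis mult_eq_0_iff not_square_less_zero order.not_eq_order_implies_strict)
qed

context ground_state
begin

text \<open>Local integrability of v/\<Phi>, the hypothesis under which \<open>weak_const\<close>
  and the comparison of weak gradients are available.\<close>

lemma quotient_integrable:
  fixes v :: "'a \<Rightarrow> real"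
  assumes v: "L2 M v" and K: "compact K" "K \<subseteq> \<Omega>"
  shows "set_integrable lebesgue K (\<lambda>x. v x / \<Phi> x)"
proof -
  have Kl: "K \<in> sets lebesgue" by (rule fmeasurableD[OF lmeasurable_compact[OF K(1)]])
  have KM: "K \<in> sets M" using Kl K(2) Omega_sets by (auto simp: sets_restrict_space_iff)
  have [measurable]: "K \<in> sets M" by (rule KM)
  obtain C where C: "AE x in M. 1 / \<Phi> x * \<bar>indicator K x\<bar> \<le> C \<and> 1 / (\<Phi> x * \<Phi> x) * \<bar>indicator K x\<bar> \<le> C"
    by (rule quotient_bounded[OF K, of "indicator K" 1]) (auto simp: indicator_def)
  have "AE x in M. \<bar>indicator K x / \<Phi> x\<bar> \<le> C"
    using C AE_space by eventually_elim (use pos in \<open>auto simp: abs_divide less_imp_le\<close>)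
  then have "L2 M (\<lambda>x. (indicator K x / \<Phi> x) *\<^sub>R v x)"
    by (intro L2_bmult v) measurable
  then have "integrable M (\<lambda>x. (indicator K x / \<Phi> x) *\<^sub>R v x)" by (rule L2_integrable(1))
  from set_integrable_compact[OF this K] show ?thesis
    unfolding set_integrable_def by (rule Bochner_Integration.integrable_cong[THEN iffD1, rotated 2]) (auto simp: indicator_def)
qed

text \<open>If the transform vanishes, v/\<Phi> has zero weak gradient, hence is constant because
  \<Omega> is connected. This is the simplicity statement.\<close>

lemma ground_grad_zero_proportional:
  assumes H: "H01 \<Omega> v Dv" and z: "L2norm M (ground_grad v Dv) = 0"
  obtains C where "AE x in M. v x = C * \<Phi> x"
proof -
  have ae: "AE x in M. ground_grad v Dv x = 0" by (rule L2norm_eq_0_AE[OF picone(1)[OF H] z])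
  obtain C where C: "AE x in M. v x / \<Phi> x = C"
  proof (rule weak_const[OF open_Omega connected, of "\<lambda>x. v x / \<Phi> x"])
    show "set_integrable lebesgue K (\<lambda>x. v x / \<Phi> x)" if "compact K" "K \<subseteq> \<Omega>" for K
      by (rule quotient_integrable[OF H01_L2(1)[OF H] that])
    show "(\<integral>x. v x / \<Phi> x * pd i \<phi> x \<partial>M) = 0" if "test_fun \<Omega> \<phi>" "i \<in> Basis" for \<phi> i
    proof -
      have "(\<integral>x. ((ground_grad v Dv x \<bullet> i) / \<Phi> x) * \<phi> x \<partial>M) = 0"
        by (rule integral_eq_zero_AE) (use ae in \<open>auto elim: eventually_mono\<close>)
      then show ?thesis using weak_quotient(1)[OF H that] by simp
    qed
  qed blast
  have "AE x in M. v x = C * \<Phi> x"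
    using C AE_space by eventually_elim (use pos in \<open>force simp: field_simps\<close>)
  then show ?thesis by (rule that)
qed

text \<open>Weak gradients are unique: G and \<open>ground_grad\<close>/\<Phi> have the same
  pairings with test functions. Both are only locally integrable, so the fundamental lemma is
  applied on small balls and the results are glued.\<close>

lemma weak_grad_quotient:
  assumes H: "H01 \<Omega> f Df" and G: "weak_grad \<Omega> (\<lambda>x. f x / \<Phi> x) G"
  shows "AE x in M. ground_grad f Df x = \<Phi> x *\<^sub>R G x"
proof (rule AE_local[OF open_Omega])
  fix y assume "y \<in> \<Omega>"
  then obtain r where r: "0 < r" "cball y r \<subseteq> \<Omega>" using open_Omega open_contains_cball by blast
  let ?B = "ball y r"
  have sub: "?B \<subseteq> \<Omega>" "?B \<subseteq> cball y r" using r by auto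
  have Bs: "?B \<in> sets lebesgue" by simp
  have onB: "integrable (lebesgue_on ?B) u" if "set_integrable lebesgue (cball y r) u" for u :: "'a \<Rightarrow> real"
  proof -
    have "set_integrable lebesgue ?B u" by (rule set_integrable_subset[OF that Bs sub(2)])
    then show ?thesis using Bs by (simp add: set_integrable_def integrable_restrict_space)
  qed
  have intB: "(\<integral>x. u x * \<psi> x \<partial>lebesgue_on ?B) = (\<integral>x. u x * \<psi> x \<partial>M)" if "test_fun ?B \<psi>" for u \<psi> :: "'a \<Rightarrow> real"
  proof -
    have "(\<lambda>x. indicator ?B x *\<^sub>R (u x * \<psi> x)) = (\<lambda>x. indicator \<Omega> x *\<^sub>R (u x * \<psi> x))"
      using test_fun_outside[OF that] sub(1) by (auto simp: fun_eq_iff indicator_def)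
    then show ?thesis using Bs Omega_sets by (simp add: integral_restrict_space)
  qed
  have bi: "integrable (lebesgue_on ?B) (\<lambda>x. u x * \<psi> x)"
    if u: "integrable (lebesgue_on ?B) u" and t: "test_fun ?B \<psi>" for u \<psi> :: "'a \<Rightarrow> real"
  proof -
    obtain D where D: "\<And>x. \<bar>\<psi> x\<bar> \<le> D" by (rule test_fun_bounded[OF t]) blast
    note b = borel_measurable_lebesgue_on_borel[OF smooth_borel[OF test_fun_smooth[OF t]], of ?B]
    show ?thesis
      by (rule Bochner_Integration.integrable_bound[OF integrable_mult_right[OF integrable_norm[OF u], of D]])
         (use D u b in \<open>auto intro!: AE_I2 simp: abs_mult mult.commute[of D] intro!: mult_left_mono order_trans[OF D abs_ge_self]\<close>)
  qed
  have each: "AE x in lebesgue_on ?B. G x \<bullet> i - (ground_grad f Df x \<bullet> i) / \<Phi> x = 0" if i: "i \<in> Basis" for i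
  proof (rule fundamental_zero)
    have "set_integrable lebesgue (cball y r) G" using G r by (simp add: weak_grad_def)
    then have "set_integrable lebesgue (cball y r) (\<lambda>x. G x \<bullet> i)"
      unfolding set_integrable_def using integrable_inner_left[of i lebesgue "\<lambda>x. indicator (cball y r) x *\<^sub>R G x"]
      by (simp add: set_integrable_def)
    then have i1: "integrable (lebesgue_on ?B) (\<lambda>x. G x \<bullet> i)" by (rule onB)
    have i2: "integrable (lebesgue_on ?B) (\<lambda>x. (ground_grad f Df x \<bullet> i) / \<Phi> x)"
      by (intro onB quotient_integrable L2_inner_left picone(1)[OF H] r) simp
    show "integrable (lebesgue_on ?B) (\<lambda>x. G x \<bullet> i - (ground_grad f Df x \<bullet> i) / \<Phi> x)"
      by (rule Bochner_Integration.integrable_diff[OF i1 i2])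
    fix \<psi> assume t: "test_fun ?B \<psi>"
    have t': "test_fun \<Omega> \<psi>" by (rule test_fun_mono[OF t sub(1)])
    have "(\<integral>x. (f x / \<Phi> x) * (grad \<psi> x \<bullet> i) \<partial>M) = - (\<integral>x. (G x \<bullet> i) * \<psi> x \<partial>M)"
      using G t' i unfolding weak_grad_def LINT_M by blast
    then have e: "(\<integral>x. (G x \<bullet> i) * \<psi> x \<partial>M) = (\<integral>x. ((ground_grad f Df x \<bullet> i) / \<Phi> x) * \<psi> x \<partial>M)"
      using weak_quotient(1)[OF H t' i] i by (simp add: grad_inner)
    have "(\<integral>x. (G x \<bullet> i - (ground_grad f Df x \<bullet> i) / \<Phi> x) * \<psi> x \<partial>lebesgue_on ?B) =
      (\<integral>x. (G x \<bullet> i) * \<psi> x \<partial>lebesgue_on ?B) - (\<integral>x. ((ground_grad f Df x \<bullet> i) / \<Phi> x) * \<psi> x \<partial>lebesgue_on ?B)"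
      unfolding left_diff_distrib by (rule Bochner_Integration.integral_diff[OF bi[OF i1 t] bi[OF i2 t]])
    also have "\<dots> = 0" unfolding intB[OF t] e by simp
    finally show "(\<integral>x. (G x \<bullet> i - (ground_grad f Df x \<bullet> i) / \<Phi> x) * \<psi> x \<partial>lebesgue_on ?B) = 0" .
  qed simp
  have "AE x in lebesgue_on ?B. \<forall>i\<in>Basis. G x \<bullet> i - (ground_grad f Df x \<bullet> i) / \<Phi> x = 0"
    using each by (intro AE_finite_allI) auto
  then have "AE x in lebesgue_on ?B. x \<in> \<Omega> \<longrightarrow> ground_grad f Df x = \<Phi> x *\<^sub>R G x"
  proof eventually_elim
    case (elim x)
    show ?case
    proof
      assume "x \<in> \<Omega>"
      then have "\<Phi> x \<noteq> 0" using pos[of x] by simp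
      show "ground_grad f Df x = \<Phi> x *\<^sub>R G x"
      proof (rule euclidean_eqI)
        fix i :: 'a assume "i \<in> Basis"
        then have "G x \<bullet> i = (ground_grad f Df x \<bullet> i) / \<Phi> x" using elim by simp
        then show "ground_grad f Df x \<bullet> i = (\<Phi> x *\<^sub>R G x) \<bullet> i" using \<open>\<Phi> x \<noteq> 0\<close> by simp
      qed
    qed
  qed
  then show "\<exists>r>0. AE x in lebesgue_on (ball y r). x \<in> \<Omega> \<longrightarrow> ground_grad f Df x = \<Phi> x *\<^sub>R G x"
    using r(1) by blast
qed

definition admissible :: "('a \<Rightarrow> real) \<Rightarrow> ('a \<Rightarrow> 'a) \<Rightarrow> bool" where
  "admissible h Dh \<longleftrightarrow> H01 \<Omega> h Dh \<and> (\<integral>x. h x * \<Phi> x \<partial>M) = 0"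

lemma admissible_lincomb:
  assumes "admissible h Dh" "admissible k Dk"
  shows "admissible (\<lambda>x. h x + c * k x) (\<lambda>x. Dh x + c *\<^sub>R Dk x)"
proof -
  have i: "integrable M (\<lambda>x. h x * \<Phi> x)" "integrable M (\<lambda>x. k x * \<Phi> x)"
    using assms by (auto simp: admissible_def intro!: integrable_mult_L2 H01_L2(1) Phi_L2)
  have "(\<integral>x. (h x + c * k x) * \<Phi> x \<partial>M) = (\<integral>x. h x * \<Phi> x + c * (k x * \<Phi> x) \<partial>M)"
    by (simp add: algebra_simps)
  also have "\<dots> = 0" using i assms by (simp add: admissible_def)
  finally show ?thesis using assms H01_lincomb by (auto simp: admissible_def)
qed

lemma admissible_scale:
  assumes "admissible h Dh"
  shows "admissible (\<lambda>x. c * h x) (\<lambda>x. c *\<^sub>R Dh x)"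
proof -
  have "H01 \<Omega> (\<lambda>x. 0) (\<lambda>x. 0)" using H01_test[OF test_fun_zero] by (simp add: grad_const[abs_def])
  then have "admissible (\<lambda>x. 0) (\<lambda>x. 0)" by (simp add: admissible_def)
  from admissible_lincomb[OF this assms, of c] show ?thesis by simp
qed

lemma admissible_project:
  assumes "H01 \<Omega> f Df"
  shows "admissible (\<lambda>x. f x + (- ((\<integral>y. f y * \<Phi> y \<partial>M) / (L2norm M \<Phi>)\<^sup>2)) * \<Phi> x)
    (\<lambda>x. Df x + (- ((\<integral>y. f y * \<Phi> y \<partial>M) / (L2norm M \<Phi>)\<^sup>2)) *\<^sub>R D\<Phi> x)"
  unfolding admissible_def
  by (intro conjI H01_lincomb[OF assms H01_Phi]
      projection_orthogonal[OF H01_L2(1)[OF assms] Phi_L2(1) less_imp_neq[OF Phi_L2norm, symmetric]])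

text \<open>The infimum of the Rayleigh quotient over the orthogonal complement of the ground state is
  attained, by Rellich compactness and the parallelogram identity.\<close>

lemma minimizer_exists:
  assumes ex: "admissible h0 Dh0" "L2norm M h0 \<noteq> 0"
  obtains v Dv \<mu> where "admissible v Dv" "L2norm M v = 1" "(L2norm M Dv)\<^sup>2 = \<mu>"
    "\<And>h Dh. admissible h Dh \<Longrightarrow> \<mu> * (L2norm M h)\<^sup>2 \<le> (L2norm M Dh)\<^sup>2"
proof -
  have L: "L2 M h" "L2 M Dh" if "admissible h Dh" for h Dh
    using that H01_L2 by (auto simp: admissible_def)
  define X where "X = {(L2norm M Dh)\<^sup>2 |h Dh. admissible h Dh \<and> L2norm M h = 1}"
  define \<mu> where "\<mu> = Inf X"
  have bdd: "bdd_below X" by (rule bdd_belowI[of _ 0]) (auto simp: X_def)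
  have norm1: "L2norm M (\<lambda>x. (1 / L2norm M h) * h x) = 1" if "L2norm M h \<noteq> 0" for h :: "'a \<Rightarrow> real"
    using L2norm_scaleR[of M "1 / L2norm M h" h] that by simp
  have "(L2norm M (\<lambda>x. (1 / L2norm M h0) *\<^sub>R Dh0 x))\<^sup>2 \<in> X"
    unfolding X_def using admissible_scale[OF ex(1), of "1 / L2norm M h0"] norm1[OF ex(2)] by blast
  then have ne: "X \<noteq> {}" by blast
  have \<mu>0: "0 \<le> \<mu>" unfolding \<mu>_def by (rule cInf_greatest[OF ne]) (auto simp: X_def)
  have ray: "\<mu> * (L2norm M h)\<^sup>2 \<le> (L2norm M Dh)\<^sup>2" if a: "admissible h Dh" for h Dh
  proof (cases "L2norm M h = 0")
    case False
    have "(L2norm M (\<lambda>x. (1 / L2norm M h) *\<^sub>R Dh x))\<^sup>2 \<in> X"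
      unfolding X_def using admissible_scale[OF a, of "1 / L2norm M h"] norm1[OF False] by blast
    then have "\<mu> \<le> (L2norm M (\<lambda>x. (1 / L2norm M h) *\<^sub>R Dh x))\<^sup>2" unfolding \<mu>_def by (rule cInf_lower[OF _ bdd])
    also have "\<dots> = (L2norm M Dh)\<^sup>2 / (L2norm M h)\<^sup>2" by (simp add: L2norm_scaleR power_mult_distrib power_divide)
    finally show ?thesis using False by (simp add: pos_le_divide_eq)
  qed simp
  have "\<exists>h Dh. admissible h Dh \<and> L2norm M h = 1 \<and> (L2norm M Dh)\<^sup>2 < \<mu> + 1 / real (Suc n)" for n
  proof -
    have "Inf X < \<mu> + 1 / real (Suc n)" by (simp add: \<mu>_def)
    then obtain z where "z \<in> X" "z < \<mu> + 1 / real (Suc n)" using cInf_less_iff[OF ne bdd] by blast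
    then show ?thesis unfolding X_def by blast
  qed
  then obtain h Dh where h: "\<And>n. admissible (h n) (Dh n)" "\<And>n. L2norm M (h n) = 1"
    "\<And>n. (L2norm M (Dh n))\<^sup>2 < \<mu> + 1 / real (Suc n)" by metis
  have Hh: "H01 \<Omega> (h n) (Dh n)" for n using h(1) by (simp add: admissible_def)
  \<comment> \<open>It exceeds the energy bound \<mu> + 1, and C >= 1 gives C <= C^2, so it bounds
    the gradient norms as well as the unit norms.\<close>
  define C where "C = \<mu> + 2"
  have C0: "0 \<le> C" "1 \<le> C" using \<mu>0 unfolding C_def by linarith+
  have Cn: "L2norm M (Dh n) \<le> C" for n
  proof -
    have "(L2norm M (Dh n))\<^sup>2 \<le> \<mu> + 1 / real (Suc n)" using h(3)[of n] by simp
    also have "\<dots> \<le> \<mu> + 1" by simp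
    also have "\<dots> \<le> C" by (simp add: C_def)
    also have "C \<le> C\<^sup>2" using mult_left_mono[OF C0(2,1)] by (simp add: power2_eq_square)
    finally show ?thesis by (rule power2_le_imp_le) (rule C0)
  qed
  have C1: "L2norm M (h n) \<le> C" for n using h(2)[of n] \<mu>0 by (simp add: C_def)
  obtain s :: "nat \<Rightarrow> nat" where s: "strict_mono s" "L2Cauchy M (\<lambda>n. h (s n))"
    by (rule H01_rellich[of h Dh C, OF Hh C1 Cn]) blast
  \<comment> \<open>The sum of two competitors is again a competitor and has energy at least \<mu>
    times its squared norm. In the parallelogram identity this forces the gradients of
    near-minimizers together once their values are close.\<close>
  have par: "(L2norm M (\<lambda>x. Dh m x - Dh n x))\<^sup>2 \<le> 2 / real (Suc m) + 2 / real (Suc n) + \<mu> * (L2norm M (\<lambda>x. h m x - h n x))\<^sup>2" for m n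
  proof -
    note l = L[OF h(1)[of m]] L[OF h(1)[of n]]
    have mi: "(L2norm M (\<lambda>x. (-1) *\<^sub>R u x))\<^sup>2 = (L2norm M u)\<^sup>2" for u :: "'a \<Rightarrow> 'c::euclidean_space"
      by (simp only: L2norm_scaleR) simp
    have pl: "(L2norm M (\<lambda>x. u x - w x))\<^sup>2 = 2 * (L2norm M u)\<^sup>2 + 2 * (L2norm M w)\<^sup>2 - (L2norm M (\<lambda>x. u x + w x))\<^sup>2"
      if "L2 M u" "L2 M w" for u w :: "'a \<Rightarrow> 'c::euclidean_space"
      using L2norm_add_sq[OF that] L2norm_add_sq[OF that(1) L2_scaleR[OF that(2), of "-1"]] mi[of w] by simp
    have "admissible (\<lambda>x. h m x + 1 * h n x) (\<lambda>x. Dh m x + 1 *\<^sub>R Dh n x)" by (rule admissible_lincomb[OF h(1) h(1)])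
    from ray[OF this] have "\<mu> * (L2norm M (\<lambda>x. h m x + h n x))\<^sup>2 \<le> (L2norm M (\<lambda>x. Dh m x + Dh n x))\<^sup>2" by simp
    moreover have "\<mu> * (L2norm M (\<lambda>x. h m x + h n x))\<^sup>2 = \<mu> * (4 - (L2norm M (\<lambda>x. h m x - h n x))\<^sup>2)"
      using pl[OF l(1,3)] h(2) by simp
    ultimately show ?thesis using pl[OF l(2,4)] h(3)[of m] h(3)[of n] by (simp add: algebra_simps)
  qed
  have cD: "L2Cauchy M (\<lambda>n. Dh (s n))"
    unfolding L2Cauchy_def
  proof (intro conjI allI impI)
    show "L2 M (Dh (s n))" for n by (rule L(2)[OF h(1)])
    fix e :: real assume e: "0 < e"
    \<comment> \<open>The value term then contributes at most e^2/4, and the choice of N2 keeps the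
      two defect terms below e^2/2 together, leaving a total below e^2.\<close>
    define d where "d = (e / 2) / (\<mu> + 1)"
    have d: "0 < d" using e \<mu>0 by (simp add: d_def)
    obtain N1 where N1: "\<forall>m\<ge>N1. \<forall>n\<ge>N1. L2norm M (\<lambda>x. h (s m) x - h (s n) x) < d"
      using L2CauchyD[OF s(2) d] by blast
    obtain N2 where N2: "1 / real (Suc N2) < e\<^sup>2 / 8" using nat_approx_posE[of "e\<^sup>2 / 8"] e by auto
    show "\<exists>N. \<forall>m\<ge>N. \<forall>n\<ge>N. L2norm M (\<lambda>x. Dh (s m) x - Dh (s n) x) < e"
    proof (intro exI[of _ "max N1 N2"] allI impI)
      fix m n assume mn: "max N1 N2 \<le> m" "max N1 N2 \<le> n"
      have inv: "1 / real (Suc (s k)) < e\<^sup>2 / 8" if "N2 \<le> k" for k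
      proof -
        have "N2 \<le> s k" using seq_suble[OF s(1), of k] that by simp
        then have "1 / real (Suc (s k)) \<le> 1 / real (Suc N2)" by (simp add: frac_le)
        then show ?thesis using N2 by simp
      qed
      have "L2norm M (\<lambda>x. h (s m) x - h (s n) x) < d" using N1 mn by simp
      then have "(L2norm M (\<lambda>x. h (s m) x - h (s n) x))\<^sup>2 \<le> d\<^sup>2" by (intro power_mono) auto
      then have "\<mu> * (L2norm M (\<lambda>x. h (s m) x - h (s n) x))\<^sup>2 \<le> \<mu> * d\<^sup>2" using \<mu>0 by (rule mult_left_mono)
      also have "\<dots> \<le> (\<mu> + 1)\<^sup>2 * d\<^sup>2"
        using \<mu>0 by (intro mult_right_mono) (auto simp: power2_eq_square algebra_simps)
      also have "\<dots> = ((\<mu> + 1) * d)\<^sup>2" by (simp only: power_mult_distrib)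
      also have "(\<mu> + 1) * d = e / 2"
      proof -
        have "q * ((e / 2) / q) = e / 2" if "q \<noteq> 0" for q :: real using that by simp
        then show ?thesis unfolding d_def using \<mu>0 by (smt (verit))
      qed
      also have "(e / 2)\<^sup>2 = e\<^sup>2 / 4" by (simp add: power_divide)
      finally have b: "\<mu> * (L2norm M (\<lambda>x. h (s m) x - h (s n) x))\<^sup>2 \<le> e\<^sup>2 / 4" .
      have two: "2 / real (Suc k) = 2 * (1 / real (Suc k))" for k by simp
      have "1 / real (Suc (s m)) < e\<^sup>2 / 8" "1 / real (Suc (s n)) < e\<^sup>2 / 8" using inv mn by auto
      moreover have "0 < e\<^sup>2" using e by simp
      ultimately have "(L2norm M (\<lambda>x. Dh (s m) x - Dh (s n) x))\<^sup>2 < e\<^sup>2"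
        using par[of "s m" "s n"] b unfolding two by linarith
      then show "L2norm M (\<lambda>x. Dh (s m) x - Dh (s n) x) < e" by (rule power2_less_imp_less) (use e in simp)
    qed
  qed
  obtain v where v: "L2conv M (\<lambda>n. h (s n)) v" by (rule L2_complete[OF s(2)])
  obtain Dv where Dv: "L2conv M (\<lambda>n. Dh (s n)) Dv" by (rule L2_complete[OF cD])
  have Hv: "H01 \<Omega> v Dv" by (rule H01_closed[OF Hh v Dv])
  have "(\<lambda>n. \<integral>x. h (s n) x * \<Phi> x \<partial>M) \<longlonglongrightarrow> (\<integral>x. v x * \<Phi> x \<partial>M)"
    using L2conv_inner1[OF v L2conv_const[OF Phi_L2(1)]] by simp
  then have "(\<integral>x. v x * \<Phi> x \<partial>M) = 0" using h(1) by (simp add: admissible_def LIMSEQ_const_iff)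
  then have av: "admissible v Dv" using Hv by (simp add: admissible_def)
  have v1: "L2norm M v = 1" using L2conv_L2norm[OF v] h(2) by (simp add: LIMSEQ_const_iff)
  have lim: "(\<lambda>n. (L2norm M (Dh (s n)))\<^sup>2) \<longlonglongrightarrow> (L2norm M Dv)\<^sup>2" by (intro tendsto_power L2conv_L2norm Dv)
  have "(\<lambda>n. \<mu> + 1 / real (Suc (s n))) \<longlonglongrightarrow> \<mu> + 0"
    using LIMSEQ_subseq_LIMSEQ[OF LIMSEQ_inverse_real_of_nat s(1)]
    by (intro tendsto_add tendsto_const) (simp add: o_def inverse_eq_divide)
  from LIMSEQ_le[OF lim this] have "(L2norm M Dv)\<^sup>2 \<le> \<mu>" using h(3) by (auto intro: less_imp_le)
  moreover have "\<mu> \<le> (L2norm M Dv)\<^sup>2" using ray[OF av] v1 by simp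
  ultimately have "(L2norm M Dv)\<^sup>2 = \<mu>" by simp
  with av v1 show ?thesis using ray by (rule that)
qed

text \<open>The variation is free only within the orthogonal complement of \<Phi>. An arbitrary test
  function is first projected, and the correction along \<Phi> drops out because both v and Dv are
  orthogonal to \<Phi> and D\<Phi>.\<close>

lemma minimizer_eigen:
  assumes v: "admissible v Dv" "L2norm M v = 1" "(L2norm M Dv)\<^sup>2 = \<mu>"
    and ray: "\<And>h Dh. admissible h Dh \<Longrightarrow> \<mu> * (L2norm M h)\<^sup>2 \<le> (L2norm M Dh)\<^sup>2"
  shows "eigen \<mu> v Dv"
  unfolding eigen_def
proof (intro conjI allI impI)
  show Hv: "H01 \<Omega> v Dv" using v(1) by (simp add: admissible_def)
  note Lv = H01_L2[OF Hv]
  have vP: "(\<integral>x. \<Phi> x * v x \<partial>M) = 0" using v(1) by (simp add: admissible_def mult.commute)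
  \<comment> \<open>The equation of \<Phi>, tested with v, reduces this to the orthogonality of v
    and \<Phi>.\<close>
  have DvP: "(\<integral>x. Dv x \<bullet> D\<Phi> x \<partial>M) = 0"
    using eigen_H01[OF eig Hv] vP by (simp add: inner_commute)
  fix \<phi> assume t: "test_fun \<Omega> \<phi>"
  define c where "c = - ((\<integral>y. \<phi> y * \<Phi> y \<partial>M) / (L2norm M \<Phi>)\<^sup>2)"
  define k where "k x = \<phi> x + c * \<Phi> x" for x
  define Dk where "Dk x = grad \<phi> x + c *\<^sub>R D\<Phi> x" for x
  have ak: "admissible k Dk"
    using admissible_project[OF H01_test[OF t]] unfolding k_def[abs_def] Dk_def[abs_def] c_def .
  then have Lk: "L2 M k" "L2 M Dk" using H01_L2 by (auto simp: admissible_def)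
  define A where "A = (\<integral>x. Dv x \<bullet> Dk x \<partial>M) - \<mu> * (\<integral>x. v x * k x \<partial>M)"
  have "A = 0"
  proof (rule linear_coeff_zero)
    fix t :: real
    have "(L2norm M (\<lambda>x. v x + t * k x))\<^sup>2 = 1 + 2 * t * (\<integral>x. v x * k x \<partial>M) + t\<^sup>2 * (L2norm M k)\<^sup>2"
      using L2norm_add_sq[OF Lv(1) L2_scaleR[OF Lk(1), of t]] v(2) L2norm_scaleR[of M t k]
      by (simp add: mult.left_commute power_mult_distrib)
    moreover have "(L2norm M (\<lambda>x. Dv x + t *\<^sub>R Dk x))\<^sup>2 = \<mu> + 2 * t * (\<integral>x. Dv x \<bullet> Dk x \<partial>M) + t\<^sup>2 * (L2norm M Dk)\<^sup>2"
      using L2norm_add_sq[OF Lv(2) L2_scaleR[OF Lk(2), of t]] v(3) L2norm_scaleR[of M t Dk]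
      by (simp add: power_mult_distrib)
    ultimately show "0 \<le> 2 * t * A + t\<^sup>2 * ((L2norm M Dk)\<^sup>2 - \<mu> * (L2norm M k)\<^sup>2)"
      using ray[OF admissible_lincomb[OF v(1) ak, of t]] by (simp add: A_def algebra_simps)
  qed
  moreover have "(\<integral>x. Dv x \<bullet> Dk x \<partial>M) = (\<integral>x. Dv x \<bullet> grad \<phi> x \<partial>M)"
  proof -
    have "(\<integral>x. Dv x \<bullet> Dk x \<partial>M) = (\<integral>x. Dv x \<bullet> grad \<phi> x + c * (Dv x \<bullet> D\<Phi> x) \<partial>M)"
      by (simp add: Dk_def inner_add_right)
    also have "\<dots> = (\<integral>x. Dv x \<bullet> grad \<phi> x \<partial>M) + (\<integral>x. c * (Dv x \<bullet> D\<Phi> x) \<partial>M)"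
      by (intro Bochner_Integration.integral_add integrable_mult_right integrable_inner Lv Phi_L2 test_L2[OF t])
    finally show ?thesis using DvP by simp
  qed
  moreover have "(\<integral>x. v x * k x \<partial>M) = (\<integral>x. v x * \<phi> x \<partial>M)"
  proof -
    have "(\<integral>x. v x * k x \<partial>M) = (\<integral>x. v x * \<phi> x + c * (\<Phi> x * v x) \<partial>M)"
      by (simp add: k_def algebra_simps)
    also have "\<dots> = (\<integral>x. v x * \<phi> x \<partial>M) + (\<integral>x. c * (\<Phi> x * v x) \<partial>M)"
      by (intro Bochner_Integration.integral_add integrable_mult_right integrable_mult_L2 Lv Phi_L2 test_L2[OF t])
    finally show ?thesis using vP by simp
  qed
  ultimately show "(\<integral>x. Dv x \<bullet> grad \<phi> x \<partial>M) = \<mu> * (\<integral>x. v x * \<phi> x \<partial>M)" by (simp add: A_def)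
qed

text \<open>The minimum \<mu> is an eigenvalue, so \<mu> >= lam. Equality would annihilate the
  transform of v by \<open>picone\<close>, making v a multiple of \<Phi>; orthogonality then gives v
  = 0 against its unit norm. Hence \<mu> > lam, and the choice of lam2 applies.\<close>

lemma spectral_gap:
  assumes first: "\<And>l u Du. eigen l u Du \<Longrightarrow> 0 < L2norm M u \<Longrightarrow> lam \<le> l"
    and second: "\<And>l u Du. eigen l u Du \<Longrightarrow> 0 < L2norm M u \<Longrightarrow> lam < l \<Longrightarrow> lam2 \<le> l"
    and h: "admissible h Dh"
  shows "lam2 * (L2norm M h)\<^sup>2 \<le> (L2norm M Dh)\<^sup>2"
proof (cases "L2norm M h = 0")
  case False
  obtain v Dv \<mu> where v: "admissible v Dv" "L2norm M v = 1" "(L2norm M Dv)\<^sup>2 = \<mu>"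
    and ray: "\<And>h Dh. admissible h Dh \<Longrightarrow> \<mu> * (L2norm M h)\<^sup>2 \<le> (L2norm M Dh)\<^sup>2"
    by (rule minimizer_exists[OF h False]) blast
  have e: "eigen \<mu> v Dv" by (rule minimizer_eigen[OF v ray])
  have Hv: "H01 \<Omega> v Dv" using v(1) by (simp add: admissible_def)
  have "lam \<le> \<mu>" using first[OF e] v(2) by simp
  moreover have "\<mu> \<noteq> lam"
  proof
    assume "\<mu> = lam"
    then have "L2norm M (ground_grad v Dv) = 0" using picone(2)[OF Hv] v(2,3) by simp
    then obtain C where C: "AE x in M. v x = C * \<Phi> x" by (rule ground_grad_zero_proportional[OF Hv])
    have [measurable]: "v \<in> borel_measurable M" using H01_L2(1)[OF Hv] by (simp add: L2_def)
    have "AE x in M. v x * \<Phi> x = C * (\<Phi> x * \<Phi> x)" using C by eventually_elim simp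
    then have "(\<integral>x. v x * \<Phi> x \<partial>M) = (\<integral>x. C * (\<Phi> x * \<Phi> x) \<partial>M)"
      by (rule integral_cong_AE[rotated 2]) measurable
    also have "\<dots> = C * (L2norm M \<Phi>)\<^sup>2" by (simp add: L2norm_sq_real)
    finally have "C = 0" using v(1) Phi_L2norm by (simp add: admissible_def)
    then have "AE x in M. norm (v x) = norm (0 :: real)" using C by simp
    then have "L2norm M v = L2norm M (\<lambda>x. 0 :: real)" by (rule L2norm_cong_AE) measurable
    then show False using v(2) by (simp add: L2norm_def)
  qed
  ultimately have "lam2 \<le> \<mu>" using second[OF e] v(2) by simp
  then have "lam2 * (L2norm M h)\<^sup>2 \<le> \<mu> * (L2norm M h)\<^sup>2" by (rule mult_right_mono) simp
  also have "\<dots> \<le> (L2norm M Dh)\<^sup>2" by (rule ray[OF h])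
  finally show ?thesis .
qed simp

text \<open>Adding a multiple of \<Phi> to f leaves \<open>ground_grad\<close> unchanged on
  \<Omega>, so f may be replaced by its projection, for which \<open>picone\<close> and
  \<open>spectral_gap\<close> combine. The constant c is minus the mean of f/\<Phi> for the weight
  \<Phi>^2.\<close>

lemma weighted_poincare:
  assumes first: "\<And>l u Du. eigen l u Du \<Longrightarrow> 0 < L2norm M u \<Longrightarrow> lam \<le> l"
    and second: "\<And>l u Du. eigen l u Du \<Longrightarrow> 0 < L2norm M u \<Longrightarrow> lam < l \<Longrightarrow> lam2 \<le> l"
    and f: "H01 \<Omega> f Df"
  obtains c where "(lam2 - lam) * (L2norm M (\<lambda>x. f x + c * \<Phi> x))\<^sup>2 \<le> (L2norm M (ground_grad f Df))\<^sup>2"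
proof -
  define c where "c = - ((\<integral>y. f y * \<Phi> y \<partial>M) / (L2norm M \<Phi>)\<^sup>2)"
  define h where "h x = f x + c * \<Phi> x" for x
  define Dh where "Dh x = Df x + c *\<^sub>R D\<Phi> x" for x
  have a: "admissible h Dh"
    using admissible_project[OF f] unfolding h_def[abs_def] Dh_def[abs_def] c_def .
  then have H: "H01 \<Omega> h Dh" by (simp add: admissible_def)
  have "ground_grad h Dh x = ground_grad f Df x" if "x \<in> \<Omega>" for x
    using pos[OF that] by (simp add: ground_grad_def h_def Dh_def add_divide_distrib algebra_simps)
  then have "L2norm M (ground_grad h Dh) = L2norm M (ground_grad f Df)"
    using picone(1)[OF f] picone(1)[OF H] by (intro L2norm_cong_AE AE_I2) (auto simp: L2_def)
  then have "(lam2 - lam) * (L2norm M h)\<^sup>2 \<le> (L2norm M (ground_grad f Df))\<^sup>2"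
    using picone(2)[OF H] spectral_gap[OF first second a] by (simp add: algebra_simps)
  then show ?thesis using that unfolding h_def[abs_def] by blast
qed

end

section \<open>From the weight \<Phi>^2 to powers of S\<close>

theorem mainTheorem12:
  fixes \<Omega> :: "'a::euclidean_space set"
    and S \<Phi>1 f g :: "'a \<Rightarrow> real" and G :: "'a \<Rightarrow> 'a"
    and m k0 k1 lam1 lam2 :: real
  assumes dom: "smooth_bounded_domain \<Omega>"
    and lam1: "dirichlet_eigenvalue \<Omega> lam1" "\<And>l. dirichlet_eigenvalue \<Omega> l \<Longrightarrow> lam1 \<le> l"
    and lam2: "dirichlet_eigenvalue \<Omega> lam2" "lam1 < lam2"
              "\<And>l. dirichlet_eigenvalue \<Omega> l \<Longrightarrow> lam1 < l \<Longrightarrow> lam2 \<le> l"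
    and Phi1: "dirichlet_eigenpair \<Omega> lam1 \<Phi>1" "\<And>x. x \<in> \<Omega> \<Longrightarrow> \<Phi>1 x > 0"
              "(LINT x:\<Omega>|lebesgue. (\<Phi>1 x)\<^sup>2) = 1"
    and m: "0 < m" "m \<le> 1"
    and S: "S \<in> borel_measurable (lebesgue_on \<Omega>)" "bounded (S ` \<Omega>)"
           "\<And>x. x \<in> \<Omega> \<Longrightarrow> S x > 0"
    and k: "0 < k0" "k0 \<le> k1"
           "\<And>x. x \<in> \<Omega> \<Longrightarrow> k0 * \<Phi>1 x \<le> S x powr m \<and> S x powr m \<le> k1 * \<Phi>1 x"
    and f: "f \<in> W012_0 \<Omega>"
    and g: "\<And>x. g x = f x / \<Phi>1 x"
    and G: "weak_grad \<Omega> g G"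
  shows "ennreal ((lam2 - lam1) * k0\<^sup>2 /
            (k1\<^sup>2 * real_of_ereal (esssup (lebesgue_on \<Omega>) S) powr (1 - m)))
         * (\<integral>\<^sup>+x\<in>\<Omega>. ennreal ((g x - (LINT y:\<Omega>|lebesgue. g y * S y powr (1 + m))
                                        / (LINT y:\<Omega>|lebesgue. S y powr (1 + m)))\<^sup>2
                                 * S x powr (1 + m)) \<partial>lebesgue)
       \<le> (\<integral>\<^sup>+x\<in>\<Omega>. ennreal ((norm (G x))\<^sup>2 * S x powr (2 * m)) \<partial>lebesgue)"
proof -
  let ?M = "lebesgue_on \<Omega>"
  have op: "open \<Omega>" "bounded \<Omega>" "\<Omega> \<noteq> {}" "connected \<Omega>"
    using dom by (auto simp: smooth_bounded_domain_def)
  interpret bounded_open \<Omega> by unfold_locales (fact op)+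
  obtain D\<Phi> where e: "eigen lam1 \<Phi>1 D\<Phi>" using Phi1(1) unfolding dirichlet_eigenpair_iff by blast
  interpret ground_state \<Omega> \<Phi>1 D\<Phi> lam1 by unfold_locales (fact op e Phi1(2))+
  have first: "lam1 \<le> l" and second: "lam1 < l \<Longrightarrow> lam2 \<le> l"
    if "eigen l u Du" "0 < L2norm ?M u" for l u Du
    using lam1(2)[of l] lam2(3)[of l] that unfolding dirichlet_eigenvalue_def dirichlet_eigenpair_iff by blast+
  obtain Df where Hf: "H01 \<Omega> f Df" using f by (auto simp: W012_0_def)
  obtain c where c: "(lam2 - lam1) * (L2norm ?M (\<lambda>x. f x + c * \<Phi>1 x))\<^sup>2 \<le> (L2norm ?M (ground_grad f Df))\<^sup>2"
    by (rule weighted_poincare[OF first second Hf]) blast+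
  have gf: "g = (\<lambda>x. f x / \<Phi>1 x)" using g by (simp add: fun_eq_iff)
  have aeG: "AE x in ?M. ground_grad f Df x = \<Phi>1 x *\<^sub>R G x" by (rule weak_grad_quotient[OF Hf G[unfolded gf]])
  have gP: "g x * \<Phi>1 x = f x" if "x \<in> \<Omega>" for x using Phi1(2)[OF that] by (simp add: g)
  have [measurable]: "S \<in> borel_measurable ?M" by (rule S(1))
  have fm[measurable]: "f \<in> borel_measurable ?M" using H01_L2(1)[OF Hf] by (simp add: L2_def)
  have gm[measurable]: "g \<in> borel_measurable ?M" unfolding gf by measurable

  \<comment> \<open>The conversion to a real is faithful only for a finite value; boundedness of S
    excludes infinity from above, positivity of S from below.\<close>
  define E where "E = real_of_ereal (esssup ?M S)"
  have SE: "AE x in ?M. S x \<le> E" and E0: "0 < E"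
  proof -
    obtain B0 where B0: "\<And>x. x \<in> \<Omega> \<Longrightarrow> S x \<le> B0"
      using S(2) unfolding bounded_iff by (auto dest: abs_le_D1)
    have up: "esssup ?M S \<le> ereal B0"
      by (rule esssup_I) (use B0 in auto)
    have ae: "AE x in ?M. ereal (S x) \<le> esssup ?M S" by (rule esssup_AE)
    then have al: "AE x in lebesgue. x \<in> \<Omega> \<longrightarrow> ereal (S x) \<le> esssup ?M S"
      using Omega_sets by (subst (asm) AE_restrict_space_iff) auto
    \<comment> \<open>A single point at which the essential bound holds gives the positive lower
      bound for \<open>E\<close>.\<close>
    obtain x where x: "x \<in> \<Omega>" "ereal (S x) \<le> esssup ?M S" using AE_open_ex[OF op(1,3) al] by blast
    have "ereal 0 < ereal (S x)" using S(3)[OF x(1)] by simp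
    then have lo: "ereal 0 < esssup ?M S" using x(2) by (rule less_le_trans)
    have eq: "esssup ?M S = ereal E"
      unfolding E_def using up lo by (cases "esssup ?M S") auto
    show "AE x in ?M. S x \<le> E" using ae unfolding eq by simp
    show "0 < E" using lo unfolding eq by simp
  qed
  define K where "K = k1\<^sup>2 * E powr (1 - m)"
  have K0: "0 < K" using k E0 by (simp add: K_def)
  define w where "w x = S x powr (1 + m)" for x
  \<comment> \<open>The exponent is split as (1 - m) + 2m: the first part is increasing in S because
    m <= 1, and the second is bounded by k1 \<Phi>.\<close>
  have wle: "AE x in ?M. w x \<le> K * (\<Phi>1 x)\<^sup>2"
    using SE AE_space
  proof eventually_elim
    case (elim x)
    then have x: "x \<in> \<Omega>" by simp
    have "w x = S x powr (1 - m) * (S x powr m)\<^sup>2"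
      by (simp add: w_def power2_eq_square add.commute flip: powr_add)
    also have "\<dots> \<le> E powr (1 - m) * (k1 * \<Phi>1 x)\<^sup>2"
      using elim S(3)[OF x] m k(3)[OF x] by (intro mult_mono powr_mono2 power_mono) auto
    finally show ?case by (simp add: K_def power_mult_distrib mult_ac)
  qed
  have wn: "0 \<le> w x" for x by (simp add: w_def)
  have [measurable]: "w \<in> borel_measurable ?M" unfolding w_def by measurable
  \<comment> \<open>Absorbing the root of the weight turns weighted L2 statements into plain ones: P
    + aQ is (g + a) times that root, and the pairing of P with Q is the integral of g against the
    weight.\<close>
  define P where "P x = g x * sqrt (w x)" for x
  define Q where "Q x = sqrt (w x)" for x
  have [measurable]: "P \<in> borel_measurable ?M" "Q \<in> borel_measurable ?M" unfolding P_def Q_def by measurable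
  have le: "AE x in ?M. norm (P x + a * Q x) \<le> norm (sqrt K *\<^sub>R (f x + a * \<Phi>1 x))" for a
    using wle AE_space
  proof eventually_elim
    case (elim x)
    then have x: "x \<in> \<Omega>" by simp
    have "sqrt (w x) \<le> sqrt K * \<Phi>1 x"
      using real_sqrt_le_mono[OF elim(1)] Phi1(2)[OF x] by (simp add: real_sqrt_mult)
    then have "\<bar>g x + a\<bar> * sqrt (w x) \<le> \<bar>g x + a\<bar> * (sqrt K * \<Phi>1 x)" by (rule mult_left_mono) simp
    moreover have "norm (P x + a * Q x) = \<bar>g x + a\<bar> * sqrt (w x)"
      using wn[of x] by (simp add: P_def Q_def abs_mult flip: distrib_right)
    moreover have "norm (sqrt K *\<^sub>R (f x + a * \<Phi>1 x)) = \<bar>g x + a\<bar> * (sqrt K * \<Phi>1 x)"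
      using K0 Phi1(2)[OF x] by (simp add: gP[OF x, symmetric] abs_mult flip: distrib_right)
    ultimately show ?case by simp
  qed
  have Lf: "L2 ?M (\<lambda>x. sqrt K *\<^sub>R (f x + a * \<Phi>1 x))" for a
    by (intro L2_scaleR L2_add H01_L2(1)[OF Hf] L2_cmult Phi_L2)
  \<comment> \<open>The domination by f + a \<Phi> holds for each a; taking a = 0 and a = 1 and
    subtracting yields membership of P and Q separately.\<close>
  have LPa: "L2 ?M (\<lambda>x. P x + a * Q x)" for a
  proof (rule L2_bound)
    show "integrable ?M (\<lambda>x. (norm (sqrt K *\<^sub>R (f x + a * \<Phi>1 x)))\<^sup>2)" using Lf[of a] by (simp only: L2_def)
    show "AE x in ?M. (norm (P x + a * Q x))\<^sup>2 \<le> (norm (sqrt K *\<^sub>R (f x + a * \<Phi>1 x)))\<^sup>2"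
      using le[of a] by eventually_elim (rule power_mono, auto)
  qed measurable
  have LP: "L2 ?M P" using LPa[of 0] by simp
  have LQ: "L2 ?M Q" using L2_diff[OF LPa[of 1] LP] by simp
  have Q0: "L2norm ?M Q \<noteq> 0"
  proof
    assume "L2norm ?M Q = 0"
    then have "AE x in ?M. Q x = 0" by (rule L2norm_eq_0_AE[OF LQ])
    then have al: "AE x in lebesgue. x \<in> \<Omega> \<longrightarrow> Q x = 0"
      using Omega_sets by (subst (asm) AE_restrict_space_iff) auto
    obtain x where "x \<in> \<Omega>" "Q x = 0" using AE_open_ex[OF op(1,3) al] by blast
    then show False using S(3)[of x] by (simp add: Q_def w_def)
  qed
  have gw: "(\<integral>x. g x * w x \<partial>?M) = (\<integral>x. P x * Q x \<partial>?M)" and ww: "(\<integral>x. w x \<partial>?M) = (L2norm ?M Q)\<^sup>2"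
    using wn by (simp_all add: P_def Q_def L2norm_sq mult.assoc)
  \<comment> \<open>The weighted mean of g appears as the projection coefficient of P along
    Q.\<close>
  define a where "a = (\<integral>x. P x * Q x \<partial>?M) / (L2norm ?M Q)\<^sup>2"
  have mean: "(LINT y:\<Omega>|lebesgue. g y * S y powr (1 + m)) / (LINT y:\<Omega>|lebesgue. S y powr (1 + m)) = a"
    unfolding LINT_M a_def gw[symmetric] ww[symmetric] w_def ..
  have "(\<integral>\<^sup>+x\<in>\<Omega>. ennreal ((g x - a)\<^sup>2 * S x powr (1 + m)) \<partial>lebesgue)
      = (\<integral>\<^sup>+x. ennreal ((norm (P x + (- a) * Q x))\<^sup>2) \<partial>?M)"
    unfolding nn_M
  proof (rule nn_integral_cong)
    fix x
    have "P x + (- a) * Q x = (g x - a) * sqrt (w x)" by (simp add: P_def Q_def algebra_simps)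
    then have "(norm (P x + (- a) * Q x))\<^sup>2 = (g x - a)\<^sup>2 * w x" using wn[of x] by (simp add: power_mult_distrib)
    then show "ennreal ((g x - a)\<^sup>2 * S x powr (1 + m)) = ennreal ((norm (P x + (- a) * Q x))\<^sup>2)"
      by (simp add: w_def)
  qed
  also have "\<dots> = ennreal ((L2norm ?M (\<lambda>x. P x + (- a) * Q x))\<^sup>2)" by (rule L2norm_nn[OF LPa])
  finally have lhs: "(\<integral>\<^sup>+x\<in>\<Omega>. ennreal ((g x - a)\<^sup>2 * S x powr (1 + m)) \<partial>lebesgue)
      = ennreal ((L2norm ?M (\<lambda>x. P x + (- a) * Q x))\<^sup>2)" .
  \<comment> \<open>The constant c belongs to the weight \<Phi>^2 and not to the present one.
    Minimality of the projection permits it on the right, after which the weights can be compared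
    pointwise.\<close>
  have "L2norm ?M (\<lambda>x. P x + (- a) * Q x) \<le> L2norm ?M (\<lambda>x. P x + c * Q x)"
    unfolding a_def by (rule projection_minimal[OF LP LQ Q0])
  also have "\<dots> \<le> L2norm ?M (\<lambda>x. sqrt K *\<^sub>R (f x + c * \<Phi>1 x))"
    by (rule L2norm_mono_AE[OF Lf _ le]) measurable
  finally have "(L2norm ?M (\<lambda>x. P x + (- a) * Q x))\<^sup>2 \<le> (L2norm ?M (\<lambda>x. sqrt K *\<^sub>R (f x + c * \<Phi>1 x)))\<^sup>2"
    by (rule power_mono) simp
  also have "\<dots> = K * (L2norm ?M (\<lambda>x. f x + c * \<Phi>1 x))\<^sup>2"
    using K0 by (simp only: L2norm_scaleR power_mult_distrib) simp
  finally have PQ: "(L2norm ?M (\<lambda>x. P x + (- a) * Q x))\<^sup>2 \<le> K * (L2norm ?M (\<lambda>x. f x + c * \<Phi>1 x))\<^sup>2" .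
  \<comment> \<open>The factor K cancels against the comparison of weights on the left, and k0^2 is
    reserved for the comparison on the right.\<close>
  define C where "C = (lam2 - lam1) * k0\<^sup>2 / K"
  have C0: "0 \<le> C" using lam2(2) K0 by (simp add: C_def)
  have "C * (L2norm ?M (\<lambda>x. P x + (- a) * Q x))\<^sup>2 \<le> C * (K * (L2norm ?M (\<lambda>x. f x + c * \<Phi>1 x))\<^sup>2)"
    by (rule mult_left_mono[OF PQ C0])
  also have "\<dots> = k0\<^sup>2 * ((lam2 - lam1) * (L2norm ?M (\<lambda>x. f x + c * \<Phi>1 x))\<^sup>2)"
    using K0 by (simp add: C_def)
  also have "\<dots> \<le> k0\<^sup>2 * (L2norm ?M (ground_grad f Df))\<^sup>2" by (rule mult_left_mono[OF c]) simp
  also have "\<dots> = (L2norm ?M (\<lambda>x. k0 *\<^sub>R ground_grad f Df x))\<^sup>2" by (simp add: L2norm_scaleR power_mult_distrib)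
  finally have main: "C * (L2norm ?M (\<lambda>x. P x + (- a) * Q x))\<^sup>2 \<le> (L2norm ?M (\<lambda>x. k0 *\<^sub>R ground_grad f Df x))\<^sup>2" .
  have "ennreal C * (\<integral>\<^sup>+x\<in>\<Omega>. ennreal ((g x - a)\<^sup>2 * S x powr (1 + m)) \<partial>lebesgue)
      = ennreal (C * (L2norm ?M (\<lambda>x. P x + (- a) * Q x))\<^sup>2)"
    unfolding lhs using C0 by (simp add: ennreal_mult)
  also have "\<dots> \<le> ennreal ((L2norm ?M (\<lambda>x. k0 *\<^sub>R ground_grad f Df x))\<^sup>2)" by (rule ennreal_leI[OF main])
  also have "\<dots> = (\<integral>\<^sup>+x. ennreal ((norm (k0 *\<^sub>R ground_grad f Df x))\<^sup>2) \<partial>?M)"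
    by (rule L2norm_nn[symmetric, OF L2_scaleR[OF picone(1)[OF Hf]]])
  \<comment> \<open>Here \<open>ground_grad\<close> is \<Phi> G almost everywhere, and k0 \<Phi> <=
    S^m gives the integrand bound. The right side is kept as a nonnegative integral and may be
    infinite.\<close>
  also have "\<dots> \<le> (\<integral>\<^sup>+x. ennreal ((norm (G x))\<^sup>2 * S x powr (2 * m)) \<partial>?M)"
  proof (rule nn_integral_mono_AE)
    show "AE x in ?M. ennreal ((norm (k0 *\<^sub>R ground_grad f Df x))\<^sup>2) \<le> ennreal ((norm (G x))\<^sup>2 * S x powr (2 * m))"
      using aeG AE_space
    proof eventually_elim
      case (elim x)
      then have x: "x \<in> \<Omega>" by simp
      have "S x powr (2 * m) = (S x powr m)\<^sup>2"
        by (simp add: power2_eq_square flip: powr_add)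
      moreover have "(k0 * \<Phi>1 x)\<^sup>2 \<le> (S x powr m)\<^sup>2"
        using k Phi1(2)[OF x] x by (intro power_mono) auto
      ultimately have "(norm (G x))\<^sup>2 * (k0 * \<Phi>1 x)\<^sup>2 \<le> (norm (G x))\<^sup>2 * S x powr (2 * m)"
        by (intro mult_left_mono) simp_all
      then show ?case unfolding elim(1) by (intro ennreal_leI) (simp add: power_mult_distrib mult_ac)
    qed
  qed
  finally show ?thesis
    unfolding mean nn_M[symmetric] C_def K_def E_def .
qed

end
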